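(* Let $\mathcal C$ be an extensive category. The category $\mathsf{FC}(\mathcal C,\mathbf{Set})$ of finite-coproduct-preserving functors $\mathcal C\to\mathbf{Set}$ (and natural transformations) is equivalent to the functor category $[\mathcal{UF}_{\mathcal C},\mathbf{Set}]$. Under this equivalence (whose two directions $A\mapsto\tilde A$ and $B\mapsto\int B$ are given in the context), the representable functor $\mathcal{UF}_{\mathcal C}((X,\mathcal U),-)$ at $(X,\mathcal U)\in\mathcal{UF}_{\mathcal C}$ corresponds to the "ultrahom functor" $$\mathcal C(X,-)_{\mathcal U}=\operatorname{colim}_{U\in\mathcal U}\mathcal C(U,-)\colon\mathcal C\to\mathbf{Set}.$$
   Context: A category $\mathcal C$ with finite coproducts is extensive if for all $A,B\in\mathcal C$ the functor $+\colon\mathcal C/A\times\mathcal C/B\to\mathcal C/(A+B)$ is an equivalence of categories. In such a category, coproduct coprojections are monic, and pullbacks along them exist and are again coproduct coprojections. $\mathrm{Sum}_{\mathcal C}(X)$ is the poset of isomorphism classes of coproduct coprojections with codomain $X$; it is a Boolean algebra, and for $f\colon X\to Y$ pullback gives a Boolean algebra homomorphism $f^{-1}\colon\mathrm{Sum}_{\mathcal C}(Y)\to\mathrm{Sum}_{\mathcal C}(X)$. An ultrafilter on $X\in\mathcal C$ is an ultrafilter of the Boolean algebra $\mathrm{Sum}_{\mathcal C}(X)$; $\beta X$ is the set of these. For $f\colon X\to Y$ and $\mathcal U\in\beta X$, $f_!(\mathcal U)=\{V\in\mathrm{Sum}_{\mathcal C}(Y):f^{-1}(V)\in\mathcal U\}\in\beta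 Y$. The category $\mathcal{UF}_{\mathcal C}$ has as objects pairs $(X,\mathcal U)$ with $X\in\mathcal C$, $\mathcal U\in\beta X$. A map $f\colon U\to Y$ defined on the domain of some $U\rightarrowtail X$ in $\mathcal U$ (a partial map $X\rightharpoonup Y$) is continuous $(X,\mathcal U)\rightharpoonup(Y,\mathcal V)$ if for all $V\in\mathrm{Sum}_{\mathcal C}(Y)$: $V\in\mathcal V$ iff the composite $f^{-1}(V)\rightarrowtail U\rightarrowtail X$ is in $\mathcal U$. Two partial maps defined on $U$, $U'$ are $=_{\mathcal U}$-equivalent if their restrictions to some $W\subseteq U\cap U'$ in $\mathcal U$ coincide. Morphisms $(X,\mathcal U)\to(Y,\mathcal V)$ are $=_{\mathcal U}$-equivalence classes $[f]$ of partial continuous maps defined on the domain of some element of $\mathcal U$. The equivalence: $A\in\mathsf{FC}(\mathcal C,\mathbf{Set})$ is sent to $\tilde A$ with $\tilde A(X,\mathcal U)=\bigcap_{U\in\mathcal U}\operatorname{im}(AU\to AX)\subseteq AX$, and with $\tilde A([f])\colon x\mapsto Af(x')$ for $f\colon U\to Y$ a representative and $x'\in AU$ the unique lifting of $x$ through $AU\rightarrowtail AX$. In the other direction, $B\in[\mathcal{UF}_{\mathcal C},\mathbf{Set}]$ is sent to $\int B$ with $(\int B)Y=\sum_{\mathcal V\in\beta Y}B(Y,\mathcal V)$ and $(\int B)f\colon(\mathcal V,a)\mapsto(f_!(\mathcal V),B([f])(a))$. In the ultrahom functor, the colimit is over $\mathcal U$ ordered by inclusion (with transition maps given by restriction). 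*)

theory Defs
  imports Main "HOL-Library.FuncSet"
begin

section \<open>Categories\<close>

record ('o, 'a) cat =
  Obj :: "'o set"
  Arr :: "'a set"
  Dom :: "'a \<Rightarrow> 'o"
  Cod :: "'a \<Rightarrow> 'o"
  Id :: "'o \<Rightarrow> 'a"
  Comp :: "'a \<Rightarrow> 'a \<Rightarrow> 'a"  \<comment> \<open>\<^term>\<open>Comp C g f\<close> is \<open>g\<close> after \<open>f\<close>\<close>

definition Hom :: "('o, 'a) cat \<Rightarrow> 'o \<Rightarrow> 'o \<Rightarrow> 'a set" where
  "Hom C X Y = {f \<in> Arr C. Dom C f = X \<and> Cod C f = Y}"

locale category =
  fixes C :: "('o, 'a) cat"
  assumes Dom_Obj: "f \<in> Arr C \<Longrightarrow> Dom C f \<in> Obj C"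
    and Cod_Obj: "f \<in> Arr C \<Longrightarrow> Cod C f \<in> Obj C"
    and Id_Hom: "X \<in> Obj C \<Longrightarrow> Id C X \<in> Hom C X X"
    and Comp_Hom: "f \<in> Hom C X Y \<Longrightarrow> g \<in> Hom C Y Z \<Longrightarrow> Comp C g f \<in> Hom C X Z"
    and Comp_Id: "f \<in> Hom C X Y \<Longrightarrow> Comp C f (Id C X) = f"
    and Id_Comp: "f \<in> Hom C X Y \<Longrightarrow> Comp C (Id C Y) f = f"
    and Comp_assoc: "f \<in> Hom C W X \<Longrightarrow> g \<in> Hom C X Y \<Longrightarrow> h \<in> Hom C Y Z
      \<Longrightarrow> Comp C h (Comp C g f) = Comp C (Comp C h g) f"

definition is_iso :: "('o, 'a) cat \<Rightarrow> 'a \<Rightarrow> bool" where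
  "is_iso C f \<longleftrightarrow> f \<in> Arr C \<and>
     (\<exists>g \<in> Hom C (Cod C f) (Dom C f).
        Comp C g f = Id C (Dom C f) \<and> Comp C f g = Id C (Cod C f))"

definition isomorphic :: "('o, 'a) cat \<Rightarrow> 'o \<Rightarrow> 'o \<Rightarrow> bool" where
  "isomorphic C X Y \<longleftrightarrow> (\<exists>f \<in> Hom C X Y. is_iso C f)"

definition is_initial :: "('o, 'a) cat \<Rightarrow> 'o \<Rightarrow> bool" where
  "is_initial C Z \<longleftrightarrow> Z \<in> Obj C \<and> (\<forall>X \<in> Obj C. \<exists>!f. f \<in> Hom C Z X)"

definition is_coproduct :: "('o, 'a) cat \<Rightarrow> 'a \<Rightarrow> 'a \<Rightarrow> bool" where
  "is_coproduct C i j \<longleftrightarrow> i \<in> Arr C \<and> j \<in> Arr C \<and> Cod C i = Cod C j \<and>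
     (\<forall>Y. \<forall>f \<in> Hom C (Dom C i) Y. \<forall>g \<in> Hom C (Dom C j) Y.
        \<exists>!u. u \<in> Hom C (Cod C i) Y \<and> Comp C u i = f \<and> Comp C u j = g)"

definition is_pullback :: "('o, 'a) cat \<Rightarrow> 'a \<Rightarrow> 'a \<Rightarrow> 'a \<Rightarrow> 'a \<Rightarrow> bool" where
  \<comment> \<open>the span \<open>(p, q)\<close> is a pullback of the cospan \<open>(f, g)\<close>, with \<open>f p = g q\<close>\<close>
  "is_pullback C p q f g \<longleftrightarrow> f \<in> Arr C \<and> g \<in> Arr C \<and> Cod C f = Cod C g \<and>
     p \<in> Hom C (Dom C p) (Dom C f) \<and> q \<in> Hom C (Dom C p) (Dom C g) \<and>
     Comp C f p = Comp C g q \<and>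
     (\<forall>T. \<forall>p' \<in> Hom C T (Dom C f). \<forall>q' \<in> Hom C T (Dom C g). Comp C f p' = Comp C g q' \<longrightarrow>
        (\<exists>!h. h \<in> Hom C T (Dom C p) \<and> Comp C p h = p' \<and> Comp C q h = q'))"

definition has_finite_coproducts :: "('o, 'a) cat \<Rightarrow> bool" where
  "has_finite_coproducts C \<longleftrightarrow> (\<exists>Z. is_initial C Z) \<and>
     (\<forall>A \<in> Obj C. \<forall>B \<in> Obj C. \<exists>i j. is_coproduct C i j \<and> Dom C i = A \<and> Dom C j = B)"


section \<open>Functors, natural transformations, equivalences\<close>

datatype ('o, 'a, 'p, 'b) fnctr = Functor (ob: "'o \<Rightarrow> 'p") (ar: "'a \<Rightarrow> 'b")

definition is_functor :: "('o, 'a) cat \<Rightarrow> ('p, 'b) cat \<Rightarrow> ('o, 'a, 'p, 'b) fnctr \<Rightarrow> bool" where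
  "is_functor C D F \<longleftrightarrow> category C \<and> category D \<and>
     (\<forall>X \<in> Obj C. ob F X \<in> Obj D) \<and>
     (\<forall>f \<in> Arr C. ar F f \<in> Hom D (ob F (Dom C f)) (ob F (Cod C f))) \<and>
     (\<forall>X \<in> Obj C. ar F (Id C X) = Id D (ob F X)) \<and>
     (\<forall>f \<in> Arr C. \<forall>g \<in> Arr C. Dom C g = Cod C f \<longrightarrow>
        ar F (Comp C g f) = Comp D (ar F g) (ar F f))"

definition id_functor :: "('o, 'a, 'o, 'a) fnctr" where
  "id_functor = Functor (\<lambda>X. X) (\<lambda>f. f)"

definition comp_functor ::
    "('p, 'b, 'q, 'c) fnctr \<Rightarrow> ('o, 'a, 'p, 'b) fnctr \<Rightarrow> ('o, 'a, 'q, 'c) fnctr" where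
  "comp_functor G F = Functor (ob G \<circ> ob F) (ar G \<circ> ar F)"

definition nat_trans :: "('o, 'a) cat \<Rightarrow> ('p, 'b) cat \<Rightarrow> ('o, 'a, 'p, 'b) fnctr \<Rightarrow>
    ('o, 'a, 'p, 'b) fnctr \<Rightarrow> ('o \<Rightarrow> 'b) \<Rightarrow> bool" where
  "nat_trans C D F G \<alpha> \<longleftrightarrow>
     (\<forall>X \<in> Obj C. \<alpha> X \<in> Hom D (ob F X) (ob G X)) \<and>
     (\<forall>f \<in> Arr C. Comp D (ar G f) (\<alpha> (Dom C f)) = Comp D (\<alpha> (Cod C f)) (ar F f))"

definition naturally_isomorphic :: "('o, 'a) cat \<Rightarrow> ('p, 'b) cat \<Rightarrow>
    ('o, 'a, 'p, 'b) fnctr \<Rightarrow> ('o, 'a, 'p, 'b) fnctr \<Rightarrow> bool" where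
  "naturally_isomorphic C D F G \<longleftrightarrow>
     (\<exists>\<alpha>. nat_trans C D F G \<alpha> \<and> (\<forall>X \<in> Obj C. is_iso D (\<alpha> X)))"

definition equivalence :: "('o, 'a) cat \<Rightarrow> ('p, 'b) cat \<Rightarrow>
    ('o, 'a, 'p, 'b) fnctr \<Rightarrow> ('p, 'b, 'o, 'a) fnctr \<Rightarrow> bool" where
  "equivalence C D F G \<longleftrightarrow> is_functor C D F \<and> is_functor D C G \<and>
     naturally_isomorphic C C (comp_functor G F) id_functor \<and>
     naturally_isomorphic D D (comp_functor F G) id_functor"

definition is_equivalence ::
    "('o, 'a) cat \<Rightarrow> ('p, 'b) cat \<Rightarrow> ('o, 'a, 'p, 'b) fnctr \<Rightarrow> bool" where
  "is_equivalence C D F \<longleftrightarrow> (\<exists>G. equivalence C D F G)"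

text \<open>
  Morphisms carrying their source and target, so that hom-sets are disjoint; they serve as the
  arrows of slice categories, of functor categories, of the category of sets and of the category
  of ultrafilters.
\<close>

datatype ('p, 'q) arrow = Arrow (src: 'p) (tgt: 'p) (val: 'q)

text \<open>
  Functors and transformations are required to be extensional (\<^term>\<open>undefined\<close> off
  the objects and arrows of \<open>C\<close>), so that equality in the functor category is
  equality of functors and of transformations.
\<close>

definition functor_cat :: "('o, 'a) cat \<Rightarrow> ('p, 'b) cat \<Rightarrow>
    (('o, 'a, 'p, 'b) fnctr, (('o, 'a, 'p, 'b) fnctr, 'o \<Rightarrow> 'b) arrow) cat" where
  "functor_cat C D =
    (let Fs = {F. is_functor C D F \<and> ob F \<in> extensional (Obj C) \<and> ar F \<in> extensional (Arr C)} in
     \<lparr> Obj = Fs,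
       Arr = {Arrow F G \<alpha> | F G \<alpha>.
                F \<in> Fs \<and> G \<in> Fs \<and> nat_trans C D F G \<alpha> \<and> \<alpha> \<in> extensional (Obj C)},
       Dom = src,
       Cod = tgt,
       Id = (\<lambda>F. Arrow F F (\<lambda>X \<in> Obj C. Id D (ob F X))),
       Comp = (\<lambda>\<beta> \<alpha>. Arrow (src \<alpha>) (tgt \<beta>) (\<lambda>X \<in> Obj C. Comp D (val \<beta> X) (val \<alpha> X))) \<rparr>)"

definition full_subcat :: "('o, 'a) cat \<Rightarrow> ('o \<Rightarrow> bool) \<Rightarrow> ('o, 'a) cat" where
  "full_subcat C P =
    C\<lparr> Obj := {X \<in> Obj C. P X}, Arr := {f \<in> Arr C. P (Dom C f) \<and> P (Cod C f)} \<rparr>"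

definition prod_cat :: "('o, 'a) cat \<Rightarrow> ('p, 'b) cat \<Rightarrow> ('o \<times> 'p, 'a \<times> 'b) cat" where
  "prod_cat C D =
    \<lparr> Obj = Obj C \<times> Obj D,
      Arr = Arr C \<times> Arr D,
      Dom = (\<lambda>(f, g). (Dom C f, Dom D g)),
      Cod = (\<lambda>(f, g). (Cod C f, Cod D g)),
      Id = (\<lambda>(X, Y). (Id C X, Id D Y)),
      Comp = (\<lambda>(f', g') (f, g). (Comp C f' f, Comp D g' g)) \<rparr>"

definition slice_cat :: "('o, 'a) cat \<Rightarrow> 'o \<Rightarrow> ('a, ('a, 'a) arrow) cat" where
  "slice_cat C A =
    \<lparr> Obj = {f \<in> Arr C. Cod C f = A},
      Arr = {Arrow f g h | f g h. f \<in> Arr C \<and> g \<in> Arr C \<and> Cod C f = A \<and> Cod C g = A \<and>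
               h \<in> Hom C (Dom C f) (Dom C g) \<and> Comp C g h = f},
      Dom = src,
      Cod = tgt,
      Id = (\<lambda>f. Arrow f f (Id C (Dom C f))),
      Comp = (\<lambda>k h. Arrow (src h) (tgt k) (Comp C (val k) (val h))) \<rparr>"

definition is_colimit :: "('j, 'k) cat \<Rightarrow> ('o, 'a) cat \<Rightarrow> ('j, 'k, 'o, 'a) fnctr \<Rightarrow>
    'o \<Rightarrow> ('j \<Rightarrow> 'a) \<Rightarrow> bool" where
  "is_colimit J C D L \<kappa> \<longleftrightarrow>
    (let is_cocone = (\<lambda>M \<mu>. M \<in> Obj C \<and> (\<forall>j \<in> Obj J. \<mu> j \<in> Hom C (ob D j) M) \<and>
           (\<forall>t \<in> Arr J. Comp C (\<mu> (Cod J t)) (ar D t) = \<mu> (Dom J t))) in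
     is_functor J C D \<and> is_cocone L \<kappa> \<and>
     (\<forall>M \<mu>. is_cocone M \<mu> \<longrightarrow>
        (\<exists>!u. u \<in> Hom C L M \<and> (\<forall>j \<in> Obj J. Comp C u (\<kappa> j) = \<mu> j))))"


section \<open>Extensive categories\<close>

text \<open>
  Binary coproducts are chosen arbitrarily; whether a category is extensive does not depend
  on the choice.
\<close>

definition coproj :: "('o, 'a) cat \<Rightarrow> 'o \<Rightarrow> 'o \<Rightarrow> 'a \<times> 'a" where
  "coproj C A B = (SOME (i, j). is_coproduct C i j \<and> Dom C i = A \<and> Dom C j = B)"

definition coprod :: "('o, 'a) cat \<Rightarrow> 'o \<Rightarrow> 'o \<Rightarrow> 'o" where
  "coprod C A B = Cod C (fst (coproj C A B))"

definition coprod_map :: "('o, 'a) cat \<Rightarrow> 'a \<Rightarrow> 'a \<Rightarrow> 'a" where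
  "coprod_map C f g =
    (let (i, j) = coproj C (Dom C f) (Dom C g); (i', j') = coproj C (Cod C f) (Cod C g) in
     THE u. u \<in> Hom C (Cod C i) (Cod C i') \<and>
            Comp C u i = Comp C i' f \<and> Comp C u j = Comp C j' g)"

definition slice_coprod_functor :: "('o, 'a) cat \<Rightarrow>
    ('a \<times> 'a, ('a, 'a) arrow \<times> ('a, 'a) arrow, 'a, ('a, 'a) arrow) fnctr" where
  "slice_coprod_functor C = Functor
     (\<lambda>(f, g). coprod_map C f g)
     (\<lambda>(h, k). Arrow (coprod_map C (src h) (src k)) (coprod_map C (tgt h) (tgt k))
                  (coprod_map C (val h) (val k)))"

definition extensive :: "('o, 'a) cat \<Rightarrow> bool" where
  "extensive C \<longleftrightarrow> category C \<and> has_finite_coproducts C \<and>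
     (\<forall>A \<in> Obj C. \<forall>B \<in> Obj C.
        is_equivalence (prod_cat (slice_cat C A) (slice_cat C B)) (slice_cat C (coprod C A B))
          (slice_coprod_functor C))"


section \<open>Summands and ultrafilters\<close>

definition coprojection :: "('o, 'a) cat \<Rightarrow> 'a \<Rightarrow> bool" where
  "coprojection C m \<longleftrightarrow> (\<exists>n. is_coproduct C m n)"

definition iso_class :: "('o, 'a) cat \<Rightarrow> 'a \<Rightarrow> 'a set" where
  "iso_class C m = {Comp C m h | h. is_iso C h \<and> Cod C h = Dom C m}"

definition Summands :: "('o, 'a) cat \<Rightarrow> 'o \<Rightarrow> 'a set set" where
  "Summands C X = {iso_class C m | m. coprojection C m \<and> Cod C m = X}"

definition summand_le :: "('o, 'a) cat \<Rightarrow> 'a set \<Rightarrow> 'a set \<Rightarrow> bool" where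
  "summand_le C U V \<longleftrightarrow>
     (\<exists>m \<in> U. \<exists>n \<in> V. \<exists>h \<in> Hom C (Dom C m) (Dom C n). Comp C n h = m)"

definition preimage :: "('o, 'a) cat \<Rightarrow> 'a \<Rightarrow> 'a set \<Rightarrow> 'a set" where
  \<comment> \<open>all pullbacks of members of the class \<open>V\<close> along \<open>f\<close>; these form one isomorphism class\<close>
  "preimage C f V = {p. \<exists>v \<in> V. \<exists>q. is_pullback C p q f v}"

definition is_filter :: "'x set \<Rightarrow> ('x \<Rightarrow> 'x \<Rightarrow> bool) \<Rightarrow> 'x set \<Rightarrow> bool" where
  "is_filter P le F \<longleftrightarrow> F \<subseteq> P \<and> F \<noteq> {} \<and>
     (\<forall>x \<in> F. \<forall>y \<in> P. le x y \<longrightarrow> y \<in> F) \<and>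
     (\<forall>x \<in> F. \<forall>y \<in> F. \<exists>z \<in> F. le z x \<and> le z y)"

definition is_ultrafilter :: "'x set \<Rightarrow> ('x \<Rightarrow> 'x \<Rightarrow> bool) \<Rightarrow> 'x set \<Rightarrow> bool" where
  "is_ultrafilter P le F \<longleftrightarrow> is_filter P le F \<and> F \<noteq> P \<and>
     (\<forall>G. is_filter P le G \<and> F \<subseteq> G \<and> G \<noteq> P \<longrightarrow> G = F)"

definition ultrafilters :: "('o, 'a) cat \<Rightarrow> 'o \<Rightarrow> 'a set set set" where
  "ultrafilters C X = {\<U>. is_ultrafilter (Summands C X) (summand_le C) \<U>}"

definition push_ultrafilter :: "('o, 'a) cat \<Rightarrow> 'a \<Rightarrow> 'a set set \<Rightarrow> 'a set set" where
  "push_ultrafilter C f \<U> = {V \<in> Summands C (Cod C f). preimage C f V \<in> \<U>}"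


section \<open>The category of ultrafilters\<close>

type_synonym ('o, 'a) uf = "'o \<times> 'a set set"

text \<open>
  A partial map is a pair \<open>(m, f)\<close> of a coprojection \<open>m\<close> representing its
  domain of definition and a map \<open>f\<close> on the domain of \<open>m\<close>. Post-composing the
  isomorphism class \<^term>\<open>preimage C f W\<close> elementwise with \<open>m\<close> gives the
  isomorphism class of the composite coprojection.
\<close>

definition partial_continuous ::
    "('o, 'a) cat \<Rightarrow> ('o, 'a) uf \<Rightarrow> ('o, 'a) uf \<Rightarrow> ('a \<times> 'a) set" where
  "partial_continuous C P Q =
    {(m, f). coprojection C m \<and> Cod C m = fst P \<and> iso_class C m \<in> snd P \<and>
             f \<in> Hom C (Dom C m) (fst Q) \<and>
             (\<forall>W \<in> Summands C (fst Q).
                W \<in> snd Q \<longleftrightarrow> (\<lambda>i. Comp C m i) ` preimage C f W \<in> snd P)}"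

definition germ_eq :: "('o, 'a) cat \<Rightarrow> 'a set set \<Rightarrow> 'a \<times> 'a \<Rightarrow> 'a \<times> 'a \<Rightarrow> bool" where
  "germ_eq C \<U> = (\<lambda>(m, f) (m', f').
     \<exists>w. coprojection C w \<and> iso_class C w \<in> \<U> \<and>
       (\<exists>a \<in> Hom C (Dom C w) (Dom C m). \<exists>a' \<in> Hom C (Dom C w) (Dom C m').
          Comp C m a = w \<and> Comp C m' a' = w \<and> Comp C f a = Comp C f' a'))"

definition germ :: "('o, 'a) cat \<Rightarrow> ('o, 'a) uf \<Rightarrow> ('o, 'a) uf \<Rightarrow> 'a \<times> 'a \<Rightarrow>
    (('o, 'a) uf, ('a \<times> 'a) set) arrow" where
  "germ C P Q r = Arrow P Q {s \<in> partial_continuous C P Q. germ_eq C (snd P) r s}"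

text \<open>
  The composite of the germs of \<open>(m, f)\<close> and \<open>(n, g)\<close> is the germ of the
  composite partial map, defined on the pullback of \<open>n\<close> along \<open>f\<close>.
\<close>

definition UF :: "('o, 'a) cat \<Rightarrow> (('o, 'a) uf, (('o, 'a) uf, ('a \<times> 'a) set) arrow) cat" where
  "UF C =
    (let Ps = {(X, \<U>). X \<in> Obj C \<and> \<U> \<in> ultrafilters C X} in
     \<lparr> Obj = Ps,
       Arr = {germ C P Q r | P Q r. P \<in> Ps \<and> Q \<in> Ps \<and> r \<in> partial_continuous C P Q},
       Dom = src,
       Cod = tgt,
       Id = (\<lambda>(X, \<U>). germ C (X, \<U>) (X, \<U>) (Id C X, Id C X)),
       Comp = (\<lambda>\<psi> \<phi>. Arrow (src \<phi>) (tgt \<psi>)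
         {s \<in> partial_continuous C (src \<phi>) (tgt \<psi>).
            \<exists>(m, f) \<in> val \<phi>. \<exists>(n, g) \<in> val \<psi>. \<exists>i q. is_pullback C i q f n \<and>
              germ_eq C (snd (src \<phi>)) (Comp C m i, Comp C g q) s}) \<rparr>)"


section \<open>Set-valued functors\<close>

text \<open>
  The category of sets has as objects all subsets of a type \<open>'s\<close>, which plays the role of
  the universe. Sets formed outside \<open>'s\<close> (hom-sets, disjoint unions) are transported into
  it along functions that are injective on them; these are passed as parameters.
\<close>

definition Set_cat :: "('s set, ('s set, 's \<Rightarrow> 's) arrow) cat" where
  "Set_cat =
    \<lparr> Obj = UNIV,
      Arr = {Arrow A B f | A B f. f \<in> A \<rightarrow>\<^sub>E B},
      Dom = src,
      Cod = tgt,
      Id = (\<lambda>A. Arrow A A (\<lambda>x \<in> A. x)),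
      Comp = (\<lambda>g f. Arrow (src f) (tgt g) (compose (src f) (val g) (val f))) \<rparr>"

type_synonym ('o, 'a, 's) set_fnctr = "('o, 'a, 's set, ('s set, 's \<Rightarrow> 's) arrow) fnctr"

type_synonym ('o, 'a, 's) set_trans =
  "(('o, 'a, 's) set_fnctr, 'o \<Rightarrow> ('s set, 's \<Rightarrow> 's) arrow) arrow"

definition preserves_finite_coproducts ::
    "('o, 'a) cat \<Rightarrow> ('p, 'b) cat \<Rightarrow> ('o, 'a, 'p, 'b) fnctr \<Rightarrow> bool" where
  "preserves_finite_coproducts C D F \<longleftrightarrow>
     (\<forall>Z. is_initial C Z \<longrightarrow> is_initial D (ob F Z)) \<and>
     (\<forall>i j. is_coproduct C i j \<longrightarrow> is_coproduct D (ar F i) (ar F j))"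

definition FC :: "('o, 'a) cat \<Rightarrow> (('o, 'a, 's) set_fnctr, ('o, 'a, 's) set_trans) cat" where
  "FC C = full_subcat (functor_cat C Set_cat) (preserves_finite_coproducts C Set_cat)"

definition hom_functor ::
    "('a \<Rightarrow> 's) \<Rightarrow> ('o, 'a) cat \<Rightarrow> 'o \<Rightarrow> ('o, 'a, 's) set_fnctr" where
  "hom_functor e C X = Functor
     (\<lambda>Y \<in> Obj C. e ` Hom C X Y)
     (\<lambda>f \<in> Arr C. Arrow (e ` Hom C X (Dom C f)) (e ` Hom C X (Cod C f))
        (\<lambda>s \<in> e ` Hom C X (Dom C f). e (Comp C f (inv_into (Hom C X (Dom C f)) e s))))"

definition hom_precomp ::
    "('a \<Rightarrow> 's) \<Rightarrow> ('o, 'a) cat \<Rightarrow> 'a \<Rightarrow> ('o, 'a, 's) set_trans" where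
  "hom_precomp e C h = Arrow (hom_functor e C (Cod C h)) (hom_functor e C (Dom C h))
     (\<lambda>Y \<in> Obj C. Arrow (e ` Hom C (Cod C h) Y) (e ` Hom C (Dom C h) Y)
        (\<lambda>s \<in> e ` Hom C (Cod C h) Y. e (Comp C (inv_into (Hom C (Cod C h) Y) e s) h)))"


section \<open>The two directions of the equivalence\<close>

definition tilde_set :: "('o, 'a) cat \<Rightarrow> ('o, 'a, 's) set_fnctr \<Rightarrow> ('o, 'a) uf \<Rightarrow> 's set" where
  \<comment> \<open>\<open>m\<close> ranges over all coprojections representing a member of the ultrafilter\<close>
  "tilde_set C A P =
     {x \<in> ob A (fst P). \<forall>m \<in> \<Union> (snd P). x \<in> val (ar A m) ` ob A (Dom C m)}"

definition tilde_ob :: "('o, 'a) cat \<Rightarrow> ('o, 'a, 's) set_fnctr \<Rightarrow>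
    (('o, 'a) uf, (('o, 'a) uf, ('a \<times> 'a) set) arrow, 's) set_fnctr" where
  "tilde_ob C A = Functor
     (\<lambda>P \<in> Obj (UF C). tilde_set C A P)
     (\<lambda>\<phi> \<in> Arr (UF C). Arrow (tilde_set C A (src \<phi>)) (tilde_set C A (tgt \<phi>))
        (\<lambda>x \<in> tilde_set C A (src \<phi>).
           THE y. \<exists>(m, f) \<in> val \<phi>. \<exists>x' \<in> ob A (Dom C m).
             val (ar A m) x' = x \<and> y = val (ar A f) x'))"

definition tilde :: "('o, 'a) cat \<Rightarrow>
    (('o, 'a, 's) set_fnctr, ('o, 'a, 's) set_trans,
     (('o, 'a) uf, (('o, 'a) uf, ('a \<times> 'a) set) arrow, 's) set_fnctr,
     (('o, 'a) uf, (('o, 'a) uf, ('a \<times> 'a) set) arrow, 's) set_trans) fnctr" where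
  "tilde C = Functor
     (tilde_ob C)
     (\<lambda>\<alpha>. Arrow (tilde_ob C (src \<alpha>)) (tilde_ob C (tgt \<alpha>))
        (\<lambda>P \<in> Obj (UF C). Arrow (tilde_set C (src \<alpha>) P) (tilde_set C (tgt \<alpha>) P)
           (restrict (val (val \<alpha> (fst P))) (tilde_set C (src \<alpha>) P))))"

text \<open>
  The elements of the disjoint union \<open>\<Sum>\<V>. B (Y, \<V>)\<close> are the pairs
  \<open>(\<V>, b)\<close>, transported into \<open>'s\<close> by \<open>e\<close>.
\<close>

definition int_pairs :: "('o, 'a) cat \<Rightarrow>
    (('o, 'a) uf, (('o, 'a) uf, ('a \<times> 'a) set) arrow, 's) set_fnctr \<Rightarrow> 'o \<Rightarrow>
    ('a set set \<times> 's) set" where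
  "int_pairs C B Y = (SIGMA \<V> : ultrafilters C Y. ob B (Y, \<V>))"

definition int_ob :: "('a set set \<times> 's \<Rightarrow> 's) \<Rightarrow> ('o, 'a) cat \<Rightarrow>
    (('o, 'a) uf, (('o, 'a) uf, ('a \<times> 'a) set) arrow, 's) set_fnctr \<Rightarrow>
    ('o, 'a, 's) set_fnctr" where
  "int_ob e C B = Functor
     (\<lambda>Y \<in> Obj C. e ` int_pairs C B Y)
     (\<lambda>f \<in> Arr C. Arrow (e ` int_pairs C B (Dom C f)) (e ` int_pairs C B (Cod C f))
        (\<lambda>s \<in> e ` int_pairs C B (Dom C f).
           (let (\<V>, b) = inv_into (int_pairs C B (Dom C f)) e s;
                \<W> = push_ultrafilter C f \<V>;
                \<phi> = germ C (Dom C f, \<V>) (Cod C f, \<W>) (Id C (Dom C f), f)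
            in e (\<W>, val (ar B \<phi>) b))))"

definition int_functor :: "('a set set \<times> 's \<Rightarrow> 's) \<Rightarrow> ('o, 'a) cat \<Rightarrow>
    ((('o, 'a) uf, (('o, 'a) uf, ('a \<times> 'a) set) arrow, 's) set_fnctr,
     (('o, 'a) uf, (('o, 'a) uf, ('a \<times> 'a) set) arrow, 's) set_trans,
     ('o, 'a, 's) set_fnctr, ('o, 'a, 's) set_trans) fnctr" where
  "int_functor e C = Functor
     (int_ob e C)
     (\<lambda>\<gamma>. Arrow (int_ob e C (src \<gamma>)) (int_ob e C (tgt \<gamma>))
        (\<lambda>Y \<in> Obj C. Arrow (e ` int_pairs C (src \<gamma>) Y) (e ` int_pairs C (tgt \<gamma>) Y)
           (\<lambda>s \<in> e ` int_pairs C (src \<gamma>) Y.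
              (let (\<V>, b) = inv_into (int_pairs C (src \<gamma>) Y) e s
               in e (\<V>, val (val \<gamma> (Y, \<V>)) b)))))"


section \<open>The ultrahom functor\<close>

definition opposite_inclusion_cat ::
    "('o, 'a) cat \<Rightarrow> 'a set set \<Rightarrow> ('a set, 'a set \<times> 'a set) cat" where
  \<comment> \<open>one arrow from \<open>V\<close> to \<open>W\<close> whenever \<open>W\<close> is contained in \<open>V\<close>\<close>
  "opposite_inclusion_cat C \<U> =
    \<lparr> Obj = \<U>,
      Arr = {(V, W). V \<in> \<U> \<and> W \<in> \<U> \<and> summand_le C W V},
      Dom = fst,
      Cod = snd,
      Id = (\<lambda>V. (V, V)),
      Comp = (\<lambda>q p. (fst p, snd q)) \<rparr>"

text \<open>
  The diagram \<open>U \<mapsto> C(U, -)\<close>. The function \<open>r\<close> chooses a representing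
  coprojection of each isomorphism class \<open>U\<close>. The transition map along
  \<open>W \<subseteq> V\<close> precomposes with the inclusion of the domain of \<open>r W\<close> into
  that of \<open>r V\<close>.
\<close>

definition ultrahom_diagram ::
    "('a \<Rightarrow> 's) \<Rightarrow> ('o, 'a) cat \<Rightarrow> ('a set \<Rightarrow> 'a) \<Rightarrow>
     ('a set, 'a set \<times> 'a set, ('o, 'a, 's) set_fnctr, ('o, 'a, 's) set_trans) fnctr" where
  "ultrahom_diagram e C r = Functor
     (\<lambda>V. hom_functor e C (Dom C (r V)))
     (\<lambda>(V, W). hom_precomp e C
        (THE h. h \<in> Hom C (Dom C (r W)) (Dom C (r V)) \<and> Comp C (r V) h = r W))"

definition is_ultrahom :: "('a \<Rightarrow> 's) \<Rightarrow> ('o, 'a) cat \<Rightarrow> ('a set \<Rightarrow> 'a) \<Rightarrow> 'a set set \<Rightarrow>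
    ('o, 'a, 's) set_fnctr \<Rightarrow> bool" where
  "is_ultrahom e C r \<U> H \<longleftrightarrow>
     (\<exists>\<kappa>. is_colimit (opposite_inclusion_cat C \<U>) (functor_cat C Set_cat)
            (ultrahom_diagram e C r) H \<kappa>)"

end

theory Submission
  imports Defs
begin

text \<open>
  Extensivity gives pullbacks along coprojections, monic and disjoint coprojections and strict initial
  objects, because a cone with vertex \<open>T\<close> can be read as an arrow from \<open>T + 0\<close> in a slice
  category. Hence a coproduct-preserving \<open>A\<close> sends complementary summands of \<open>X\<close> to
  complementary subsets of \<open>A X\<close>, and the summands whose image contains a given
  \<open>x \<in> A X\<close> form an ultrafilter on \<open>X\<close>. So \<open>A X\<close> is the disjoint union of the
  subsets \<open>\<Inter>U \<in> \<U>. im (A U \<rightarrow> A X)\<close>, which gives the counit.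
  For the unit, an element \<open>(\<V>, b)\<close> of
  \<open>\<integral>B\<close> at \<open>X\<close> lies in the image of a summand \<open>U\<close> iff \<open>U \<in> \<V>\<close>, since the
  inclusion \<open>U \<rightarrow> X\<close> is invertible in the category of ultrafilters.
  Finally, every arrow of \<open>\<C>\<close> defined on a summand \<open>U \<in> \<U>\<close> is continuous for exactly one
  ultrafilter on its codomain, so that \<open>\<integral>\<close> of the representable at \<open>(X, \<U>)\<close>
  consists of germs of arrows along \<open>\<U>\<close>, which is the filtered colimit of the hom functors.
\<close>

section \<open>Categories, functors and equivalences\<close>

text \<open>Arrows between ultrafilters are classes of partial maps composed along pullbacks, and
  summands are isomorphism classes; handled directly, both would need chosen pullbacks and coherence
  arguments throughout. Instead a summand is treated through the generalised elements that factor
  through it (\<open>factors\<close>), an ultrafilter through representing coprojections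
  (\<open>large\<close>), and germs through the quantifier \<open>ev\<close>, which asks for a
  property on all generalised elements of some large summand. Continuity, equality of germs and
  composition become statements of the form \<open>ev C U P\<close> about the relation
  \<open>app\<close>; they combine by \<open>ev_conj\<close> and the single-valuedness of
  \<open>app\<close>, and are matched with the given definitions once each. The Boolean algebra of
  summands is never built as a structure: complements come from coproduct decompositions, and
  primality is derived from maximality. Sets of arrows, germs and pairs have to be coded in the
  universe \<open>'s\<close>; presenting functors and transformations by plain functions, with
  \<open>mkF\<close> and \<open>mkT\<close>, keeps the coding out of the categorical
  arguments.\<close>

lemma Hom_iff: "f \<in> Hom C X Y \<longleftrightarrow> f \<in> Arr C \<and> Dom C f = X \<and> Cod C f = Y"
  by (auto simp: Hom_def)

context category
begin

abbreviation comp (infixr "\<cdot>" 70) where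
  "g \<cdot> f \<equiv> Comp C g f"

lemma Arr_comp [simp]: "\<lbrakk>f \<in> Arr C; g \<in> Arr C; Dom C g = Cod C f\<rbrakk> \<Longrightarrow> g \<cdot> f \<in> Arr C"
  using Comp_Hom[of f "Dom C f" "Cod C f" g "Cod C g"] by (simp add: Hom_iff)

lemma Dom_comp [simp]: "\<lbrakk>f \<in> Arr C; g \<in> Arr C; Dom C g = Cod C f\<rbrakk> \<Longrightarrow> Dom C (g \<cdot> f) = Dom C f"
  using Comp_Hom[of f "Dom C f" "Cod C f" g "Cod C g"] by (simp add: Hom_iff)

lemma Cod_comp [simp]: "\<lbrakk>f \<in> Arr C; g \<in> Arr C; Dom C g = Cod C f\<rbrakk> \<Longrightarrow> Cod C (g \<cdot> f) = Cod C g"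
  using Comp_Hom[of f "Dom C f" "Cod C f" g "Cod C g"] by (simp add: Hom_iff)

lemma comp_assoc [simp]:
  "\<lbrakk>f \<in> Arr C; g \<in> Arr C; h \<in> Arr C; Dom C g = Cod C f; Dom C h = Cod C g\<rbrakk>
    \<Longrightarrow> (h \<cdot> g) \<cdot> f = h \<cdot> (g \<cdot> f)"
  using Comp_assoc[of f "Dom C f" "Cod C f" g "Cod C g" h "Cod C h"] by (simp add: Hom_iff)

lemma Obj_Dom [simp]: "f \<in> Arr C \<Longrightarrow> Dom C f \<in> Obj C"
  by (rule Dom_Obj)

lemma Obj_Cod [simp]: "f \<in> Arr C \<Longrightarrow> Cod C f \<in> Obj C"
  by (rule Cod_Obj)

lemma Id_simps [simp]:
  assumes "X \<in> Obj C"
  shows "Id C X \<in> Arr C" "Dom C (Id C X) = X" "Cod C (Id C X) = X"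
  using Id_Hom[OF assms] by (auto simp: Hom_iff)

lemma comp_Id [simp]: "\<lbrakk>f \<in> Arr C; Dom C f = X\<rbrakk> \<Longrightarrow> f \<cdot> Id C X = f"
  using Comp_Id[of f X "Cod C f"] by (simp add: Hom_iff)

lemma Id_comp [simp]: "\<lbrakk>f \<in> Arr C; Cod C f = X\<rbrakk> \<Longrightarrow> Id C X \<cdot> f = f"
  using Id_Comp[of f "Dom C f" X] by (simp add: Hom_iff)

lemma is_isoI:
  assumes "f \<in> Arr C" "g \<in> Arr C" "Dom C g = Cod C f" "Cod C g = Dom C f"
    "g \<cdot> f = Id C (Dom C f)" "f \<cdot> g = Id C (Cod C f)"
  shows "is_iso C f"
  using assms by (auto simp: is_iso_def Hom_iff)

lemma is_isoE:
  assumes "is_iso C f"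
  obtains g where "f \<in> Arr C" "g \<in> Arr C" "Dom C g = Cod C f" "Cod C g = Dom C f"
    "g \<cdot> f = Id C (Dom C f)" "f \<cdot> g = Id C (Cod C f)" "is_iso C g"
proof -
  obtain g where g: "f \<in> Arr C" "g \<in> Arr C" "Dom C g = Cod C f" "Cod C g = Dom C f"
    "g \<cdot> f = Id C (Dom C f)" "f \<cdot> g = Id C (Cod C f)"
    using assms by (auto simp: is_iso_def Hom_iff)
  moreover from this have "is_iso C g" by (intro is_isoI[where g = f]) simp_all
  ultimately show ?thesis using that by blast
qed

lemma is_iso_comp:
  assumes "is_iso C f" "is_iso C g" "Dom C g = Cod C f"
  shows "is_iso C (g \<cdot> f)"
proof -
  obtain f' where f: "f \<in> Arr C" "f' \<in> Arr C" "Dom C f' = Cod C f" "Cod C f' = Dom C f"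
    "f' \<cdot> f = Id C (Dom C f)" "f \<cdot> f' = Id C (Cod C f)" using is_isoE[OF assms(1)] by metis
  obtain g' where g: "g \<in> Arr C" "g' \<in> Arr C" "Dom C g' = Cod C g" "Cod C g' = Dom C g"
    "g' \<cdot> g = Id C (Dom C g)" "g \<cdot> g' = Id C (Cod C g)" using is_isoE[OF assms(2)] by metis
  have "g' \<cdot> (g \<cdot> f) = f" using f g assms(3) comp_assoc[of f g g'] by simp
  moreover have "f \<cdot> (f' \<cdot> g') = g'" using f g assms(3) comp_assoc[of g' f' f] by simp
  ultimately show ?thesis
    using f g assms(3) by (intro is_isoI[where g = "f' \<cdot> g'"]) simp_all
qed

lemma isomorphic_sym:
  assumes "isomorphic C X Y"
  shows "isomorphic C Y X"
proof -
  obtain f where f: "f \<in> Hom C X Y" "is_iso C f" using assms by (auto simp: isomorphic_def)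
  obtain g where "g \<in> Arr C" "Dom C g = Cod C f" "Cod C g = Dom C f" "is_iso C g"
    using is_isoE[OF f(2)] by blast
  then show ?thesis using f(1) by (auto simp: isomorphic_def Hom_iff)
qed

lemma isomorphic_trans:
  assumes "isomorphic C X Y" "isomorphic C Y Z"
  shows "isomorphic C X Z"
proof -
  obtain f g where "f \<in> Hom C X Y" "is_iso C f" "g \<in> Hom C Y Z" "is_iso C g"
    using assms by (auto simp: isomorphic_def)
  then show ?thesis using is_iso_comp[of f g] by (auto simp: isomorphic_def Hom_iff intro!: bexI[of _ "g \<cdot> f"])
qed

lemma initial_unique:
  "\<lbrakk>is_initial C Z; f \<in> Arr C; g \<in> Arr C; Dom C f = Z; Dom C g = Z; Cod C f = Cod C g\<rbrakk> \<Longrightarrow> f = g"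
  unfolding is_initial_def Hom_iff by (metis Obj_Cod)

lemma initial_arrow:
  assumes "is_initial C Z" "X \<in> Obj C"
  obtains f where "f \<in> Arr C" "Dom C f = Z" "Cod C f = X"
  using assms unfolding is_initial_def Hom_iff by metis

end

section \<open>Functors, and what an equivalence gives on arrows and on objects\<close>

lemma is_functorD:
  assumes "is_functor C D F"
  shows "category C" "category D" "X \<in> Obj C \<Longrightarrow> ob F X \<in> Obj D"
    "f \<in> Arr C \<Longrightarrow> ar F f \<in> Arr D" "f \<in> Arr C \<Longrightarrow> Dom D (ar F f) = ob F (Dom C f)"
    "f \<in> Arr C \<Longrightarrow> Cod D (ar F f) = ob F (Cod C f)"
    "X \<in> Obj C \<Longrightarrow> ar F (Id C X) = Id D (ob F X)"
    "\<lbrakk>f \<in> Arr C; g \<in> Arr C; Dom C g = Cod C f\<rbrakk> \<Longrightarrow> ar F (Comp C g f) = Comp D (ar F g) (ar F f)"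
  using assms unfolding is_functor_def Hom_iff by auto

lemma functor_preserves_iso:
  assumes F: "is_functor C D F" and f: "is_iso C f"
  shows "is_iso D (ar F f)"
proof -
  interpret C: category C by (rule is_functorD[OF F])
  interpret D: category D by (rule is_functorD[OF F])
  note Fs = is_functorD(3-8)[OF F]
  obtain g where g: "f \<in> Arr C" "g \<in> Arr C" "Dom C g = Cod C f" "Cod C g = Dom C f"
    "Comp C g f = Id C (Dom C f)" "Comp C f g = Id C (Cod C f)" using C.is_isoE[OF f] by metis
  show ?thesis
    by (rule D.is_isoI[where g = "ar F g"])
      (use g Fs(6)[of f g] Fs(6)[of g f] in \<open>simp_all add: Fs(1-5)\<close>)
qed

lemma functor_preserves_isomorphic:
  assumes F: "is_functor C D F" and iso: "isomorphic C X Y"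
  shows "isomorphic D (ob F X) (ob F Y)"
proof -
  obtain f where "f \<in> Hom C X Y" "is_iso C f" using iso by (auto simp: isomorphic_def)
  then show ?thesis
    using functor_preserves_iso[OF F, of f] is_functorD(4-6)[OF F, of f]
    by (auto simp: isomorphic_def Hom_iff)
qed

lemma equivalence_sym: "equivalence A B F G \<Longrightarrow> equivalence B A G F"
  by (auto simp: equivalence_def)

text \<open>Only the isomorphism from G F to the identity is unpacked. The two functors play
  symmetric roles in \<open>equivalence\<close>, so \<open>equivalence_sym\<close> yields the same
  for F G.\<close>

lemma equivalence_unit:
  assumes "equivalence A B F G"
  obtains \<eta> where
    "\<And>X. X \<in> Obj A \<Longrightarrow> \<eta> X \<in> Hom A (ob G (ob F X)) X"
    "\<And>X. X \<in> Obj A \<Longrightarrow> is_iso A (\<eta> X)"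
    "\<And>h. h \<in> Arr A \<Longrightarrow> Comp A h (\<eta> (Dom A h)) = Comp A (\<eta> (Cod A h)) (ar G (ar F h))"
proof -
  have "naturally_isomorphic A A (comp_functor G F) id_functor"
    using assms by (simp add: equivalence_def)
  then obtain \<eta> where "nat_trans A A (comp_functor G F) id_functor \<eta>" "\<forall>X \<in> Obj A. is_iso A (\<eta> X)"
    unfolding naturally_isomorphic_def by blast
  then show ?thesis
    by (intro that[of \<eta>]) (auto simp: nat_trans_def comp_functor_def id_functor_def)
qed

text \<open>Naturality of \<eta> at \<open>h\<close> and at \<open>k\<close> shows that both have
  the same composite with \<open>\<eta> X\<close>, since their images under G F agree; the right
  inverse of \<open>\<eta> X\<close> cancels it.\<close>

lemma equivalence_faithful:
  assumes E: "equivalence A B F G" and h: "h \<in> Hom A X Y" and k: "k \<in> Hom A X Y"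
    and eq: "ar F h = ar F k"
  shows "h = k"
proof -
  interpret A: category A using E is_functorD by (auto simp: equivalence_def)
  obtain \<eta> where \<eta>: "\<And>X. X \<in> Obj A \<Longrightarrow> \<eta> X \<in> Hom A (ob G (ob F X)) X"
    "\<And>X. X \<in> Obj A \<Longrightarrow> is_iso A (\<eta> X)"
    "\<And>h. h \<in> Arr A \<Longrightarrow> Comp A h (\<eta> (Dom A h)) = Comp A (\<eta> (Cod A h)) (ar G (ar F h))"
    using equivalence_unit[OF E] by metis
  have hk: "h \<in> Arr A" "k \<in> Arr A" "Dom A h = X" "Dom A k = X" "Cod A h = Y" "Cod A k = Y" "X \<in> Obj A"
    using h k by (auto simp: Hom_iff)
  obtain g where g: "g \<in> Arr A" "Dom A g = X" "Cod A g = Dom A (\<eta> X)" "Comp A (\<eta> X) g = Id A X"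
    using \<eta>(1,2)[OF hk(7)] A.is_isoE[of "\<eta> X"] unfolding Hom_iff by metis
  have "Comp A h (\<eta> X) = Comp A k (\<eta> X)" using \<eta>(3)[of h] \<eta>(3)[of k] hk eq by simp
  then have "Comp A (Comp A h (\<eta> X)) g = Comp A (Comp A k (\<eta> X)) g" by simp
  then show ?thesis using hk g \<eta>(1)[OF hk(7)] by (simp add: Hom_iff)
qed

text \<open>The candidate is the conjugate of \<open>ar G w\<close> by the isomorphisms \<eta>.
  Naturality only shows that \<open>ar F h\<close> and \<open>w\<close> agree after applying G;
  faithfulness of G, available through \<open>equivalence_sym\<close>, then removes G.\<close>

lemma equivalence_full:
  assumes E: "equivalence A B F G" and X: "X \<in> Obj A" and Y: "Y \<in> Obj A"
    and w: "w \<in> Hom B (ob F X) (ob F Y)"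
  obtains h where "h \<in> Hom A X Y" "ar F h = w"
proof -
  have F: "is_functor A B F" and G: "is_functor B A G" using E by (auto simp: equivalence_def)
  interpret A: category A by (rule is_functorD[OF F])
  note Fs = is_functorD(3-8)[OF F] and Gs = is_functorD(3-8)[OF G]
  obtain \<eta> where \<eta>: "\<And>X. X \<in> Obj A \<Longrightarrow> \<eta> X \<in> Hom A (ob G (ob F X)) X"
    "\<And>X. X \<in> Obj A \<Longrightarrow> is_iso A (\<eta> X)"
    "\<And>h. h \<in> Arr A \<Longrightarrow> Comp A h (\<eta> (Dom A h)) = Comp A (\<eta> (Cod A h)) (ar G (ar F h))"
    using equivalence_unit[OF E] by metis
  have \<eta>X: "\<eta> X \<in> Arr A" "Dom A (\<eta> X) = ob G (ob F X)" "Cod A (\<eta> X) = X"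
    and \<eta>Y: "\<eta> Y \<in> Arr A" "Dom A (\<eta> Y) = ob G (ob F Y)" "Cod A (\<eta> Y) = Y"
    using \<eta>(1)[OF X] \<eta>(1)[OF Y] by (auto simp: Hom_iff)
  obtain g where g: "g \<in> Arr A" "Dom A g = X" "Cod A g = ob G (ob F X)"
    "Comp A g (\<eta> X) = Id A (ob G (ob F X))"
    using \<eta>(2)[OF X] A.is_isoE[of "\<eta> X"] \<eta>X by metis
  obtain k where k: "k \<in> Arr A" "Dom A k = Y" "Cod A k = ob G (ob F Y)"
    "Comp A k (\<eta> Y) = Id A (ob G (ob F Y))"
    using \<eta>(2)[OF Y] A.is_isoE[of "\<eta> Y"] \<eta>Y by metis
  have Gw: "ar G w \<in> Arr A" "Dom A (ar G w) = ob G (ob F X)" "Cod A (ar G w) = ob G (ob F Y)"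
    using w Gs(2-4)[of w] by (auto simp: Hom_iff)
  define h where "h = Comp A (\<eta> Y) (Comp A (ar G w) g)"
  have h: "h \<in> Arr A" "Dom A h = X" "Cod A h = Y"
    using Gw g \<eta>Y by (auto simp: h_def)
  have GFh: "ar G (ar F h) \<in> Arr A" "Dom A (ar G (ar F h)) = ob G (ob F X)"
    "Cod A (ar G (ar F h)) = ob G (ob F Y)"
    using h by (auto simp: Gs Fs)
  have "Comp A (\<eta> Y) (ar G (ar F h)) = Comp A (\<eta> Y) (ar G w)"
    using \<eta>(3)[OF h(1)] h Gw g \<eta>X \<eta>Y by (simp add: h_def)
  then have "Comp A k (Comp A (\<eta> Y) (ar G (ar F h))) = Comp A k (Comp A (\<eta> Y) (ar G w))" by simp
  then have "Comp A (Comp A k (\<eta> Y)) (ar G (ar F h)) = Comp A (Comp A k (\<eta> Y)) (ar G w)"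
    using k(1-3) \<eta>Y Gw GFh by simp
  then have "ar G (ar F h) = ar G w" using k(4) Gw GFh by simp
  moreover have "ar F h \<in> Hom B (ob F X) (ob F Y)" using h Fs by (auto simp: Hom_iff)
  ultimately have "ar F h = w" using equivalence_faithful[OF equivalence_sym[OF E]] w by blast
  then show ?thesis using that h by (auto simp: Hom_iff)
qed

lemma equivalence_essentially_surjective:
  assumes E: "equivalence A B F G" and Z: "Z \<in> Obj B"
  obtains X e where "X \<in> Obj A" "e \<in> Hom B (ob F X) Z" "is_iso B e"
proof -
  have "ob G Z \<in> Obj A" using E is_functorD(3) Z by (auto simp: equivalence_def)
  moreover obtain \<epsilon> where "\<epsilon> Z \<in> Hom B (ob F (ob G Z)) Z" "is_iso B (\<epsilon> Z)"
    using equivalence_unit[OF equivalence_sym[OF E]] Z by metis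
  ultimately show ?thesis using that by blast
qed

section \<open>Extensive categories\<close>

context category
begin

text \<open>Existence and uniqueness are separated, and hom-sets are replaced by equations on
  \<open>Dom\<close> and \<open>Cod\<close>, the form in which the simplifier can check that
  composites are defined.\<close>

lemma is_coproductI:
  assumes "i \<in> Arr C" "j \<in> Arr C" "Cod C i = Cod C j"
    and "\<And>f g. \<lbrakk>f \<in> Arr C; g \<in> Arr C; Dom C f = Dom C i; Dom C g = Dom C j; Cod C f = Cod C g\<rbrakk> \<Longrightarrow>
      \<exists>u. u \<in> Arr C \<and> Dom C u = Cod C i \<and> Cod C u = Cod C f \<and> u \<cdot> i = f \<and> u \<cdot> j = g"
    and "\<And>u v. \<lbrakk>u \<in> Arr C; v \<in> Arr C; Dom C u = Cod C i; Dom C v = Cod C i; Cod C u = Cod C v;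
      u \<cdot> i = v \<cdot> i; u \<cdot> j = v \<cdot> j\<rbrakk> \<Longrightarrow> u = v"
  shows "is_coproduct C i j"
  unfolding is_coproduct_def Hom_iff
proof (intro conjI allI ballI assms(1-3))
  fix Y f g assume f: "f \<in> Hom C (Dom C i) Y" and g: "g \<in> Hom C (Dom C j) Y"
  then obtain u where u: "u \<in> Arr C \<and> Dom C u = Cod C i \<and> Cod C u = Cod C f \<and> u \<cdot> i = f \<and> u \<cdot> j = g"
    using assms(4)[of f g] by (auto simp: Hom_iff)
  show "\<exists>!u. (u \<in> Arr C \<and> Dom C u = Cod C i \<and> Cod C u = Y) \<and> u \<cdot> i = f \<and> u \<cdot> j = g"
    by (rule ex1I[of _ u]) (use u f assms(5) in \<open>auto simp: Hom_iff\<close>)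
qed

lemma is_coproductD:
  assumes "is_coproduct C i j"
  shows "i \<in> Arr C" "j \<in> Arr C" "Cod C j = Cod C i"
  using assms by (auto simp: is_coproduct_def)

lemma is_coproduct_copair:
  assumes "is_coproduct C i j" "f \<in> Arr C" "g \<in> Arr C" "Dom C f = Dom C i" "Dom C g = Dom C j"
    "Cod C f = Cod C g"
  obtains u where "u \<in> Arr C" "Dom C u = Cod C i" "Cod C u = Cod C f" "u \<cdot> i = f" "u \<cdot> j = g"
proof -
  have "f \<in> Hom C (Dom C i) (Cod C f)" "g \<in> Hom C (Dom C j) (Cod C f)"
    using assms by (auto simp: Hom_iff)
  then have "\<exists>!u. u \<in> Hom C (Cod C i) (Cod C f) \<and> u \<cdot> i = f \<and> u \<cdot> j = g"
    using assms(1) unfolding is_coproduct_def by blast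
  then show ?thesis using that by (auto simp: Hom_iff)
qed

lemma is_coproduct_eq:
  assumes "is_coproduct C i j" "u \<in> Arr C" "v \<in> Arr C" "Dom C u = Cod C i" "Dom C v = Cod C i"
    "Cod C u = Cod C v" "u \<cdot> i = v \<cdot> i" "u \<cdot> j = v \<cdot> j"
  shows "u = v"
proof -
  note ij = is_coproductD[OF assms(1)]
  have "v \<cdot> i \<in> Hom C (Dom C i) (Cod C u)" "v \<cdot> j \<in> Hom C (Dom C j) (Cod C u)"
    using assms ij by (auto simp: Hom_iff)
  then have "\<exists>!w. w \<in> Hom C (Cod C i) (Cod C u) \<and> w \<cdot> i = v \<cdot> i \<and> w \<cdot> j = v \<cdot> j"
    using assms(1) unfolding is_coproduct_def by blast
  then show ?thesis using assms by (auto simp: Hom_iff)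
qed

lemma is_coproduct_sym:
  assumes "is_coproduct C i j"
  shows "is_coproduct C j i"
proof (rule is_coproductI)
  note [simp] = is_coproductD[OF assms]
  fix f g assume "f \<in> Arr C" "g \<in> Arr C" "Dom C f = Dom C j" "Dom C g = Dom C i" "Cod C f = Cod C g"
  then show "\<exists>u. u \<in> Arr C \<and> Dom C u = Cod C j \<and> Cod C u = Cod C f \<and> u \<cdot> j = f \<and> u \<cdot> i = g"
    using is_coproduct_copair[OF assms, of g f] by auto
next
  fix u v assume "u \<in> Arr C" "v \<in> Arr C" "Dom C u = Cod C j" "Dom C v = Cod C j" "Cod C u = Cod C v"
    "u \<cdot> j = v \<cdot> j" "u \<cdot> i = v \<cdot> i"
  then show "u = v" using is_coproductD[OF assms] by - (rule is_coproduct_eq[OF assms]; simp)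
qed (use is_coproductD[OF assms] in simp_all)

lemma is_coproduct_comp_iso:
  assumes ij: "is_coproduct C i j" and s: "is_iso C s" "Dom C s = Cod C i"
  shows "is_coproduct C (s \<cdot> i) (s \<cdot> j)"
proof -
  note [simp] = is_coproductD[OF ij] s(2)
  obtain s' where [simp]: "s \<in> Arr C" "s' \<in> Arr C" "Dom C s' = Cod C s" "Cod C s' = Cod C i"
    and ss': "s' \<cdot> s = Id C (Cod C i)" "s \<cdot> s' = Id C (Cod C s)"
    using is_isoE[OF s(1)] s(2) by metis
  have cancel: "s' \<cdot> (s \<cdot> i) = i" "s' \<cdot> (s \<cdot> j) = j"
    using ss' comp_assoc[of i s s'] comp_assoc[of j s s'] by simp_all
  show ?thesis
  proof (rule is_coproductI)
    fix f g assume fg: "f \<in> Arr C" "g \<in> Arr C" "Dom C f = Dom C (s \<cdot> i)" "Dom C g = Dom C (s \<cdot> j)"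
      "Cod C f = Cod C g"
    then obtain u where u: "u \<in> Arr C" "Dom C u = Cod C i" "Cod C u = Cod C f" "u \<cdot> i = f" "u \<cdot> j = g"
      using is_coproduct_copair[OF ij, of f g] by auto
    show "\<exists>u. u \<in> Arr C \<and> Dom C u = Cod C (s \<cdot> i) \<and> Cod C u = Cod C f \<and>
        u \<cdot> (s \<cdot> i) = f \<and> u \<cdot> (s \<cdot> j) = g"
      by (rule exI[of _ "u \<cdot> s'"]) (use u cancel in simp)
  next
    fix u v assume uv: "u \<in> Arr C" "v \<in> Arr C" "Dom C u = Cod C (s \<cdot> i)" "Dom C v = Cod C (s \<cdot> i)"
      "Cod C u = Cod C v" "u \<cdot> (s \<cdot> i) = v \<cdot> (s \<cdot> i)" "u \<cdot> (s \<cdot> j) = v \<cdot> (s \<cdot> j)"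
    then have "u \<cdot> s = v \<cdot> s" by - (rule is_coproduct_eq[OF ij]; simp)
    then have "(u \<cdot> s) \<cdot> s' = (v \<cdot> s) \<cdot> s'" by simp
    then show "u = v" using uv(1-5) ss' by simp
  qed simp_all
qed

lemma is_coproduct_unique:
  assumes ij: "is_coproduct C i j" and kl: "is_coproduct C k l"
    and dom: "Dom C k = Dom C i" "Dom C l = Dom C j"
  obtains s where "is_iso C s" "s \<in> Arr C" "Dom C s = Cod C i" "Cod C s = Cod C k"
    "s \<cdot> i = k" "s \<cdot> j = l"
proof -
  note [simp] = is_coproductD[OF ij] is_coproductD[OF kl] dom
  obtain s where s: "s \<in> Arr C" "Dom C s = Cod C i" "Cod C s = Cod C k" "s \<cdot> i = k" "s \<cdot> j = l"
    using is_coproduct_copair[OF ij, of k l] by auto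
  obtain s' where s': "s' \<in> Arr C" "Dom C s' = Cod C k" "Cod C s' = Cod C i" "s' \<cdot> k = i" "s' \<cdot> l = j"
    using is_coproduct_copair[OF kl, of i j] by auto
  have "s' \<cdot> s = Id C (Cod C i)" by (rule is_coproduct_eq[OF ij]) (use s s' in simp_all)
  moreover have "s \<cdot> s' = Id C (Cod C k)" by (rule is_coproduct_eq[OF kl]) (use s s' in simp_all)
  ultimately have "is_iso C s" using s s' by (intro is_isoI[where g = s']) simp_all
  then show ?thesis using that s by blast
qed

lemma is_pullbackI:
  assumes "f \<in> Arr C" "g \<in> Arr C" "Cod C f = Cod C g" "p \<in> Arr C" "q \<in> Arr C"
    "Dom C q = Dom C p" "Cod C p = Dom C f" "Cod C q = Dom C g" "f \<cdot> p = g \<cdot> q"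
    and "\<And>a b. \<lbrakk>a \<in> Arr C; b \<in> Arr C; Dom C a = Dom C b; Cod C a = Dom C f; Cod C b = Dom C g;
        f \<cdot> a = g \<cdot> b\<rbrakk> \<Longrightarrow>
      \<exists>h. h \<in> Arr C \<and> Dom C h = Dom C a \<and> Cod C h = Dom C p \<and> p \<cdot> h = a \<and> q \<cdot> h = b"
    and "\<And>h k. \<lbrakk>h \<in> Arr C; k \<in> Arr C; Dom C h = Dom C k; Cod C h = Dom C p; Cod C k = Dom C p;
        p \<cdot> h = p \<cdot> k; q \<cdot> h = q \<cdot> k\<rbrakk> \<Longrightarrow> h = k"
  shows "is_pullback C p q f g"
  unfolding is_pullback_def Hom_iff
proof (intro conjI allI ballI impI assms(1-9) refl)
  fix T a b assume ab: "a \<in> Hom C T (Dom C f)" "b \<in> Hom C T (Dom C g)" "f \<cdot> a = g \<cdot> b"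
  then obtain h where h: "h \<in> Arr C \<and> Dom C h = Dom C a \<and> Cod C h = Dom C p \<and> p \<cdot> h = a \<and> q \<cdot> h = b"
    using assms(10)[of a b] by (auto simp: Hom_iff)
  show "\<exists>!h. (h \<in> Arr C \<and> Dom C h = T \<and> Cod C h = Dom C p) \<and> p \<cdot> h = a \<and> q \<cdot> h = b"
    by (rule ex1I[of _ h]) (use h ab assms(11) in \<open>auto simp: Hom_iff\<close>)
qed

lemma is_pullbackD:
  assumes "is_pullback C p q f g"
  shows "f \<in> Arr C" "g \<in> Arr C" "Cod C g = Cod C f" "p \<in> Arr C" "q \<in> Arr C"
    "Dom C q = Dom C p" "Cod C p = Dom C f" "Cod C q = Dom C g" "f \<cdot> p = g \<cdot> q"
  using assms by (auto simp: is_pullback_def Hom_iff)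

lemma is_pullback_lift:
  assumes "is_pullback C p q f g" "a \<in> Arr C" "b \<in> Arr C" "Dom C a = Dom C b" "Cod C a = Dom C f"
    "Cod C b = Dom C g" "f \<cdot> a = g \<cdot> b"
  obtains h where "h \<in> Arr C" "Dom C h = Dom C a" "Cod C h = Dom C p" "p \<cdot> h = a" "q \<cdot> h = b"
proof -
  have "a \<in> Hom C (Dom C a) (Dom C f)" "b \<in> Hom C (Dom C a) (Dom C g)"
    using assms by (auto simp: Hom_iff)
  then have "\<exists>!h. h \<in> Hom C (Dom C a) (Dom C p) \<and> p \<cdot> h = a \<and> q \<cdot> h = b"
    using assms(1,7) unfolding is_pullback_def by blast
  then show ?thesis using that by (auto simp: Hom_iff)
qed

lemma is_pullback_eq:
  assumes "is_pullback C p q f g" "h \<in> Arr C" "k \<in> Arr C" "Dom C h = Dom C k" "Cod C h = Dom C p"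
    "Cod C k = Dom C p" "p \<cdot> h = p \<cdot> k" "q \<cdot> h = q \<cdot> k"
  shows "h = k"
proof -
  note pb = is_pullbackD[OF assms(1)]
  have "f \<cdot> (p \<cdot> h) = g \<cdot> (q \<cdot> h)"
    using pb assms comp_assoc[of h p f] comp_assoc[of h q g] by simp
  moreover have "p \<cdot> h \<in> Hom C (Dom C h) (Dom C f)" "q \<cdot> h \<in> Hom C (Dom C h) (Dom C g)"
    using assms pb by (auto simp: Hom_iff)
  ultimately have "\<exists>!l. l \<in> Hom C (Dom C h) (Dom C p) \<and> p \<cdot> l = p \<cdot> h \<and> q \<cdot> l = q \<cdot> h"
    using assms(1) unfolding is_pullback_def by blast
  then show ?thesis using assms by (auto simp: Hom_iff)
qed

lemma is_pullback_unique:
  assumes pb: "is_pullback C p q f g" and pb': "is_pullback C p' q' f g"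
  obtains h where "is_iso C h" "Dom C h = Dom C p" "Cod C h = Dom C p'" "p' \<cdot> h = p" "q' \<cdot> h = q"
proof -
  note D = is_pullbackD[OF pb] and D' = is_pullbackD[OF pb']
  obtain h where h: "h \<in> Arr C" "Dom C h = Dom C p" "Cod C h = Dom C p'" "p' \<cdot> h = p" "q' \<cdot> h = q"
    using is_pullback_lift[OF pb', of p q] D by auto
  obtain k where k: "k \<in> Arr C" "Dom C k = Dom C p'" "Cod C k = Dom C p" "p \<cdot> k = p'" "q \<cdot> k = q'"
    using is_pullback_lift[OF pb, of p' q'] D' by auto
  have kh: "p \<cdot> (k \<cdot> h) = p" "q \<cdot> (k \<cdot> h) = q" "p' \<cdot> (h \<cdot> k) = p'" "q' \<cdot> (h \<cdot> k) = q'"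
    using D D' h k comp_assoc[of h k p] comp_assoc[of h k q] comp_assoc[of k h p'] comp_assoc[of k h q']
    by simp_all
  have "k \<cdot> h = Id C (Dom C p)" using D h k kh by - (rule is_pullback_eq[OF pb]; simp)
  moreover have "h \<cdot> k = Id C (Dom C p')" using D' h k kh by - (rule is_pullback_eq[OF pb']; simp)
  ultimately have "is_iso C h" using h k by (intro is_isoI[where g = k]) simp_all
  then show ?thesis using that h by blast
qed

lemma is_coproduct_precomp_iso:
  assumes ij: "is_coproduct C i j" and h: "is_iso C h" "Cod C h = Dom C i"
  shows "is_coproduct C (i \<cdot> h) j"
proof -
  note [simp] = is_coproductD[OF ij] h(2)
  obtain h' where [simp]: "h \<in> Arr C" "h' \<in> Arr C" "Dom C h' = Dom C i" "Cod C h' = Dom C h"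
    and hh': "h' \<cdot> h = Id C (Dom C h)" "h \<cdot> h' = Id C (Dom C i)"
    using is_isoE[OF h(1)] h(2) by metis
  show ?thesis
  proof (rule is_coproductI)
    fix f g assume fg: "f \<in> Arr C" "g \<in> Arr C" "Dom C f = Dom C (i \<cdot> h)" "Dom C g = Dom C j"
      "Cod C f = Cod C g"
    then obtain u where u: "u \<in> Arr C" "Dom C u = Cod C i" "Cod C u = Cod C f" "u \<cdot> i = f \<cdot> h'" "u \<cdot> j = g"
      using is_coproduct_copair[OF ij, of "f \<cdot> h'" g] by auto
    have "u \<cdot> i \<cdot> h = f" using u fg hh' comp_assoc[of h i u] by simp
    then show "\<exists>u. u \<in> Arr C \<and> Dom C u = Cod C (i \<cdot> h) \<and> Cod C u = Cod C f \<and>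
        u \<cdot> (i \<cdot> h) = f \<and> u \<cdot> j = g"
      using u by auto
  next
    fix u v assume uv: "u \<in> Arr C" "v \<in> Arr C" "Dom C u = Cod C (i \<cdot> h)" "Dom C v = Cod C (i \<cdot> h)"
      "Cod C u = Cod C v" "u \<cdot> i \<cdot> h = v \<cdot> i \<cdot> h" "u \<cdot> j = v \<cdot> j"
    then have "((u \<cdot> i) \<cdot> h) \<cdot> h' = ((v \<cdot> i) \<cdot> h) \<cdot> h'" by simp
    then have "u \<cdot> i = v \<cdot> i" using uv(1-5) hh' by simp
    then show "u = v" using uv by - (rule is_coproduct_eq[OF ij]; simp)
  qed simp_all
qed

text \<open>A copair of f and g is f itself, compatibility with \<open>z\<close> being automatic by
  initiality. Reading an object as X + 0 feeds degenerate decompositions into the general results,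
  from which monicity, strictness and disjointness follow.\<close>

lemma is_coproduct_initial:
  assumes "is_initial C Z" "z \<in> Arr C" "Dom C z = Z" "Cod C z = X"
  shows "is_coproduct C (Id C X) z"
proof (rule is_coproductI)
  have X: "X \<in> Obj C" using assms by auto
  fix f g assume "f \<in> Arr C" "g \<in> Arr C" "Dom C f = Dom C (Id C X)" "Dom C g = Dom C z" "Cod C f = Cod C g"
  then have "f \<in> Arr C \<and> Dom C f = Cod C (Id C X) \<and> Cod C f = Cod C f \<and> f \<cdot> Id C X = f \<and> f \<cdot> z = g"
    using assms X initial_unique[OF assms(1), of "f \<cdot> z" g] by simp
  then show "\<exists>u. u \<in> Arr C \<and> Dom C u = Cod C (Id C X) \<and> Cod C u = Cod C f \<and> u \<cdot> Id C X = f \<and> u \<cdot> z = g"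
    by blast
qed (use assms in auto)

section \<open>Slice categories\<close>

lemma slice_cat_simps:
  "f \<in> Obj (slice_cat C A) \<longleftrightarrow> f \<in> Arr C \<and> Cod C f = A"
  "e \<in> Hom (slice_cat C A) f g \<longleftrightarrow> src e = f \<and> tgt e = g \<and> f \<in> Arr C \<and> g \<in> Arr C \<and> Cod C f = A \<and>
     Cod C g = A \<and> val e \<in> Hom C (Dom C f) (Dom C g) \<and> g \<cdot> val e = f"
  "Comp (slice_cat C A) k h = Arrow (src h) (tgt k) (val k \<cdot> val h)"
  "Id (slice_cat C A) f = Arrow f f (Id C (Dom C f))"
  "Dom (slice_cat C A) e = src e" "Cod (slice_cat C A) e = tgt e"
  by (cases e; force simp: slice_cat_def Hom_iff)+

lemma slice_iso:
  assumes "e \<in> Hom (slice_cat C A) f g" "is_iso (slice_cat C A) e"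
  shows "is_iso C (val e)"
proof -
  obtain k where k: "k \<in> Hom (slice_cat C A) (tgt e) (src e)"
     "Comp (slice_cat C A) k e = Id (slice_cat C A) (src e)"
     "Comp (slice_cat C A) e k = Id (slice_cat C A) (tgt e)"
    using assms(2) unfolding is_iso_def slice_cat_simps(5,6) by blast
  have e: "src e = f" "tgt e = g" "val e \<in> Hom C (Dom C f) (Dom C g)"
    using assms(1) by (auto simp: slice_cat_simps)
  have "val k \<in> Hom C (Dom C g) (Dom C f)"
    using k(1) e unfolding slice_cat_simps(2) by simp
  with e k(2,3) show ?thesis
    by (intro is_isoI[where g = "val k"]) (auto simp: slice_cat_simps(3,4) Hom_iff)
qed

end

section \<open>Decompositions and pullbacks along coprojections, from the equivalences of
  slices\<close>

locale extensive_category = category C for C :: "('o, 'a) cat" +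
  assumes extensive: "extensive C"
begin

lemma has_initial: obtains Z where "is_initial C Z"
  using extensive by (auto simp: extensive_def has_finite_coproducts_def)

abbreviation inl where "inl A B \<equiv> fst (coproj C A B)"
abbreviation inr where "inr A B \<equiv> snd (coproj C A B)"

lemma coproj:
  assumes "A \<in> Obj C" "B \<in> Obj C"
  shows "is_coproduct C (inl A B) (inr A B)" "Dom C (inl A B) = A" "Dom C (inr A B) = B"
proof -
  obtain i j where "is_coproduct C i j \<and> Dom C i = A \<and> Dom C j = B"
    using extensive assms unfolding extensive_def has_finite_coproducts_def by blast
  then have "case (i, j) of (i, j) \<Rightarrow> is_coproduct C i j \<and> Dom C i = A \<and> Dom C j = B" by simp
  then have "case coproj C A B of (i, j) \<Rightarrow> is_coproduct C i j \<and> Dom C i = A \<and> Dom C j = B"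
    unfolding coproj_def by (rule someI)
  then show "is_coproduct C (inl A B) (inr A B)" "Dom C (inl A B) = A" "Dom C (inr A B) = B"
    by (auto simp: case_prod_beta)
qed

lemma coproj_simps [simp]:
  assumes "A \<in> Obj C" "B \<in> Obj C"
  shows "inl A B \<in> Arr C" "inr A B \<in> Arr C" "Dom C (inl A B) = A" "Dom C (inr A B) = B"
    "Cod C (inl A B) = coprod C A B" "Cod C (inr A B) = coprod C A B"
  using coproj[OF assms] is_coproductD[OF coproj(1)[OF assms]] by (simp_all add: coprod_def)

lemma coprod_Obj [simp]: "\<lbrakk>A \<in> Obj C; B \<in> Obj C\<rbrakk> \<Longrightarrow> coprod C A B \<in> Obj C"
  using Obj_Cod[of "inl A B"] by simp

lemma coprod_map:
  assumes f: "f \<in> Arr C" and g: "g \<in> Arr C"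
  shows "coprod_map C f g \<in> Arr C"
    "Dom C (coprod_map C f g) = coprod C (Dom C f) (Dom C g)"
    "Cod C (coprod_map C f g) = coprod C (Cod C f) (Cod C g)"
    "coprod_map C f g \<cdot> inl (Dom C f) (Dom C g) = inl (Cod C f) (Cod C g) \<cdot> f"
    "coprod_map C f g \<cdot> inr (Dom C f) (Dom C g) = inr (Cod C f) (Cod C g) \<cdot> g"
proof -
  let ?i = "inl (Dom C f) (Dom C g)" and ?j = "inr (Dom C f) (Dom C g)"
  let ?k = "inl (Cod C f) (Cod C g)" and ?l = "inr (Cod C f) (Cod C g)"
  let ?P = "\<lambda>u. u \<in> Hom C (Cod C ?i) (Cod C ?k) \<and> u \<cdot> ?i = ?k \<cdot> f \<and> u \<cdot> ?j = ?l \<cdot> g"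
  have "is_coproduct C ?i ?j" using f g by (simp add: coproj)
  moreover have "?k \<cdot> f \<in> Hom C (Dom C ?i) (Cod C ?k)" "?l \<cdot> g \<in> Hom C (Dom C ?j) (Cod C ?k)"
    using f g by (simp_all add: Hom_iff)
  ultimately have "\<exists>!u. ?P u" unfolding is_coproduct_def by blast
  then have "?P (THE u. ?P u)" by (rule theI')
  moreover have "coprod_map C f g = (THE u. ?P u)"
    by (simp add: coprod_map_def case_prod_beta)
  ultimately have "?P (coprod_map C f g)" by simp
  then show "coprod_map C f g \<in> Arr C"
    "Dom C (coprod_map C f g) = coprod C (Dom C f) (Dom C g)"
    "Cod C (coprod_map C f g) = coprod C (Cod C f) (Cod C g)"
    "coprod_map C f g \<cdot> ?i = ?k \<cdot> f" "coprod_map C f g \<cdot> ?j = ?l \<cdot> g"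
    using f g by (simp_all add: Hom_iff)
qed

lemma coprod_mapI:
  assumes f: "f \<in> Arr C" and g: "g \<in> Arr C" and u: "u \<in> Arr C"
    "Dom C u = coprod C (Dom C f) (Dom C g)" "Cod C u = coprod C (Cod C f) (Cod C g)"
    "u \<cdot> inl (Dom C f) (Dom C g) = inl (Cod C f) (Cod C g) \<cdot> f"
    "u \<cdot> inr (Dom C f) (Dom C g) = inr (Cod C f) (Cod C g) \<cdot> g"
  shows "u = coprod_map C f g"
  by (rule is_coproduct_eq[OF coproj(1)[of "Dom C f" "Dom C g"]])
    (use assms coprod_map[OF f g] in simp_all)

lemma slice_equivalence:
  assumes "A \<in> Obj C" "B \<in> Obj C"
  obtains G where "equivalence (prod_cat (slice_cat C A) (slice_cat C B)) (slice_cat C (coprod C A B))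
    (slice_coprod_functor C) G"
  using extensive assms by (auto simp: extensive_def is_equivalence_def)

text \<open>The hypotheses make \<open>(h, k)\<close> and \<open>(h', k')\<close> parallel arrows in
  the product of two slices with the same image under the sum functor, which is faithful. The first
  components are what uniqueness of a mediating arrow into a pullback requires.\<close>

lemma slice_coprod_faithful:
  assumes "f \<in> Arr C" "g \<in> Arr C" "f' \<in> Arr C" "g' \<in> Arr C" "Cod C f' = Cod C f" "Cod C g' = Cod C g"
    and "h \<in> Hom C (Dom C f) (Dom C f')" "f' \<cdot> h = f" "h' \<in> Hom C (Dom C f) (Dom C f')" "f' \<cdot> h' = f"
    and "k \<in> Hom C (Dom C g) (Dom C g')" "g' \<cdot> k = g" "k' \<in> Hom C (Dom C g) (Dom C g')" "g' \<cdot> k' = g"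
    and "coprod_map C h k = coprod_map C h' k'"
  shows "h = h'"
proof -
  obtain G where E: "equivalence (prod_cat (slice_cat C (Cod C f)) (slice_cat C (Cod C g)))
      (slice_cat C (coprod C (Cod C f) (Cod C g))) (slice_coprod_functor C) G"
    using slice_equivalence[of "Cod C f" "Cod C g"] assms by auto
  have "(Arrow f f' h, Arrow g g' k) = (Arrow f f' h', Arrow g g' k')"
    by (rule equivalence_faithful[OF E, of _ "(f, g)" "(f', g')"])
      (use assms in \<open>auto simp: Hom_iff prod_cat_def slice_cat_def slice_coprod_functor_def\<close>)
  then show ?thesis by simp
qed

text \<open>The arrow \<open>w\<close> is an arrow of the slice between two values of the sum
  functor, so fullness splits it into one arrow in each of the two slices.\<close>

lemma slice_coprod_full:
  assumes "f \<in> Arr C" "g \<in> Arr C" "f' \<in> Arr C" "g' \<in> Arr C" "Cod C f' = Cod C f" "Cod C g' = Cod C g"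
    and w: "w \<in> Arr C" "Dom C w = coprod C (Dom C f) (Dom C g)" "Cod C w = coprod C (Dom C f') (Dom C g')"
    "coprod_map C f' g' \<cdot> w = coprod_map C f g"
  shows "\<exists>h k. h \<in> Hom C (Dom C f) (Dom C f') \<and> f' \<cdot> h = f \<and> w = coprod_map C h k \<and>
    k \<in> Hom C (Dom C g) (Dom C g') \<and> g' \<cdot> k = g"
proof -
  let ?AB = "prod_cat (slice_cat C (Cod C f)) (slice_cat C (Cod C g))"
  obtain G where E: "equivalence ?AB
      (slice_cat C (coprod C (Cod C f) (Cod C g))) (slice_coprod_functor C) G"
    using slice_equivalence[of "Cod C f" "Cod C g"] assms by auto
  have "(f, g) \<in> Obj ?AB" "(f', g') \<in> Obj ?AB"
    using assms by (auto simp: prod_cat_def slice_cat_simps)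
  moreover have "Arrow (coprod_map C f g) (coprod_map C f' g') w \<in>
      Hom (slice_cat C (coprod C (Cod C f) (Cod C g)))
       (ob (slice_coprod_functor C) (f, g)) (ob (slice_coprod_functor C) (f', g'))"
    using assms coprod_map[of f g] coprod_map[of f' g']
    unfolding slice_cat_simps(2) slice_coprod_functor_def by (simp add: Hom_iff)
  ultimately obtain hk where hk: "hk \<in> Hom ?AB (f, g) (f', g')"
      "ar (slice_coprod_functor C) hk = Arrow (coprod_map C f g) (coprod_map C f' g') w"
    using equivalence_full[OF E] by metis
  obtain h k where "hk = (h, k)" by (cases hk)
  with hk have "h \<in> Hom (slice_cat C (Cod C f)) f f'" "k \<in> Hom (slice_cat C (Cod C g)) g g'"
    "w = coprod_map C (val h) (val k)"
    by (auto simp: prod_cat_def Hom_iff slice_coprod_functor_def)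
  then show ?thesis unfolding slice_cat_simps(2) by blast
qed

text \<open>Essential surjectivity of the sum functor makes f, as an object over A + B, isomorphic
  to some a + b. The coprojections of the domain of a + b, transported along this isomorphism
  \<open>s\<close>, are x and y.\<close>

lemma chosen_coproduct_decompose:
  assumes AB: "A \<in> Obj C" "B \<in> Obj C" and f: "f \<in> Arr C" "Cod C f = coprod C A B"
  obtains x y a b where "is_coproduct C x y" "Cod C x = Dom C f"
    "a \<in> Hom C (Dom C x) A" "b \<in> Hom C (Dom C y) B" "f \<cdot> x = inl A B \<cdot> a" "f \<cdot> y = inr A B \<cdot> b"
proof -
  let ?AB = "prod_cat (slice_cat C A) (slice_cat C B)"
  obtain G where E: "equivalence ?AB (slice_cat C (coprod C A B)) (slice_coprod_functor C) G"
    using slice_equivalence[OF AB] .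
  have "f \<in> Obj (slice_cat C (coprod C A B))" using f by (simp add: slice_cat_simps)
  then obtain ab e where ab: "ab \<in> Obj ?AB"
    and e: "e \<in> Hom (slice_cat C (coprod C A B)) (ob (slice_coprod_functor C) ab) f"
      "is_iso (slice_cat C (coprod C A B)) e"
    using equivalence_essentially_surjective[OF E] by metis
  obtain a b where "ab = (a, b)" by (cases ab)
  with ab have a: "a \<in> Arr C" "Cod C a = A" and b: "b \<in> Arr C" "Cod C b = B"
    and o: "ob (slice_coprod_functor C) ab = coprod_map C a b"
    by (auto simp: prod_cat_def slice_cat_simps slice_coprod_functor_def)
  define s where "s = val e"
  have s: "is_iso C s" using slice_iso[OF e] by (simp add: s_def)
  note cm = coprod_map[OF a(1) b(1)]
  have s': "s \<in> Arr C" "Dom C s = coprod C (Dom C a) (Dom C b)" "Cod C s = Dom C f"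
     "f \<cdot> s = coprod_map C a b"
    using e(1) cm unfolding slice_cat_simps(2) o s_def by (auto simp: Hom_iff)
  let ?i = "inl (Dom C a) (Dom C b)" and ?j = "inr (Dom C a) (Dom C b)"
  have "is_coproduct C (s \<cdot> ?i) (s \<cdot> ?j)"
    by (rule is_coproduct_comp_iso) (use a b s s' in \<open>simp_all add: coproj\<close>)
  moreover have "f \<cdot> s \<cdot> ?i = inl A B \<cdot> a" "f \<cdot> s \<cdot> ?j = inr A B \<cdot> b"
    using cm a b s' f(1) comp_assoc[of ?i s f] comp_assoc[of ?j s f] by simp_all
  ultimately show ?thesis
    using that[of "s \<cdot> ?i" "s \<cdot> ?j" a b] a b s' by (simp add: Hom_iff)
qed

text \<open>
  A cone with vertex \<open>T\<close> over \<open>f\<close> and \<open>inl\<close> is a morphism into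
  \<open>f\<close> over \<open>A + B\<close> from an object of the form \<open>T + 0\<close>, so full
  faithfulness of \<open>+\<close> provides the unique mediating arrow.
\<close>

lemma chosen_coproduct_pullback:
  assumes AB: "A \<in> Obj C" "B \<in> Obj C" and f: "f \<in> Arr C" "Cod C f = coprod C A B"
    and xy: "is_coproduct C x y" "Cod C x = Dom C f"
    and a: "a \<in> Hom C (Dom C x) A" and b: "b \<in> Hom C (Dom C y) B"
    and fx: "f \<cdot> x = inl A B \<cdot> a" and fy: "f \<cdot> y = inr A B \<cdot> b"
  shows "is_pullback C x a f (inl A B)"
proof -
  note [simp] = is_coproductD[OF xy(1)] AB f xy(2)
  have [simp]: "a \<in> Arr C" "Dom C a = Dom C x" "Cod C a = A" "b \<in> Arr C" "Dom C b = Dom C y" "Cod C b = B"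
    using a b by (auto simp: Hom_iff)
  let ?i = "inl (Dom C x) (Dom C y)" and ?j = "inr (Dom C x) (Dom C y)"
  obtain s where "is_iso C s" and [simp]: "s \<in> Arr C" "Dom C s = Dom C f"
     "Cod C s = coprod C (Dom C x) (Dom C y)" and sx: "s \<cdot> x = ?i" and sy: "s \<cdot> y = ?j"
    using is_coproduct_unique[OF xy(1) coproj(1)[of "Dom C x" "Dom C y"]] by auto
  then obtain s' where [simp]: "s' \<in> Arr C" "Dom C s' = Cod C s" "Cod C s' = Dom C f"
     and s's: "s' \<cdot> s = Id C (Dom C f)"
    using is_isoE by metis
  have s_mono: "u = v" if "s \<cdot> u = s \<cdot> v" "u \<in> Arr C" "v \<in> Arr C" "Cod C u = Dom C f" "Cod C v = Dom C f" for u v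
  proof -
    have "(s' \<cdot> s) \<cdot> u = (s' \<cdot> s) \<cdot> v" using that by simp
    then show ?thesis using that s's by simp
  qed
  note cm = coprod_map[of a b, simplified]
  \<comment> \<open>Through the isomorphism \<open>s\<close> the arrow f becomes the object a + b of
    the slice, to which full faithfulness applies.\<close>
  have fs: "coprod_map C a b \<cdot> s = f"
  proof (rule is_coproduct_eq[OF xy(1)])
    show "(coprod_map C a b \<cdot> s) \<cdot> x = f \<cdot> x" "(coprod_map C a b \<cdot> s) \<cdot> y = f \<cdot> y"
      using sx sy cm fx fy by simp_all
  qed (use cm in simp_all)
  obtain Z where Z: "is_initial C Z" using has_initial .
  then have [simp]: "Z \<in> Obj C" by (simp add: is_initial_def)
  obtain zB where [simp]: "zB \<in> Arr C" "Dom C zB = Z" "Cod C zB = B" using initial_arrow[OF Z AB(2)] .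
  obtain z where [simp]: "z \<in> Arr C" "Dom C z = Z" "Cod C z = Dom C y"
    using initial_arrow[OF Z, of "Dom C y"] by auto
  obtain zS where [simp]: "zS \<in> Arr C" "Dom C zS = Z" "Cod C zS = coprod C (Dom C x) (Dom C y)"
    by (rule initial_arrow[OF Z coprod_Obj[of "Dom C x" "Dom C y"]]) simp_all
  have bz: "b \<cdot> z = zB" by (rule initial_unique[OF Z]) simp_all
  show ?thesis
  proof (rule is_pullbackI)
    fix p q assume pq [simp]: "p \<in> Arr C" "q \<in> Arr C" "Dom C p = Dom C q" "Cod C p = Dom C f"
      "Cod C q = Dom C (inl A B)" and eq: "f \<cdot> p = inl A B \<cdot> q"
    let ?t = "inl (Dom C q) Z" and ?t' = "inr (Dom C q) Z"
    \<comment> \<open>The cone as an arrow from T + 0: \<open>s\<close> after p on T, and the only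
      possible arrow on 0. It lies over A + B because the cone commutes on T and because 0 is
      initial.\<close>
    obtain w where [simp]: "w \<in> Arr C" "Dom C w = coprod C (Dom C q) Z"
      "Cod C w = coprod C (Dom C x) (Dom C y)" and w: "w \<cdot> ?t = s \<cdot> p" "w \<cdot> ?t' = zS"
      using is_coproduct_copair[OF coproj(1)[of "Dom C q" Z], of "s \<cdot> p" zS] by auto
    have [simp]: "Cod C q = A" using pq(5) by simp
    have "coprod_map C a b \<cdot> w = coprod_map C q zB"
    proof (rule coprod_mapI)
      have "(coprod_map C a b \<cdot> w) \<cdot> ?t = (coprod_map C a b \<cdot> s) \<cdot> p" using w cm by simp
      then show "(coprod_map C a b \<cdot> w) \<cdot> inl (Dom C q) (Dom C zB) = inl (Cod C q) (Cod C zB) \<cdot> q"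
        using fs eq by simp
      show "(coprod_map C a b \<cdot> w) \<cdot> inr (Dom C q) (Dom C zB) = inr (Cod C q) (Cod C zB) \<cdot> zB"
        by (rule initial_unique[OF Z]) (use cm in simp_all)
    qed (use cm in simp_all)
    then have "\<exists>h k. h \<in> Hom C (Dom C q) (Dom C a) \<and> a \<cdot> h = q \<and> w = coprod_map C h k \<and>
        k \<in> Hom C (Dom C zB) (Dom C b) \<and> b \<cdot> k = zB"
      by (intro slice_coprod_full) simp_all
    then obtain h k where hk: "h \<in> Hom C (Dom C q) (Dom C a)" "a \<cdot> h = q"
       "k \<in> Hom C (Dom C zB) (Dom C b)" "w = coprod_map C h k"
      by blast
    have h [simp]: "h \<in> Arr C" "Dom C h = Dom C q" "Cod C h = Dom C x"
      "k \<in> Arr C" "Dom C k = Z" "Cod C k = Dom C y" using hk by (auto simp: Hom_iff)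
    have "s \<cdot> (x \<cdot> h) = (s \<cdot> x) \<cdot> h" by simp
    also have "\<dots> = w \<cdot> ?t" unfolding sx hk(4) using coprod_map(4)[of h k] by simp
    finally have "x \<cdot> h = p" using w by - (rule s_mono; simp)
    then show "\<exists>h. h \<in> Arr C \<and> Dom C h = Dom C p \<and> Cod C h = Dom C x \<and> x \<cdot> h = p \<and> a \<cdot> h = q"
      using hk(2) by (intro exI[of _ h]) simp
  next
    fix h h' assume [simp]: "h \<in> Arr C" "h' \<in> Arr C" "Dom C h = Dom C h'" "Cod C h = Dom C x"
      "Cod C h' = Dom C x" and eq: "x \<cdot> h = x \<cdot> h'" "a \<cdot> h = a \<cdot> h'"
    have "(s \<cdot> x) \<cdot> h = (s \<cdot> x) \<cdot> h'" using eq by simp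
    \<comment> \<open>Completing \<open>h\<close> and \<open>h'\<close> by the same \<open>z\<close>
      on the summand 0 turns them into parallel arrows into the pair (a, b) in the product of
      slices.\<close>
    then have "coprod_map C h z = coprod_map C h' z"
      using coprod_map[of h z] coprod_map[of h' z] sx by - (rule coprod_mapI; simp)
    then show "h = h'"
      using eq bz by - (rule slice_coprod_faithful[of "a \<cdot> h" zB a b h h' z z]; simp add: Hom_iff)
  qed (use fx in simp_all)
qed

text \<open>An arbitrary coproduct differs from the chosen one by an isomorphism \<open>s\<close>.
  The chosen case is applied to f followed by the inverse of \<open>s\<close>, and the resulting
  equations are composed with \<open>s\<close>.\<close>

lemma coproduct_decompose:
  assumes ij: "is_coproduct C i j" and f: "f \<in> Arr C" "Cod C f = Cod C i"
  obtains x y a b where "is_coproduct C x y" "Cod C x = Dom C f"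
    "a \<in> Hom C (Dom C x) (Dom C i)" "b \<in> Hom C (Dom C y) (Dom C j)" "f \<cdot> x = i \<cdot> a" "f \<cdot> y = j \<cdot> b"
proof -
  note [simp] = is_coproductD[OF ij] f
  let ?A = "Dom C i" and ?B = "Dom C j"
  obtain s where s: "is_iso C s" and [simp]: "s \<in> Arr C" "Dom C s = coprod C ?A ?B" "Cod C s = Cod C i"
     and si: "s \<cdot> inl ?A ?B = i" "s \<cdot> inr ?A ?B = j"
    using is_coproduct_unique[OF coproj(1) ij, of ?A ?B] by auto
  then obtain s' where [simp]: "s' \<in> Arr C" "Dom C s' = Cod C i" "Cod C s' = coprod C ?A ?B"
     and ss': "s \<cdot> s' = Id C (Cod C i)"
    using is_isoE[OF s] by metis
  obtain x y a b where xy: "is_coproduct C x y" "Cod C x = Dom C (s' \<cdot> f)"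
    "a \<in> Hom C (Dom C x) ?A" "b \<in> Hom C (Dom C y) ?B" "(s' \<cdot> f) \<cdot> x = inl ?A ?B \<cdot> a"
    "(s' \<cdot> f) \<cdot> y = inr ?A ?B \<cdot> b"
    by (rule chosen_coproduct_decompose[of ?A ?B "s' \<cdot> f"]) simp_all
  note xyD = is_coproductD[OF xy(1)]
  have "(s \<cdot> s') \<cdot> f \<cdot> x = (s \<cdot> inl ?A ?B) \<cdot> a"
    using xy(2,3,5) xyD by (simp add: Hom_iff)
  moreover have "(s \<cdot> s') \<cdot> f \<cdot> y = (s \<cdot> inr ?A ?B) \<cdot> b"
    using xy(2,4,6) xyD by (simp add: Hom_iff)
  ultimately show ?thesis using that[OF xy(1) _ xy(3,4)] xy(2) xyD ss' si by simp
qed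

text \<open>Composing the cospan with an isomorphism \<open>s\<close> onto the chosen coproduct
  changes neither its cones nor the mediating arrows, so the chosen case gives the pullback.\<close>

lemma coproduct_pullback:
  assumes ij: "is_coproduct C i j" and f: "f \<in> Arr C" "Cod C f = Cod C i"
    and xy: "is_coproduct C x y" "Cod C x = Dom C f"
    and a: "a \<in> Hom C (Dom C x) (Dom C i)" and b: "b \<in> Hom C (Dom C y) (Dom C j)"
    and fx: "f \<cdot> x = i \<cdot> a" and fy: "f \<cdot> y = j \<cdot> b"
  shows "is_pullback C x a f i"
proof -
  note [simp] = is_coproductD[OF ij] is_coproductD[OF xy(1)] f xy(2)
  have [simp]: "a \<in> Arr C" "Dom C a = Dom C x" "Cod C a = Dom C i"
    "b \<in> Arr C" "Dom C b = Dom C y" "Cod C b = Dom C j"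
    using a b by (auto simp: Hom_iff)
  let ?A = "Dom C i" and ?B = "Dom C j"
  obtain s where s: "is_iso C s" and [simp]: "s \<in> Arr C" "Dom C s = Cod C i" "Cod C s = coprod C ?A ?B"
     and si: "s \<cdot> i = inl ?A ?B" "s \<cdot> j = inr ?A ?B"
    using is_coproduct_unique[OF ij coproj(1), of ?A ?B] by auto
  have "(s \<cdot> f) \<cdot> x = (s \<cdot> i) \<cdot> a" "(s \<cdot> f) \<cdot> y = (s \<cdot> j) \<cdot> b" using fx fy by simp_all
  then have "is_pullback C x a (s \<cdot> f) (inl ?A ?B)"
    using xy a b si by (intro chosen_coproduct_pullback[of ?A ?B "s \<cdot> f" x y a b]) simp_all
  note pb = is_pullback_lift[OF this] is_pullback_eq[OF this]
  show ?thesis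
  proof (rule is_pullbackI)
    fix p q assume pq: "p \<in> Arr C" "q \<in> Arr C" "Dom C p = Dom C q" "Cod C p = Dom C f"
      "Cod C q = Dom C i" "f \<cdot> p = i \<cdot> q"
    then have "(s \<cdot> f) \<cdot> p = (s \<cdot> i) \<cdot> q" by simp
    then show "\<exists>h. h \<in> Arr C \<and> Dom C h = Dom C p \<and> Cod C h = Dom C x \<and> x \<cdot> h = p \<and> a \<cdot> h = q"
      using pq si pb(1)[of p q] by auto
  next
    fix h k assume "h \<in> Arr C" "k \<in> Arr C" "Dom C h = Dom C k" "Cod C h = Dom C x"
      "Cod C k = Dom C x" "x \<cdot> h = x \<cdot> k" "a \<cdot> h = a \<cdot> k"
    then show "h = k" using pb(2)[of h k] by simp
  qed (use fx in simp_all)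
qed

end

section \<open>Coprojections\<close>

text \<open>Membership of a generalised element t in the subobject n. The subobject comes first, so
  between coprojections \<open>factors C n m\<close> expresses that m is contained in n. The
  factoring arrow stays existential; it is unique once n is monic.\<close>

definition factors :: "('o, 'a) cat \<Rightarrow> 'a \<Rightarrow> 'a \<Rightarrow> bool" where
  "factors C n t \<longleftrightarrow> n \<in> Arr C \<and> (\<exists>b \<in> Arr C. Cod C b = Dom C n \<and> Comp C n b = t)"

context category
begin

lemma factorsE:
  assumes "factors C n t"
  obtains b where "n \<in> Arr C" "b \<in> Arr C" "Cod C b = Dom C n" "Dom C b = Dom C t" "n \<cdot> b = t"
    "t \<in> Arr C" "Cod C t = Cod C n"
  using assms by (auto simp: factors_def)

lemma factors_Arr: "factors C n t \<Longrightarrow> n \<in> Arr C \<and> t \<in> Arr C \<and> Cod C t = Cod C n"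
  by (auto elim: factorsE)

lemma factorsI: "\<lbrakk>n \<in> Arr C; b \<in> Arr C; Cod C b = Dom C n\<rbrakk> \<Longrightarrow> factors C n (n \<cdot> b)"
  by (auto simp: factors_def)

lemma factors_refl: "n \<in> Arr C \<Longrightarrow> factors C n n"
  using factorsI[of n "Id C (Dom C n)"] by simp

lemma factors_comp:
  assumes "factors C n t" "x \<in> Arr C" "Cod C x = Dom C t"
  shows "factors C n (t \<cdot> x)"
proof -
  obtain b where b: "n \<in> Arr C" "b \<in> Arr C" "Cod C b = Dom C n" "Dom C b = Dom C t" "n \<cdot> b = t"
    using factorsE[OF assms(1)] .
  then have "t \<cdot> x = n \<cdot> (b \<cdot> x)" using assms(2,3) comp_assoc[of x b n] by simp
  then show ?thesis using factorsI[of n "b \<cdot> x"] b assms(2,3) by simp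
qed

lemma factors_trans:
  assumes "factors C n m" "factors C m t"
  shows "factors C n t"
proof -
  obtain b where "b \<in> Arr C" "Cod C b = Dom C m" "m \<cdot> b = t"
    using factorsE[OF assms(2)] .
  then show ?thesis using factors_comp[OF assms(1), of b] by simp
qed

lemma coprojection_Arr: "coprojection C m \<Longrightarrow> m \<in> Arr C"
  by (auto simp: coprojection_def dest: is_coproductD)

lemma coprojectionI: "is_coproduct C m n \<Longrightarrow> coprojection C m"
  by (auto simp: coprojection_def)

lemma coprojectionI2: "is_coproduct C m n \<Longrightarrow> coprojection C n"
  using is_coproduct_sym coprojectionI by blast

lemma coprojection_precomp_iso:
  "\<lbrakk>coprojection C m; is_iso C h; Cod C h = Dom C m\<rbrakk> \<Longrightarrow> coprojection C (m \<cdot> h)"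
  unfolding coprojection_def using is_coproduct_precomp_iso by blast

text \<open>This is the associativity (D + D') + M' = D + (D' + M'): the complement of the composite
  is the coproduct of the two complements, mapped into the codomain by \<open>k\<close>.\<close>

lemma coprojection_comp:
  assumes m: "coprojection C m" and d: "coprojection C d" "Cod C d = Dom C m"
    and cop: "has_finite_coproducts C"
  shows "coprojection C (m \<cdot> d)"
proof -
  obtain m' d' where mm: "is_coproduct C m m'" and dd: "is_coproduct C d d'"
    using m d(1) by (auto simp: coprojection_def)
  note [simp] = is_coproductD[OF mm] is_coproductD[OF dd] d(2)
  obtain i j where ij: "is_coproduct C i j" and [simp]: "Dom C i = Dom C d'" "Dom C j = Dom C m'"
    using cop Obj_Dom unfolding has_finite_coproducts_def by (metis is_coproductD(2) mm dd)
  note [simp] = is_coproductD[OF ij]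
  obtain k where [simp]: "k \<in> Arr C" "Dom C k = Cod C i" "Cod C k = Cod C m"
    and k: "k \<cdot> i = m \<cdot> d'" "k \<cdot> j = m'"
    using is_coproduct_copair[OF ij, of "m \<cdot> d'" m'] by auto
  have "is_coproduct C (m \<cdot> d) k"
  proof (rule is_coproductI)
    fix f g assume [simp]: "f \<in> Arr C" "g \<in> Arr C" "Dom C f = Dom C (m \<cdot> d)" "Dom C g = Dom C k"
      "Cod C f = Cod C g"
    obtain v where [simp]: "v \<in> Arr C" "Dom C v = Cod C d" "Cod C v = Cod C f"
      and v: "v \<cdot> d = f" "v \<cdot> d' = g \<cdot> i"
      using is_coproduct_copair[OF dd, of f "g \<cdot> i"] by auto
    obtain u where [simp]: "u \<in> Arr C" "Dom C u = Cod C m" "Cod C u = Cod C v"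
      and u: "u \<cdot> m = v" "u \<cdot> m' = g \<cdot> j"
      using is_coproduct_copair[OF mm, of v "g \<cdot> j"] by auto
    have "(u \<cdot> m) \<cdot> d = f" "(u \<cdot> m) \<cdot> d' = g \<cdot> i" unfolding u v by simp_all
    then have ud: "u \<cdot> (m \<cdot> d) = f" "u \<cdot> (m \<cdot> d') = g \<cdot> i" by simp_all
    have "u \<cdot> k = g" by (rule is_coproduct_eq[OF ij]) (use ud k u in simp_all)
    then show "\<exists>u. u \<in> Arr C \<and> Dom C u = Cod C (m \<cdot> d) \<and> Cod C u = Cod C f \<and>
        u \<cdot> (m \<cdot> d) = f \<and> u \<cdot> k = g"
      using ud by (intro exI[of _ u]) simp
  next
    fix u v assume [simp]: "u \<in> Arr C" "v \<in> Arr C" "Dom C u = Cod C (m \<cdot> d)"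
      "Dom C v = Cod C (m \<cdot> d)" "Cod C u = Cod C v"
      and eq: "u \<cdot> (m \<cdot> d) = v \<cdot> (m \<cdot> d)" "u \<cdot> k = v \<cdot> k"
    have ki: "(u \<cdot> k) \<cdot> i = (v \<cdot> k) \<cdot> i" "(u \<cdot> k) \<cdot> j = (v \<cdot> k) \<cdot> j" using eq by simp_all
    have "u \<cdot> m = v \<cdot> m" by (rule is_coproduct_eq[OF dd]) (use eq(1) ki k in simp_all)
    then show "u = v" using ki k by - (rule is_coproduct_eq[OF mm]; simp)
  qed simp_all
  then show ?thesis by (rule coprojectionI)
qed

end

section \<open>Monic and disjoint coprojections, strict initial objects, and Boolean laws for
  summands\<close>

context extensive_category
begin

lemma coprojection_Id: "X \<in> Obj C \<Longrightarrow> coprojection C (Id C X)"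
  using has_initial initial_arrow is_coproduct_initial coprojectionI by metis

lemma coprojection_compose:
  "\<lbrakk>coprojection C m; coprojection C d; Cod C d = Dom C m\<rbrakk> \<Longrightarrow> coprojection C (m \<cdot> d)"
  using coprojection_comp extensive by (auto simp: extensive_def)

text \<open>The pullback of m along itself is computed from the decomposition of its domain as Dom m
  + 0. The part over m is everything, so the kernel pair of m consists of identities, and a and b
  are the same mediating arrow.\<close>

lemma coprojection_mono:
  assumes "coprojection C m" "m \<cdot> a = m \<cdot> b" "a \<in> Arr C" "b \<in> Arr C"
    "Cod C a = Dom C m" "Cod C b = Dom C m"
  shows "a = b"
proof -
  obtain n where mn: "is_coproduct C m n" using assms(1) by (auto simp: coprojection_def)
  note [simp] = is_coproductD[OF mn] assms(3-6)
  obtain Z where Z: "is_initial C Z" using has_initial .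
  obtain z where z: "z \<in> Arr C" "Dom C z = Z" "Cod C z = Dom C m" using initial_arrow[OF Z, of "Dom C m"] by auto
  obtain z' where z': "z' \<in> Arr C" "Dom C z' = Z" "Cod C z' = Dom C n" using initial_arrow[OF Z, of "Dom C n"] by auto
  have "m \<cdot> z = n \<cdot> z'" by (rule initial_unique[OF Z]) (use z z' in simp_all)
  then have pb: "is_pullback C (Id C (Dom C m)) (Id C (Dom C m)) m m"
    using z z' is_coproduct_initial[OF Z z]
    by - (rule coproduct_pullback[OF mn, where y = z and b = z']; simp add: Hom_iff)
  have "Dom C (m \<cdot> a) = Dom C (m \<cdot> b)" using assms(2) by simp
  then have "Dom C a = Dom C b" by simp
  then show ?thesis using is_pullback_lift[OF pb, of a b] assms(2) by (metis assms(3-6))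
qed

text \<open>An initial Z is the coproduct Z + Z with identities as coprojections. Pulled back along
  f this gives coprojections x and y that have sections, as pullbacks of identities. An arrow that
  restricts to \<open>g'\<close> along x and to g after f along y must then equal both.\<close>

lemma initial_strict:
  assumes Z: "is_initial C Z" and f: "f \<in> Arr C" "Cod C f = Z"
  shows "is_initial C (Dom C f)"
proof -
  have ZO [simp]: "Z \<in> Obj C" using Z by (simp add: is_initial_def)
  note [simp] = f
  have ZZ: "is_coproduct C (Id C Z) (Id C Z)" by (rule is_coproduct_initial[OF Z]) simp_all
  obtain x y a b where xy: "is_coproduct C x y" "Cod C x = Dom C f"
    "a \<in> Hom C (Dom C x) (Dom C (Id C Z))" "b \<in> Hom C (Dom C y) (Dom C (Id C Z))"
    "f \<cdot> x = Id C Z \<cdot> a" "f \<cdot> y = Id C Z \<cdot> b"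
    by (rule coproduct_decompose[OF ZZ f(1)]) simp
  note [simp] = is_coproductD[OF xy(1)] xy(2)
  have "is_pullback C x a f (Id C Z)" "is_pullback C y b f (Id C Z)"
    using coproduct_pullback[OF ZZ f(1) _ xy(1)]
      coproduct_pullback[OF ZZ f(1) _ is_coproduct_sym[OF xy(1)]] xy by simp_all
  note pb = is_pullback_lift[OF this(1), of "Id C (Dom C f)" f] is_pullback_lift[OF this(2), of "Id C (Dom C f)" f]
  obtain h where h: "h \<in> Arr C" "Dom C h = Dom C f" "Cod C h = Dom C x" "x \<cdot> h = Id C (Dom C f)"
    using pb(1) by auto
  obtain k where k: "k \<in> Arr C" "Dom C k = Dom C f" "Cod C k = Dom C y" "y \<cdot> k = Id C (Dom C f)"
    using pb(2) by auto
  show ?thesis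
    unfolding is_initial_def
  proof (intro conjI ballI)
    fix Y assume Y: "Y \<in> Obj C"
    obtain g where g: "g \<in> Arr C" "Dom C g = Z" "Cod C g = Y" using initial_arrow[OF Z Y] .
    show "\<exists>!g. g \<in> Hom C (Dom C f) Y"
    proof (rule ex1I[of _ "g \<cdot> f"])
      fix g' assume "g' \<in> Hom C (Dom C f) Y"
      then have g': "g' \<in> Arr C" "Dom C g' = Dom C f" "Cod C g' = Y" by (auto simp: Hom_iff)
      obtain u where u: "u \<in> Arr C" "Dom C u = Dom C f" "Cod C u = Y" "u \<cdot> x = g' \<cdot> x" "u \<cdot> y = (g \<cdot> f) \<cdot> y"
        using is_coproduct_copair[OF xy(1), of "g' \<cdot> x" "(g \<cdot> f) \<cdot> y"] g g' by auto
      have "(u \<cdot> x) \<cdot> h = (g' \<cdot> x) \<cdot> h" "(u \<cdot> y) \<cdot> k = ((g \<cdot> f) \<cdot> y) \<cdot> k" using u(4,5) by simp_all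
      then have "u = g'" "u = g \<cdot> f" using u(1-3) h k g g' by simp_all
      then show "g' = g \<cdot> f" by simp
    qed (use g in \<open>simp add: Hom_iff\<close>)
  qed simp
qed

text \<open>The intersection of i and j, computed by \<open>coproduct_pullback\<close> from the
  decomposition of Dom i as 0 + Dom i, has an initial vertex. Any cone over i and j maps into it,
  and strictness applies to the vertex of the cone.\<close>

lemma coproduct_disjoint:
  assumes ij: "is_coproduct C i j" and "i \<cdot> p = j \<cdot> q" "p \<in> Arr C" "q \<in> Arr C"
    "Cod C p = Dom C i" "Cod C q = Dom C j"
  shows "is_initial C (Dom C p)"
proof -
  note [simp] = is_coproductD[OF ij] assms(3-6)
  obtain Z where Z: "is_initial C Z" using has_initial .
  obtain z where z: "z \<in> Arr C" "Dom C z = Z" "Cod C z = Dom C i" using initial_arrow[OF Z, of "Dom C i"] by auto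
  obtain z' where z': "z' \<in> Arr C" "Dom C z' = Z" "Cod C z' = Dom C j" using initial_arrow[OF Z, of "Dom C j"] by auto
  have "i \<cdot> z = j \<cdot> z'" by (rule initial_unique[OF Z]) (use z z' in simp_all)
  then have pb: "is_pullback C z z' i j"
    using z z' is_coproduct_sym[OF is_coproduct_initial[OF Z z]]
    by - (rule coproduct_pullback[OF is_coproduct_sym[OF ij], where y = "Id C (Dom C i)" and b = "Id C (Dom C i)"];
      simp add: Hom_iff)
  have "Dom C (i \<cdot> p) = Dom C (j \<cdot> q)" using assms(2) by simp
  then have "Dom C p = Dom C q" by simp
  then obtain h where "h \<in> Arr C" "Dom C h = Dom C p" "Cod C h = Dom C z"
    using is_pullback_lift[OF pb, of p q] assms(2) by auto
  then show ?thesis using initial_strict[OF Z] z by metis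
qed

text \<open>The section is the copair of the arrow out of the initial summand with the identity. It
  serves to discard an empty part of a decomposition.\<close>

lemma coproduct_initial_section:
  assumes xy: "is_coproduct C x y" and "is_initial C (Dom C x)"
  obtains g where "g \<in> Arr C" "Dom C g = Cod C y" "Cod C g = Dom C y" "y \<cdot> g = Id C (Cod C y)"
proof -
  note [simp] = is_coproductD[OF xy]
  obtain z where z: "z \<in> Arr C" "Dom C z = Dom C x" "Cod C z = Dom C y"
    using initial_arrow[OF assms(2), of "Dom C y"] by auto
  obtain g where g: "g \<in> Arr C" "Dom C g = Cod C y" "Cod C g = Dom C y" "g \<cdot> x = z" "g \<cdot> y = Id C (Dom C y)"
    using is_coproduct_copair[OF xy, of z "Id C (Dom C y)"] z by auto
  have "y \<cdot> z = x" by (rule initial_unique[OF assms(2)]) (use z in simp_all)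
  then have "y \<cdot> g = Id C (Cod C y)" using g by - (rule is_coproduct_eq[OF xy]; simp)
  then show ?thesis using that g by blast
qed

lemma coproduct_split:
  assumes ij: "is_coproduct C i j" and f: "f \<in> Arr C" "Cod C f = Cod C i"
  obtains x y a b where "is_coproduct C x y" "is_pullback C x a f i" "is_pullback C y b f j"
proof -
  obtain x y a b where xy: "is_coproduct C x y" "Cod C x = Dom C f"
    "a \<in> Hom C (Dom C x) (Dom C i)" "b \<in> Hom C (Dom C y) (Dom C j)" "f \<cdot> x = i \<cdot> a" "f \<cdot> y = j \<cdot> b"
    using coproduct_decompose[OF ij f] .
  show ?thesis
    using that[OF xy(1) coproduct_pullback[OF ij f xy]
        coproduct_pullback[OF is_coproduct_sym[OF ij] f(1) _ is_coproduct_sym[OF xy(1)] _ xy(4,3,6,5)]]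
      is_coproductD[OF ij] is_coproductD[OF xy(1)] f(2) xy(2) by simp
qed

lemma coprojection_pullback:
  assumes "coprojection C n" "f \<in> Arr C" "Cod C f = Cod C n"
  obtains p q where "is_pullback C p q f n"
  using assms coproduct_split[of n _ f] unfolding coprojection_def by metis

lemma pullback_coprojection:
  assumes pb: "is_pullback C p q f n" and n: "coprojection C n"
  shows "coprojection C p"
proof -
  note D = is_pullbackD[OF pb]
  obtain x y a where xy: "is_coproduct C x y" "is_pullback C x a f n"
    using coproduct_split[of n _ f] n D(1,3) unfolding coprojection_def by metis
  obtain h where "is_iso C h" "Cod C h = Dom C x" "x \<cdot> h = p"
    using is_pullback_unique[OF pb xy(2)] by metis
  then show ?thesis using coprojection_precomp_iso[OF coprojectionI[OF xy(1)]] by blast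
qed

lemma factors_disjoint:
  assumes "is_coproduct C m n" "factors C m t" "factors C n t"
  shows "is_initial C (Dom C t)"
proof -
  obtain b where b: "b \<in> Arr C" "Cod C b = Dom C m" "Dom C b = Dom C t" "m \<cdot> b = t"
    using factorsE[OF assms(2)] .
  obtain c where c: "c \<in> Arr C" "Cod C c = Dom C n" "Dom C c = Dom C t" "n \<cdot> c = t"
    using factorsE[OF assms(3)] .
  show ?thesis using coproduct_disjoint[OF assms(1), of b c] b c by simp
qed

lemma factors_initial:
  assumes "is_initial C (Dom C t)" "t \<in> Arr C" "n \<in> Arr C" "Cod C t = Cod C n"
  shows "factors C n t"
proof -
  obtain b where b: "b \<in> Arr C" "Dom C b = Dom C t" "Cod C b = Dom C n"
    using initial_arrow[OF assms(1), of "Dom C n"] assms(3) by auto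
  have "n \<cdot> b = t" by (rule initial_unique[OF assms(1)]) (use assms b in simp_all)
  then show ?thesis using factorsI[of n b] b assms by simp
qed

lemma factors_split:
  assumes "is_coproduct C m n" "w \<in> Arr C" "Cod C w = Cod C m"
  obtains x y where "is_coproduct C x y" "Cod C x = Dom C w" "factors C m (w \<cdot> x)" "factors C n (w \<cdot> y)"
proof -
  obtain x y a b where xy: "is_coproduct C x y" "Cod C x = Dom C w"
    "a \<in> Hom C (Dom C x) (Dom C m)" "b \<in> Hom C (Dom C y) (Dom C n)" "w \<cdot> x = m \<cdot> a" "w \<cdot> y = n \<cdot> b"
    using coproduct_decompose[OF assms] .
  then show ?thesis
    using that[of x y] factorsI[of m a] factorsI[of n b] is_coproductD[OF assms(1)] by (simp add: Hom_iff)
qed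

text \<open>This is the Boolean law that w lies below the complement of m when their meet is bottom,
  with the meet tested on generalised elements. After splitting w along the coproduct, the part over
  m has initial domain, so the other coprojection has a section and w factors through n.\<close>

lemma factors_complement:
  assumes mn: "is_coproduct C m n" and w: "w \<in> Arr C" "Cod C w = Cod C m"
    and init: "\<And>x. \<lbrakk>x \<in> Arr C; Cod C x = Dom C w; factors C m (w \<cdot> x)\<rbrakk> \<Longrightarrow> is_initial C (Dom C x)"
  shows "factors C n w"
proof -
  obtain x y where xy: "is_coproduct C x y" "Cod C x = Dom C w" "factors C m (w \<cdot> x)" "factors C n (w \<cdot> y)"
    using factors_split[OF mn w] .
  note D = is_coproductD[OF xy(1)]
  obtain g where g: "g \<in> Arr C" "Dom C g = Cod C y" "Cod C g = Dom C y" "y \<cdot> g = Id C (Cod C y)"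
    using coproduct_initial_section[OF xy(1)] init[OF D(1) xy(2,3)] by blast
  then have "(w \<cdot> y) \<cdot> g = w" using w D xy(2) by simp
  then show ?thesis using factors_comp[OF xy(4), of g] g D xy(2) w by simp
qed

text \<open>The witness is m composed with the pullback of n along m. Its universal property is
  stated for all generalised elements t, not only for coprojections, because filters and germs are
  tested on such t.\<close>

lemma factors_meet:
  assumes "coprojection C m" "coprojection C n" "Cod C m = Cod C n"
  obtains w where "coprojection C w" "factors C m w" "factors C n w"
    "\<And>t. \<lbrakk>factors C m t; factors C n t\<rbrakk> \<Longrightarrow> factors C w t"
proof -
  note [simp] = coprojection_Arr[OF assms(1)] coprojection_Arr[OF assms(2)]
  obtain p q where pb: "is_pullback C p q m n"
    using coprojection_pullback[OF assms(2), of m] assms(3) by auto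
  note D = is_pullbackD[OF pb]
  have cp: "coprojection C (m \<cdot> p)"
    using coprojection_compose[OF assms(1) pullback_coprojection[OF pb assms(2)]] D by simp
  show ?thesis
  proof (rule that[OF cp])
    show "factors C m (m \<cdot> p)" using D by (intro factorsI) simp_all
    show "factors C n (m \<cdot> p)" unfolding D(9) using D by (intro factorsI) simp_all
    fix t assume t: "factors C m t" "factors C n t"
    obtain b where b: "b \<in> Arr C" "Cod C b = Dom C m" "Dom C b = Dom C t" "m \<cdot> b = t"
      using factorsE[OF t(1)] .
    obtain c where c: "c \<in> Arr C" "Cod C c = Dom C n" "Dom C c = Dom C t" "n \<cdot> c = t"
      using factorsE[OF t(2)] .
    obtain h where h: "h \<in> Arr C" "Cod C h = Dom C p" "p \<cdot> h = b"
      using is_pullback_lift[OF pb, of b c] b c by auto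
    have "(m \<cdot> p) \<cdot> h = t" using h b D(1-8) by simp
    then show "factors C (m \<cdot> p) t" using factorsI[of "m \<cdot> p" h] h D(1-8) by simp
  qed
qed

text \<open>Two coprojections that factor through each other do so by mutually inverse arrows, as
  both are monic. Equality of isomorphism classes can therefore be decided by \<open>factors\<close>
  alone.\<close>

lemma mem_iso_class:
  assumes m: "coprojection C m"
  shows "t \<in> iso_class C m \<longleftrightarrow> coprojection C t \<and> factors C m t \<and> factors C t m"
proof
  note [simp] = coprojection_Arr[OF m]
  assume "t \<in> iso_class C m"
  then obtain h where h: "t = m \<cdot> h" "is_iso C h" "Cod C h = Dom C m"
    by (auto simp: iso_class_def)
  obtain k where k: "h \<in> Arr C" "k \<in> Arr C" "Dom C k = Cod C h" "Cod C k = Dom C h" "h \<cdot> k = Id C (Cod C h)"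
    using is_isoE[OF h(2)] .
  have "(m \<cdot> h) \<cdot> k = m" using k h by simp
  then show "coprojection C t \<and> factors C m t \<and> factors C t m"
    using coprojection_precomp_iso[OF m h(2,3)] factorsI[of m h] factorsI[of "m \<cdot> h" k] h k by simp
next
  note [simp] = coprojection_Arr[OF m]
  assume t: "coprojection C t \<and> factors C m t \<and> factors C t m"
  then have [simp]: "t \<in> Arr C" by (auto intro: coprojection_Arr)
  obtain b where b: "b \<in> Arr C" "Cod C b = Dom C m" "Dom C b = Dom C t" "m \<cdot> b = t"
    using factorsE[of m t] t by blast
  obtain c where c: "c \<in> Arr C" "Cod C c = Dom C t" "Dom C c = Dom C m" "t \<cdot> c = m"
    using factorsE[of t m] t by blast
  have "(m \<cdot> b) \<cdot> c = m" "(t \<cdot> c) \<cdot> b = t" using b(4) c(4) by simp_all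
  then have "b \<cdot> c = Id C (Dom C m)" "c \<cdot> b = Id C (Dom C t)"
    using b(1-3) c(1-3) coprojection_mono[OF m, of "b \<cdot> c" "Id C (Dom C m)"]
      coprojection_mono[of t "c \<cdot> b" "Id C (Dom C t)"] t by simp_all
  then have "is_iso C b" using b c by (intro is_isoI[where g = c]) simp_all
  then show "t \<in> iso_class C m" using b by (auto simp: iso_class_def)
qed

lemma iso_class_self: "coprojection C m \<Longrightarrow> m \<in> iso_class C m"
  by (simp add: mem_iso_class factors_refl coprojection_Arr)

lemma iso_class_eq_iff:
  assumes "coprojection C m" "coprojection C n"
  shows "iso_class C m = iso_class C n \<longleftrightarrow> factors C m n \<and> factors C n m"
  using iso_class_self[OF assms(2)] assms by (auto simp: mem_iso_class intro: factors_trans)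

text \<open>An inclusion between some representatives passes to all of them, because representatives
  of one class factor through each other. The order of the arguments is reversed.\<close>

lemma summand_le_iff:
  assumes m: "coprojection C m" and n: "coprojection C n"
  shows "summand_le C (iso_class C m) (iso_class C n) \<longleftrightarrow> factors C n m"
proof
  assume "summand_le C (iso_class C m) (iso_class C n)"
  then obtain m' n' h where "m' \<in> iso_class C m" "n' \<in> iso_class C n" "h \<in> Hom C (Dom C m') (Dom C n')"
     "n' \<cdot> h = m'"
    by (auto simp: summand_le_def)
  then have "factors C n' m'" "factors C n n'" "factors C m' m"
    using factorsI[of n' h] m n by (auto simp: mem_iso_class Hom_iff coprojection_Arr)
  then show "factors C n m" using factors_trans by blast
next
  assume "factors C n m"
  then obtain b where "b \<in> Hom C (Dom C m) (Dom C n)" "n \<cdot> b = m"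
    using factorsE[of n m] unfolding Hom_iff by blast
  moreover have "m \<in> iso_class C m" "n \<in> iso_class C n"
    using m n by (simp_all add: iso_class_self)
  ultimately show "summand_le C (iso_class C m) (iso_class C n)"
    by (auto simp: summand_le_def)
qed

end

section \<open>Ultrafilters of summands\<close>

definition large :: "('o, 'a) cat \<Rightarrow> 'a set set \<Rightarrow> 'a \<Rightarrow> bool" where
  "large C U m \<longleftrightarrow> coprojection C m \<and> iso_class C m \<in> U"

text \<open>A quantifier for validity near U. All composites of w with an x are tested, not only w,
  so that two such statements can be combined on a smaller summand without P being known to be
  stable under restriction.\<close>

definition ev :: "('o, 'a) cat \<Rightarrow> 'a set set \<Rightarrow> ('a \<Rightarrow> bool) \<Rightarrow> bool" where
  "ev C U P \<longleftrightarrow> (\<exists>w. large C U w \<and> (\<forall>x \<in> Arr C. Cod C x = Dom C w \<longrightarrow> P (Comp C w x)))"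

context extensive_category
begin

lemma SummandsE:
  assumes "V \<in> Summands C X"
  obtains m where "coprojection C m" "Cod C m = X" "V = iso_class C m"
  using assms by (auto simp: Summands_def)

lemma Summands_iff: "coprojection C m \<Longrightarrow> iso_class C m \<in> Summands C X \<longleftrightarrow> Cod C m = X"
  unfolding Summands_def using iso_class_eq_iff factors_Arr by fastforce

lemma large_coprojection: "large C U m \<Longrightarrow> coprojection C m"
  by (simp add: large_def)

lemma large_Arr: "large C U m \<Longrightarrow> m \<in> Arr C"
  by (simp add: large_def coprojection_Arr)

text \<open>Every class in F has a representative, and the order on classes becomes
  \<open>factors\<close> between representatives. Upward closure carries no condition on codomains,
  since factoring already forces them to agree.\<close>

lemma filter_iff:
  "is_filter (Summands C X) (summand_le C) F \<longleftrightarrow> F \<subseteq> Summands C X \<and> (\<exists>m. large C F m) \<and>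
    (\<forall>m n. large C F m \<longrightarrow> coprojection C n \<longrightarrow> factors C n m \<longrightarrow> large C F n) \<and>
    (\<forall>m n. large C F m \<longrightarrow> large C F n \<longrightarrow> (\<exists>w. large C F w \<and> factors C m w \<and> factors C n w))"
  (is "?L \<longleftrightarrow> ?R")
proof (cases "F \<subseteq> Summands C X")
  case True
  have ex: "\<And>V. V \<in> F \<Longrightarrow> \<exists>m. V = iso_class C m \<and> large C F m"
    using True SummandsE large_def by (metis subsetD)
  have ex': "\<And>V. V \<in> Summands C X \<Longrightarrow> \<exists>m. V = iso_class C m \<and> coprojection C m"
    using SummandsE by metis
  have cod: "\<And>m. large C F m \<Longrightarrow> Cod C m = X"
    using True Summands_iff by (auto simp: large_def)
  show ?thesis
  proof
    assume L: ?L
    have "\<exists>m. large C F m" using L ex by (auto simp: is_filter_def)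
    moreover have "large C F n" if "large C F m" "coprojection C n" "factors C n m" for m n
    proof -
      have "iso_class C n \<in> Summands C X" "iso_class C m \<in> F"
        using that cod[of m] factors_Arr[of n m] Summands_iff[of n] by (auto simp: large_def)
      then show ?thesis
        using L that summand_le_iff[of m n] by (auto simp: is_filter_def large_def)
    qed
    moreover have "\<exists>w. large C F w \<and> factors C m w \<and> factors C n w"
      if mn: "large C F m" "large C F n" for m n
    proof -
      have "iso_class C m \<in> F" "iso_class C n \<in> F" using mn by (auto simp: large_def)
      then obtain W where W: "W \<in> F" "summand_le C W (iso_class C m)" "summand_le C W (iso_class C n)"
        using L unfolding is_filter_def by blast
      obtain w where "W = iso_class C w" "large C F w" using ex[OF W(1)] by blast
      then show ?thesis using W mn summand_le_iff by (auto simp: large_def)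
    qed
    ultimately show ?R using True by blast
  next
    assume R: ?R
    have "V \<in> F" if UV: "U \<in> F" "V \<in> Summands C X" "summand_le C U V" for U V
    proof -
      obtain m n where mn: "U = iso_class C m" "large C F m" "V = iso_class C n" "coprojection C n"
        using ex[OF UV(1)] ex'[OF UV(2)] by blast
      then have "large C F n" using R UV(3) summand_le_iff[of m n] by (auto simp: large_def)
      then show ?thesis using mn by (simp add: large_def)
    qed
    moreover have "\<exists>W \<in> F. summand_le C W U \<and> summand_le C W V" if UV: "U \<in> F" "V \<in> F" for U V
    proof -
      obtain m n where mn: "U = iso_class C m" "large C F m" "V = iso_class C n" "large C F n"
        using ex[OF UV(1)] ex[OF UV(2)] by blast
      then obtain w where "large C F w" "factors C m w" "factors C n w" using R by blast
      then show ?thesis using mn by (intro bexI[of _ "iso_class C w"]) (auto simp: summand_le_iff large_def)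
    qed
    ultimately show ?L using R by (auto simp: is_filter_def large_def)
  qed
qed (simp add: is_filter_def)

lemma coprojection_initial:
  assumes "X \<in> Obj C"
  obtains z where "is_coproduct C (Id C X) z" "is_initial C (Dom C z)" "coprojection C z" "Cod C z = X"
proof -
  obtain Z where Z: "is_initial C Z" using has_initial .
  obtain z where "z \<in> Arr C" "Dom C z = Z" "Cod C z = X" using initial_arrow[OF Z assms] .
  then show ?thesis using that[of z] is_coproduct_initial[OF Z] coprojectionI2 Z by blast
qed

text \<open>A summand with initial domain is the bottom element: it factors through every
  coprojection into X, so a filter containing it contains all summands.\<close>

lemma filter_proper_iff:
  assumes X: "X \<in> Obj C" and F: "is_filter (Summands C X) (summand_le C) F"
  shows "F \<noteq> Summands C X \<longleftrightarrow> (\<forall>m. large C F m \<longrightarrow> \<not> is_initial C (Dom C m))"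
proof
  assume neq: "F \<noteq> Summands C X"
  note F = F[unfolded filter_iff]
  show "\<forall>m. large C F m \<longrightarrow> \<not> is_initial C (Dom C m)"
  proof (intro allI impI notI)
    fix m assume m: "large C F m" "is_initial C (Dom C m)"
    have "Cod C m = X" using F m(1) Summands_iff by (auto simp: large_def)
    have "Summands C X \<subseteq> F"
    proof
      fix V assume "V \<in> Summands C X"
      then obtain n where n: "coprojection C n" "Cod C n = X" "V = iso_class C n" by (rule SummandsE)
      then have "factors C n m"
        using factors_initial[OF m(2) large_Arr[OF m(1)]] \<open>Cod C m = X\<close> coprojection_Arr by simp
      then have "large C F n" using F m(1) n by blast
      then show "V \<in> F" using n by (simp add: large_def)
    qed
    then show False using F neq by blast
  qed
next
  assume R: "\<forall>m. large C F m \<longrightarrow> \<not> is_initial C (Dom C m)"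
  obtain z where "is_initial C (Dom C z)" "coprojection C z" "Cod C z = X"
    using coprojection_initial[OF X] .
  then show "F \<noteq> Summands C X" using R Summands_iff[of z X] by (auto simp: large_def)
qed

text \<open>Non-emptiness and properness both come from the complement condition for the identity of
  X and its empty complement: one of the two is large, and not both.\<close>

lemma ultrafilterI:
  assumes X: "X \<in> Obj C" and sub: "U \<subseteq> Summands C X"
    and up: "\<And>m n. \<lbrakk>large C U m; coprojection C n; factors C n m\<rbrakk> \<Longrightarrow> large C U n"
    and dir: "\<And>m n. \<lbrakk>large C U m; large C U n\<rbrakk> \<Longrightarrow> \<exists>w. large C U w \<and> factors C m w \<and> factors C n w"
    and compl: "\<And>m n. \<lbrakk>is_coproduct C m n; Cod C m = X\<rbrakk> \<Longrightarrow> large C U m \<longleftrightarrow> \<not> large C U n"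
  shows "U \<in> ultrafilters C X"
proof -
  obtain z where z: "is_coproduct C (Id C X) z" "is_initial C (Dom C z)" "coprojection C z" "Cod C z = X"
    using coprojection_initial[OF X] .
  have "\<exists>m. large C U m" using compl[OF z(1)] X by auto
  then have U: "is_filter (Summands C X) (summand_le C) U"
    unfolding filter_iff using sub up dir by blast
  have cod: "\<And>m. large C U m \<Longrightarrow> Cod C m = X" using sub Summands_iff by (auto simp: large_def)
  have "U \<noteq> Summands C X"
    unfolding filter_proper_iff[OF X U]
  proof (intro allI impI notI)
    fix m assume m: "large C U m" "is_initial C (Dom C m)"
    then have "large C U n" if "coprojection C n" "Cod C n = X" for n
      using up[OF m(1) that(1)] factors_initial[OF m(2) large_Arr[OF m(1)]] that cod[OF m(1)] coprojection_Arr
      by simp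
    then show False using compl[OF z(1)] X z coprojection_Id by simp
  qed
  moreover have "G = U" if G: "is_filter (Summands C X) (summand_le C) G" "U \<subseteq> G" "G \<noteq> Summands C X" for G
  proof (rule ccontr)
    assume "G \<noteq> U"
    \<comment> \<open>A strictly larger G contains some m outside U, whose complement n belongs to
      U. Then m and n have a common refinement in G, and its domain is initial.\<close>
    then obtain V where V: "V \<in> G" "V \<notin> U" using G(2) by blast
    note G' = G(1)[unfolded filter_iff]
    obtain m where m: "coprojection C m" "Cod C m = X" "V = iso_class C m"
      using V(1) G' SummandsE by (metis subsetD)
    then obtain n where n: "is_coproduct C m n" by (auto simp: coprojection_def)
    then have "large C U n" using compl[OF n] m V by (auto simp: large_def)
    then have "large C G n" "large C G m" using G(2) V m by (auto simp: large_def)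
    then obtain w where "large C G w" "factors C m w" "factors C n w" using G' by blast
    then show False
      using factors_disjoint[OF n] G(3) unfolding filter_proper_iff[OF X G(1)] by blast
  qed
  ultimately show ?thesis using U by (auto simp: ultrafilters_def is_ultrafilter_def)
qed

lemma ultrafilter_filter:
  assumes "U \<in> ultrafilters C X"
  shows "is_filter (Summands C X) (summand_le C) U" "U \<noteq> Summands C X"
  using assms by (auto simp: ultrafilters_def is_ultrafilter_def)

lemma large_Cod: "\<lbrakk>U \<in> ultrafilters C X; large C U m\<rbrakk> \<Longrightarrow> Cod C m = X"
  using ultrafilter_filter(1)[of U X] Summands_iff[of m X] by (auto simp: filter_iff large_def)

lemma large_up:
  "\<lbrakk>U \<in> ultrafilters C X; large C U m; coprojection C n; factors C n m\<rbrakk> \<Longrightarrow> large C U n"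
  using ultrafilter_filter(1)[of U X] unfolding filter_iff by blast

lemma large_dir:
  assumes "U \<in> ultrafilters C X" "large C U m" "large C U n"
  obtains w where "large C U w" "factors C m w" "factors C n w"
  using ultrafilter_filter(1)[of U X] assms unfolding filter_iff by blast

lemma ultrafilter_Obj: "U \<in> ultrafilters C X \<Longrightarrow> X \<in> Obj C"
  using ultrafilter_filter(1)[of U X] large_Cod[of U X] unfolding filter_iff
  by (metis Obj_Cod large_Arr)

lemma large_not_initial: "\<lbrakk>U \<in> ultrafilters C X; large C U m\<rbrakk> \<Longrightarrow> \<not> is_initial C (Dom C m)"
  using ultrafilter_filter[of U X] filter_proper_iff[OF ultrafilter_Obj[of U X], of U] by blast

lemma large_Id: 
  assumes "U \<in> ultrafilters C X"
  shows "large C U (Id C X)"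
proof -
  have X: "X \<in> Obj C" by (rule ultrafilter_Obj[OF assms])
  obtain m where m: "large C U m" using ultrafilter_filter(1)[OF assms] unfolding filter_iff by blast
  have "factors C (Id C X) m" using factorsI[of "Id C X" m] X large_Arr[OF m] large_Cod[OF assms m] by simp
  then show ?thesis using large_up[OF assms m] coprojection_Id[OF X] by blast
qed

text \<open>A common refinement of complementary summands would be initial, which excludes that both
  are large. Otherwise, if n is not large, maximality is tested on the filter generated by U and m:
  it is proper, so it equals U and m is large.\<close>

lemma large_complement:
  assumes U: "U \<in> ultrafilters C X" and mn: "is_coproduct C m n" "Cod C m = X"
  shows "large C U m \<longleftrightarrow> \<not> large C U n"
proof
  assume m: "large C U m"
  show "\<not> large C U n"
  proof
    assume "large C U n"
    then obtain w where "large C U w" "factors C m w" "factors C n w" using large_dir[OF U m] by blast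
    then show False using factors_disjoint[OF mn(1)] large_not_initial[OF U] by blast
  qed
next
  assume n: "\<not> large C U n"
  have X: "X \<in> Obj C" by (rule ultrafilter_Obj[OF U])
  note Uf = ultrafilter_filter(1)[OF U, unfolded filter_iff]
  have cm: "coprojection C m" "coprojection C n" using mn coprojectionI coprojectionI2 by blast+
  \<comment> \<open>The generated filter: v contains the meet of m with some w in U, the meet being
    tested on generalised elements t.\<close>
  define Q where "Q v \<longleftrightarrow> coprojection C v \<and> Cod C v = X \<and>
    (\<exists>w. large C U w \<and> (\<forall>t. factors C w t \<longrightarrow> factors C m t \<longrightarrow> factors C v t))" for v
  define G where "G = {iso_class C v | v. Q v}"
  have Q_iso: "Q v" if "iso_class C v = iso_class C v'" "coprojection C v" "Q v'" for v v'
  proof -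
    have vv: "coprojection C v'" "Cod C v' = X" using that(3) by (auto simp: Q_def)
    then have "factors C v v'" using that iso_class_eq_iff by blast
    then show ?thesis
      using that(2,3) vv factors_trans[of v v'] factors_Arr[of v v'] unfolding Q_def by metis
  qed
  have GQ: "large C G v \<longleftrightarrow> Q v" for v
  proof
    assume "large C G v"
    then obtain v' where "coprojection C v" "iso_class C v = iso_class C v'" "Q v'"
      by (auto simp: large_def G_def)
    then show "Q v" using Q_iso by blast
  qed (auto simp: large_def G_def Q_def)
  have QI: "Q v" if "large C U v" for v
    using that large_Cod[OF U that] unfolding Q_def by (auto simp: large_def)
  have "is_filter (Summands C X) (summand_le C) G"
    unfolding filter_iff GQ
  proof (intro conjI allI impI)
    show "G \<subseteq> Summands C X" by (auto simp: G_def Q_def Summands_def)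
    show "\<exists>m. Q m" using QI large_Id[OF U] by blast
    fix v v'
    show "Q v'" if "Q v" "coprojection C v'" "factors C v' v"
      using that factors_trans[of v' v] factors_Arr[of v' v] unfolding Q_def by metis
    assume v: "Q v" and v': "Q v'"
    obtain w where w: "large C U w" "\<And>t. \<lbrakk>factors C w t; factors C m t\<rbrakk> \<Longrightarrow> factors C v t"
      using v by (auto simp: Q_def)
    obtain w' where w': "large C U w'" "\<And>t. \<lbrakk>factors C w' t; factors C m t\<rbrakk> \<Longrightarrow> factors C v' t"
      using v' by (auto simp: Q_def)
    obtain w'' where w'': "large C U w''" "factors C w w''" "factors C w' w''"
      using large_dir[OF U w(1) w'(1)] .
    have "coprojection C v" "coprojection C v'" "Cod C v = Cod C v'" using v v' by (auto simp: Q_def)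
    then obtain u where u: "coprojection C u" "factors C v u" "factors C v' u"
      "\<And>t. \<lbrakk>factors C v t; factors C v' t\<rbrakk> \<Longrightarrow> factors C u t"
      using factors_meet by blast
    have "Cod C u = X" using factors_Arr[OF u(2)] v by (simp add: Q_def)
    moreover have "\<forall>t. factors C w'' t \<longrightarrow> factors C m t \<longrightarrow> factors C u t"
      using u(4) w(2)[OF factors_trans[OF w''(2)]] w'(2)[OF factors_trans[OF w''(3)]] by blast
    ultimately have "Q u" using w'' u(1) unfolding Q_def by blast
    then show "\<exists>u. Q u \<and> factors C v u \<and> factors C v' u" using u by blast
  qed
  moreover have "U \<subseteq> G"
  proof
    fix V assume "V \<in> U"
    then obtain v where "large C U v" "V = iso_class C v" using Uf SummandsE by (metis large_def subsetD)
    then show "V \<in> G" using QI by (auto simp: G_def)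
  qed
  ultimately have "G = U \<or> G = Summands C X" using U by (auto simp: ultrafilters_def is_ultrafilter_def)
  \<comment> \<open>If the empty summand belonged to this filter, some w in U would meet m only in
    initial parts, and w would lie below n by \<open>factors_complement\<close>; but n is not
    large.\<close>
  moreover have "G \<noteq> Summands C X"
  proof
    assume "G = Summands C X"
    moreover obtain z where z: "is_initial C (Dom C z)" "coprojection C z" "Cod C z = X"
      using coprojection_initial[OF X] .
    ultimately have "Q z" using Summands_iff[of z X] GQ[of z] by (simp add: large_def)
    then obtain w where w: "large C U w" "\<And>t. \<lbrakk>factors C w t; factors C m t\<rbrakk> \<Longrightarrow> factors C z t"
      by (auto simp: Q_def)
    have wA: "w \<in> Arr C" "Cod C w = X" using large_Arr[OF w(1)] large_Cod[OF U w(1)] by auto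
    have "factors C n w"
    proof (rule factors_complement[OF mn(1) wA(1)])
      fix x assume x: "x \<in> Arr C" "Cod C x = Dom C w" "factors C m (w \<cdot> x)"
      then have "factors C z (w \<cdot> x)" using w(2) factorsI wA by blast
      then obtain b where "b \<in> Arr C" "Cod C b = Dom C z" "Dom C b = Dom C (w \<cdot> x)"
        by (rule factorsE)
      then show "is_initial C (Dom C x)" using initial_strict[OF z(1)] x wA by force
    qed (use mn wA in simp)
    then show False using n large_up[OF U w(1) cm(2)] by blast
  qed
  ultimately have "G = U" by blast
  moreover have "Q m" using cm(1) mn(2) large_Id[OF U] unfolding Q_def by blast
  ultimately show "large C U m" using GQ by blast
qed

text \<open>Maximality of U upgrades the inclusion to an equality. For pushed ultrafilters this
  halves the work, as only one direction has to be followed through \<open>ev\<close>.\<close>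

lemma ultrafilter_eqI:
  assumes U: "U \<in> ultrafilters C X" and V: "V \<in> ultrafilters C X"
    and sub: "\<And>m. large C U m \<Longrightarrow> large C V m"
  shows "U = V"
proof -
  have "U \<subseteq> V"
  proof
    fix W assume "W \<in> U"
    then obtain m where "large C U m" "W = iso_class C m"
      using ultrafilter_filter(1)[OF U] SummandsE unfolding filter_iff by (metis large_def subsetD)
    then show "W \<in> V" using sub by (auto simp: large_def)
  qed
  then show ?thesis using U ultrafilter_filter[OF V] by (auto simp: ultrafilters_def is_ultrafilter_def)
qed

section \<open>Calculus of the quantifier \<open>ev\<close>\<close>

lemma ev_I:
  assumes "large C U w" "\<And>x. \<lbrakk>x \<in> Arr C; Cod C x = Dom C w\<rbrakk> \<Longrightarrow> P (w \<cdot> x)"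
  shows "ev C U P"
  using assms by (auto simp: ev_def)

lemma ev_E:
  assumes "ev C U P"
  obtains w where "large C U w" "P w"
proof -
  obtain w where w: "large C U w" "\<And>x. \<lbrakk>x \<in> Arr C; Cod C x = Dom C w\<rbrakk> \<Longrightarrow> P (w \<cdot> x)"
    using assms by (auto simp: ev_def)
  have wA: "w \<in> Arr C" by (rule large_Arr[OF w(1)])
  then have "P w" using w(2)[of "Id C (Dom C w)"] by simp
  then show ?thesis using that w(1) by blast
qed

lemma ev_mono:
  assumes "ev C U P" "\<And>t. \<lbrakk>t \<in> Arr C; P t\<rbrakk> \<Longrightarrow> Q t"
  shows "ev C U Q"
proof -
  obtain w where w: "large C U w" "\<And>x. \<lbrakk>x \<in> Arr C; Cod C x = Dom C w\<rbrakk> \<Longrightarrow> P (w \<cdot> x)"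
    using assms(1) by (auto simp: ev_def)
  show ?thesis by (rule ev_I[OF w(1)]) (use w large_Arr[OF w(1)] assms(2) in simp)
qed

text \<open>A common refinement of the two witnessing summands works: its generalised elements are
  generalised elements of both.\<close>

lemma ev_conj:
  assumes U: "U \<in> ultrafilters C X" and P: "ev C U P" and Q: "ev C U Q"
  shows "ev C U (\<lambda>t. P t \<and> Q t)"
proof -
  obtain v where v: "large C U v" "\<And>x. \<lbrakk>x \<in> Arr C; Cod C x = Dom C v\<rbrakk> \<Longrightarrow> P (v \<cdot> x)"
    using P by (auto simp: ev_def)
  obtain u where u: "large C U u" "\<And>x. \<lbrakk>x \<in> Arr C; Cod C x = Dom C u\<rbrakk> \<Longrightarrow> Q (u \<cdot> x)"
    using Q by (auto simp: ev_def)
  obtain w where w: "large C U w" "factors C v w" "factors C u w" using large_dir[OF U v(1) u(1)] .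
  show ?thesis
  proof (rule ev_I[OF w(1)])
    fix x assume x: "x \<in> Arr C" "Cod C x = Dom C w"
    obtain b where b: "b \<in> Arr C" "Cod C b = Dom C v" "Dom C b = Dom C (w \<cdot> x)" "v \<cdot> b = w \<cdot> x"
      using factorsE[OF factors_comp[OF w(2) x]] .
    obtain c where c: "c \<in> Arr C" "Cod C c = Dom C u" "Dom C c = Dom C (w \<cdot> x)" "u \<cdot> c = w \<cdot> x"
      using factorsE[OF factors_comp[OF w(3) x]] .
    show "P (w \<cdot> x) \<and> Q (w \<cdot> x)" using v(2)[of b] u(2)[of c] b c by simp
  qed
qed

lemma ev_large: "large C U m \<Longrightarrow> ev C U (factors C m)"
  by (rule ev_I) (auto intro: factorsI large_Arr)

lemma ev_True: "U \<in> ultrafilters C X \<Longrightarrow> ev C U (\<lambda>t. t \<in> Arr C \<and> Cod C t = X)"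
  using ev_I[of U "Id C X"] large_Id[of U X] ultrafilter_Obj[of U X] by simp

end

section \<open>Germs of partial maps\<close>

text \<open>
  A partial map \<open>r = (m, f)\<close> acts on those generalised elements \<open>t\<close> of the codomain of
  \<open>m\<close> that factor through \<open>m\<close>. As \<open>m\<close> is monic, the action is single-valued, and the
  action of a composite partial map is the composite of the actions.
\<close>

definition app :: "('o, 'a) cat \<Rightarrow> 'a \<times> 'a \<Rightarrow> 'a \<Rightarrow> 'a \<Rightarrow> bool" where
  "app C r t z \<longleftrightarrow>
     (\<exists>b \<in> Arr C. Cod C b = Dom C (fst r) \<and> Comp C (fst r) b = t \<and> Comp C (snd r) b = z)"

text \<open>Partial maps defined on a member of U, with no ultrafilter on Y in sight. Continuity is
  left out because \<open>push\<close> provides the one ultrafilter on Y for which it holds.\<close>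

definition rep :: "('o, 'a) cat \<Rightarrow> 'a set set \<Rightarrow> 'o \<Rightarrow> 'a \<times> 'a \<Rightarrow> bool" where
  "rep C U Y r \<longleftrightarrow> large C U (fst r) \<and> snd r \<in> Hom C (Dom C (fst r)) Y"

text \<open>The analogue for partial maps of the pushforward of an ultrafilter. A summand is
  accepted when the values of r eventually lie in it, so no pullback is chosen;
  \<open>large_push_preimage\<close> recovers the condition on preimages.\<close>

definition push :: "('o, 'a) cat \<Rightarrow> 'a set set \<Rightarrow> 'a \<times> 'a \<Rightarrow> 'a set set" where
  "push C U r = {iso_class C n | n. coprojection C n \<and> Cod C n = Cod C (snd r) \<and>
     ev C U (\<lambda>t. \<exists>z. app C r t z \<and> factors C n z)}"

text \<open>Expresses that s represents the composite of the germs of r and r'. Being a relation, it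
  leaves open on which summand the composite is defined, so any convenient representative may
  serve.\<close>

definition rcomp :: "('o, 'a) cat \<Rightarrow> 'a set set \<Rightarrow> 'a \<times> 'a \<Rightarrow> 'a \<times> 'a \<Rightarrow> 'a \<times> 'a \<Rightarrow> bool" where
  "rcomp C U r r' s \<longleftrightarrow> ev C U (\<lambda>t. \<exists>y z. app C r t y \<and> app C r' y z \<and> app C s t z)"

text \<open>The target ultrafilter is computed from r and need not be carried along; by
  \<open>UF_ArrE\<close> every arrow of \<open>UF C\<close> has this form.\<close>

definition germ_at :: "('o, 'a) cat \<Rightarrow> 'o \<Rightarrow> 'a set set \<Rightarrow> 'a \<times> 'a \<Rightarrow>
    (('o, 'a) uf, ('a \<times> 'a) set) arrow" where
  "germ_at C X U r = germ C (X, U) (Cod C (snd r), push C U r) r"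

context extensive_category
begin

lemma repD:
  assumes "rep C U Y r"
  shows "fst r \<in> Arr C" "snd r \<in> Arr C" "Dom C (snd r) = Dom C (fst r)" "Cod C (snd r) = Y"
    "coprojection C (fst r)" "large C U (fst r)" "Y \<in> Obj C"
  using assms large_Arr[of U "fst r"] large_coprojection[of U "fst r"] Obj_Cod[of "snd r"]
  by (auto simp: rep_def Hom_iff)

lemma appE:
  assumes "rep C U Y r" "app C r t z"
  obtains b where "b \<in> Arr C" "Cod C b = Dom C (fst r)" "Dom C b = Dom C t" "fst r \<cdot> b = t" "snd r \<cdot> b = z"
    "t \<in> Arr C" "z \<in> Arr C" "Dom C z = Dom C t" "Cod C z = Y" "Cod C t = Cod C (fst r)"
  using assms repD[OF assms(1)] by (auto simp: app_def)

lemma app_Arr: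
  assumes "rep C U Y r" "app C r t z"
  shows "t \<in> Arr C" "z \<in> Arr C" "Dom C z = Dom C t" "Cod C z = Y"
  using appE[OF assms] by blast+

lemma appI:
  assumes "b \<in> Arr C" "Cod C b = Dom C (fst r)"
  shows "app C r (fst r \<cdot> b) (snd r \<cdot> b)"
  using assms by (auto simp: app_def)

lemma app_comp:
  assumes r: "rep C U Y r" and a: "app C r t z" and x: "x \<in> Arr C" "Cod C x = Dom C t"
  shows "app C r (t \<cdot> x) (z \<cdot> x)"
proof -
  obtain b where b: "b \<in> Arr C" "Cod C b = Dom C (fst r)" "Dom C b = Dom C t" "fst r \<cdot> b = t" "snd r \<cdot> b = z"
    using appE[OF r a] .
  show ?thesis
    using appI[of "b \<cdot> x" r] b x repD[OF r] comp_assoc[of x b "fst r"] comp_assoc[of x b "snd r"] by simp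
qed

lemma app_fun:
  assumes "rep C U Y r" "app C r t z" "app C r t z'"
  shows "z = z'"
  using coprojection_mono[OF repD(5)[OF assms(1)]] assms(2,3) unfolding app_def by metis

lemma app_self:
  assumes "rep C U Y r"
  shows "app C r (fst r) (snd r)"
  using appI[of "Id C (Dom C (fst r))" r] repD[OF assms] by simp

lemma ev_app:
  assumes "rep C U Y r"
  shows "ev C U (\<lambda>t. \<exists>z. app C r t z)"
  by (rule ev_I[of U "fst r"]) (use repD[OF assms] appI in blast)+

lemma rep_Id: "\<lbrakk>U \<in> ultrafilters C X; f \<in> Arr C; Dom C f = X; Cod C f = Y\<rbrakk> \<Longrightarrow> rep C U Y (Id C X, f)"
  using large_Id[of U X] by (auto simp: rep_def Hom_iff)

lemma app_Id: "f \<in> Arr C \<Longrightarrow> app C (Id C (Dom C f), f) t z \<longleftrightarrow> t \<in> Arr C \<and> Cod C t = Dom C f \<and> z = f \<cdot> t"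
  by (auto simp: app_def)

lemma large_push:
  assumes r: "rep C U Y r"
  shows "large C (push C U r) n \<longleftrightarrow>
    coprojection C n \<and> Cod C n = Y \<and> ev C U (\<lambda>t. \<exists>z. app C r t z \<and> factors C n z)"
proof
  assume "large C (push C U r) n"
  then obtain n' where n': "coprojection C n" "iso_class C n = iso_class C n'" "coprojection C n'"
    "Cod C n' = Y" "ev C U (\<lambda>t. \<exists>z. app C r t z \<and> factors C n' z)"
    using repD(4)[OF r] by (auto simp: large_def push_def)
  then have nn: "factors C n n'" using iso_class_eq_iff by blast
  have "ev C U (\<lambda>t. \<exists>z. app C r t z \<and> factors C n z)"
    by (rule ev_mono[OF n'(5)]) (use nn factors_trans in blast)
  then show "coprojection C n \<and> Cod C n = Y \<and> ev C U (\<lambda>t. \<exists>z. app C r t z \<and> factors C n z)"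
    using n' factors_Arr[OF nn] by simp
next
  assume "coprojection C n \<and> Cod C n = Y \<and> ev C U (\<lambda>t. \<exists>z. app C r t z \<and> factors C n z)"
  then show "large C (push C U r) n" using repD(4)[OF r] by (auto simp: large_def push_def)
qed

text \<open>By the definition of \<open>push\<close>, the values of r eventually lie in the summand
  that witnesses Q. This is the change of variables along r.\<close>

lemma ev_push:
  assumes r: "rep C U Y r" and Q: "ev C (push C U r) Q"
  shows "ev C U (\<lambda>t. \<exists>y. app C r t y \<and> Q y)"
proof -
  obtain v where v: "large C (push C U r) v" "\<And>x. \<lbrakk>x \<in> Arr C; Cod C x = Dom C v\<rbrakk> \<Longrightarrow> Q (v \<cdot> x)"
    using Q by (auto simp: ev_def)
  have "ev C U (\<lambda>t. \<exists>z. app C r t z \<and> factors C v z)" using v(1) large_push[OF r] by blast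
  then show ?thesis by (rule ev_mono) (use v(2) in \<open>auto simp: factors_def\<close>)
qed

text \<open>Upward closure and meets pass through \<open>ev\<close>. If complementary m and n were
  both large, the values of r on some large summand would lie in both, and that summand would be
  initial. If n is not large, primality of U is applied to the preimage of m.\<close>

lemma push_in_ultrafilters:
  assumes U: "U \<in> ultrafilters C X" and r: "rep C U Y r"
  shows "push C U r \<in> ultrafilters C Y"
proof (rule ultrafilterI)
  note [simp] = repD[OF r]
  show "Y \<in> Obj C" by simp
  show "push C U r \<subseteq> Summands C Y" by (auto simp: push_def Summands_def)
  fix m n
  show "large C (push C U r) n"
    if mn: "large C (push C U r) m" "coprojection C n" "factors C n m"
  proof -
    have "ev C U (\<lambda>t. \<exists>z. app C r t z \<and> factors C m z)" using mn(1) large_push[OF r] by blast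
    then have "ev C U (\<lambda>t. \<exists>z. app C r t z \<and> factors C n z)"
      by (rule ev_mono) (use mn(3) factors_trans in blast)
    then show ?thesis using mn large_push[OF r] factors_Arr[OF mn(3)] by simp
  qed
  show "\<exists>w. large C (push C U r) w \<and> factors C m w \<and> factors C n w"
    if mn: "large C (push C U r) m" "large C (push C U r) n"
  proof -
    have c: "coprojection C m" "coprojection C n" "Cod C m = Y" "Cod C n = Y" using mn large_push[OF r] by auto
    then obtain w where w: "coprojection C w" "factors C m w" "factors C n w"
       "\<And>t. \<lbrakk>factors C m t; factors C n t\<rbrakk> \<Longrightarrow> factors C w t"
      using factors_meet[of m n] by auto
    have "ev C U (\<lambda>t. (\<exists>z. app C r t z \<and> factors C m z) \<and> (\<exists>z. app C r t z \<and> factors C n z))"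
      using mn large_push[OF r] by (intro ev_conj[OF U]) auto
    then have "ev C U (\<lambda>t. \<exists>z. app C r t z \<and> factors C w z)"
      by (rule ev_mono) (use w(4) app_fun[OF r] in blast)
    then have "large C (push C U r) w" using w(1) large_push[OF r] factors_Arr[OF w(2)] c(3) by simp
    then show ?thesis using w(2,3) by blast
  qed
  show "large C (push C U r) m \<longleftrightarrow> \<not> large C (push C U r) n"
    if mn: "is_coproduct C m n" "Cod C m = Y"
  proof
    assume m: "large C (push C U r) m"
    show "\<not> large C (push C U r) n"
    proof
      assume "large C (push C U r) n"
      then have "ev C U (\<lambda>t. (\<exists>z. app C r t z \<and> factors C m z) \<and> (\<exists>z. app C r t z \<and> factors C n z))"
        using m large_push[OF r] by (intro ev_conj[OF U]) auto
      then obtain w z where w: "large C U w" "app C r w z" "factors C m z" "factors C n z"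
        by (rule ev_E) (use app_fun[OF r] in blast)
      then have "is_initial C (Dom C w)" using factors_disjoint[OF mn(1)] app_Arr[OF r] by metis
      then show False using large_not_initial[OF U w(1)] by blast
    qed
  next
    assume n: "\<not> large C (push C U r) n"
    have cmn: "coprojection C m" "coprojection C n" "Cod C n = Y"
      using mn coprojectionI coprojectionI2 is_coproductD by auto
    define k where "k = fst r"
    define f where "f = snd r"
    have [simp]: "k \<in> Arr C" "f \<in> Arr C" "Dom C f = Dom C k" "Cod C f = Y" "coprojection C k"
      using repD[OF r] by (simp_all add: k_def f_def)
    obtain x y a b where xy: "is_coproduct C x y" "is_pullback C x a f m" "is_pullback C y b f n"
      by (rule coproduct_split[OF mn(1), of f]) (simp_all add: mn(2))
    note X = is_pullbackD[OF xy(2)] and Y = is_pullbackD[OF xy(3)]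
    have "coprojection C (k \<cdot> x)"
      using coprojection_compose[of k x] coprojectionI[OF xy(1)] X by simp
    \<comment> \<open>The complement in X of the preimage of m. By primality of U it remains to
      exclude that d is large.\<close>
    then obtain d where d: "is_coproduct C (k \<cdot> x) d" by (auto simp: coprojection_def)
    have cod: "Cod C (k \<cdot> x) = X" using X large_Cod[OF U, of k] by (simp add: k_def)
    have "\<not> large C U d"
    proof
      assume d': "large C U d"
      \<comment> \<open>A generalised element of d has only initial parts in x, the preimage of m,
        so it lies in the complementary preimage y of n. If d were large, the values of f would thus
        eventually lie in n.\<close>
      have "factors C y c" if c: "c \<in> Arr C" "Cod C c = Dom C k" "factors C d (k \<cdot> c)" for c
      proof (rule factors_complement[OF xy(1)])
        fix s assume s: "s \<in> Arr C" "Cod C s = Dom C c" "factors C x (c \<cdot> s)"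
        obtain e where e: "e \<in> Arr C" "Cod C e = Dom C x" "Dom C e = Dom C (c \<cdot> s)" "x \<cdot> e = c \<cdot> s"
          using factorsE[OF s(3)] .
        have "(k \<cdot> x) \<cdot> e = k \<cdot> (c \<cdot> s)" using e X by simp
        then have "factors C (k \<cdot> x) (k \<cdot> (c \<cdot> s))"
          using factorsI[of "k \<cdot> x" e] e X by simp
        moreover have "factors C d (k \<cdot> (c \<cdot> s))" using factors_comp[OF c(3), of s] s c by simp
        ultimately have "is_initial C (Dom C (k \<cdot> (c \<cdot> s)))" by (rule factors_disjoint[OF d])
        then show "is_initial C (Dom C s)" using s c by simp
      qed (use c X in simp_all)
      note fy = this
      have "ev C U (\<lambda>t. factors C d t \<and> (\<exists>z. app C r t z))"
        by (rule ev_conj[OF U ev_large[OF d'] ev_app[OF r]])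
      then have "ev C U (\<lambda>t. \<exists>z. app C r t z \<and> factors C n z)"
      proof (rule ev_mono)
        fix t assume t: "factors C d t \<and> (\<exists>z. app C r t z)"
        then obtain c where c: "c \<in> Arr C" "Cod C c = Dom C k" "k \<cdot> c = t" "app C r t (f \<cdot> c)"
          by (auto simp: app_def k_def f_def)
        then obtain e where e: "e \<in> Arr C" "Cod C e = Dom C y" "y \<cdot> e = c"
          using fy[of c] t by (auto simp: factors_def)
        have "f \<cdot> c = (f \<cdot> y) \<cdot> e" using e Y(1-8) by auto
        also have "\<dots> = n \<cdot> (b \<cdot> e)" using e Y by simp
        finally have "factors C n (f \<cdot> c)" using factorsI[of n "b \<cdot> e"] e Y by simp
        then show "\<exists>z. app C r t z \<and> factors C n z" using c by blast
      qed
      then show False using n large_push[OF r] cmn by blast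
    qed
    then have "large C U (k \<cdot> x)" using large_complement[OF U d cod] by blast
    then have "ev C U (\<lambda>t. \<exists>z. app C r t z \<and> factors C m z)"
    proof (rule ev_I)
      fix s assume s: "s \<in> Arr C" "Cod C s = Dom C (k \<cdot> x)"
      then have s': "Cod C s = Dom C x" using X by simp
      have "app C r ((k \<cdot> x) \<cdot> s) (f \<cdot> (x \<cdot> s))" using appI[of "x \<cdot> s" r] s s' X by (simp add: k_def f_def)
      moreover have "(f \<cdot> x) \<cdot> s = m \<cdot> (a \<cdot> s)" using s s' X by simp
      then have "f \<cdot> (x \<cdot> s) = m \<cdot> (a \<cdot> s)" using s s' X(1-8) by simp
      then have "factors C m (f \<cdot> (x \<cdot> s))" using factorsI[of m "a \<cdot> s"] s s' X by simp
      ultimately show "\<exists>z. app C r ((k \<cdot> x) \<cdot> s) z \<and> factors C m z" by blast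
    qed
    then show "large C (push C U r) m" using large_push[OF r] cmn mn(2) by blast
  qed
qed

section \<open>Preimages of summands, and continuity as equality with the pushed ultrafilter\<close>

lemma is_pullback_precomp_iso:
  assumes pb: "is_pullback C p q f g" and h: "is_iso C h" "Cod C h = Dom C p"
  shows "is_pullback C (p \<cdot> h) (q \<cdot> h) f g"
proof -
  note D = is_pullbackD[OF pb]
  obtain k where k: "h \<in> Arr C" "k \<in> Arr C" "Dom C k = Cod C h" "Cod C k = Dom C h"
    "k \<cdot> h = Id C (Dom C h)" "h \<cdot> k = Id C (Cod C h)" using is_isoE[OF h(1)] .
  show ?thesis
  proof (rule is_pullbackI)
    have "(f \<cdot> p) \<cdot> h = (g \<cdot> q) \<cdot> h" using D(9) by simp
    then show "f \<cdot> p \<cdot> h = g \<cdot> q \<cdot> h" using D(1-8) k h by simp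
    fix a b assume "a \<in> Arr C" "b \<in> Arr C" "Dom C a = Dom C b" "Cod C a = Dom C f" "Cod C b = Dom C g"
        "f \<cdot> a = g \<cdot> b"
    then obtain l where l: "l \<in> Arr C" "Dom C l = Dom C a" "Cod C l = Dom C p" "p \<cdot> l = a" "q \<cdot> l = b"
      using is_pullback_lift[OF pb, of a b] by blast
    have "h \<cdot> (k \<cdot> l) = l" using comp_assoc[of l k h] k l h by simp
    then show "\<exists>l. l \<in> Arr C \<and> Dom C l = Dom C a \<and> Cod C l = Dom C (p \<cdot> h) \<and> (p \<cdot> h) \<cdot> l = a \<and> (q \<cdot> h) \<cdot> l = b"
      using k l h D(1-8) by (intro exI[of _ "k \<cdot> l"]) simp
  next
    fix l l' assume l: "l \<in> Arr C" "l' \<in> Arr C" "Dom C l = Dom C l'" "Cod C l = Dom C (p \<cdot> h)"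
        "Cod C l' = Dom C (p \<cdot> h)" "(p \<cdot> h) \<cdot> l = (p \<cdot> h) \<cdot> l'" "(q \<cdot> h) \<cdot> l = (q \<cdot> h) \<cdot> l'"
    then have l': "Cod C l = Dom C h" "Cod C l' = Dom C h" using D k h by simp_all
    have "h \<cdot> l = h \<cdot> l'"
      by (rule is_pullback_eq[OF pb]) (use l l' D(1-8) k h in simp_all)
    then have "(k \<cdot> h) \<cdot> l = (k \<cdot> h) \<cdot> l'" using l l' k(1-4) by simp
    then show "l = l'" using l(1,2) l' k(5) by simp
  qed (use D k h in simp_all)
qed

text \<open>Pullbacks along f of two representatives of one class factor through each other, and
  \<open>mem_iso_class\<close> then identifies them. In particular \<open>preimage\<close> returns a
  single summand.\<close>

lemma preimage_iso_class:
  assumes n: "coprojection C n" and pb: "is_pullback C p q f n"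
  shows "preimage C f (iso_class C n) = iso_class C p"
proof -
  note D = is_pullbackD[OF pb]
  have p: "coprojection C p" by (rule pullback_coprojection[OF pb n])
  show ?thesis
  proof (intro set_eqI iffI)
    fix t assume "t \<in> preimage C f (iso_class C n)"
    then obtain v u where v: "coprojection C v" "factors C n v" "factors C v n" and pb': "is_pullback C t u f v"
      by (auto simp: preimage_def mem_iso_class[OF n])
    note E = is_pullbackD[OF pb']
    obtain c where c: "c \<in> Arr C" "Cod C c = Dom C n" "Dom C c = Dom C v" "n \<cdot> c = v" using factorsE[OF v(2)] .
    obtain d where d: "d \<in> Arr C" "Cod C d = Dom C v" "Dom C d = Dom C n" "v \<cdot> d = n" using factorsE[OF v(3)] .
    have "f \<cdot> t = n \<cdot> (c \<cdot> u)" using E c D(2) comp_assoc[of u c n] by simp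
    then have "factors C p t" using is_pullback_lift[OF pb, of t "c \<cdot> u"] E c factorsI D by (metis Arr_comp Cod_comp Dom_comp)
    moreover have "f \<cdot> p = v \<cdot> (d \<cdot> q)" using D d E(2) comp_assoc[of q d v] by simp
    then have "factors C t p" using is_pullback_lift[OF pb', of p "d \<cdot> q"] D d factorsI E by (metis Arr_comp Cod_comp Dom_comp)
    ultimately show "t \<in> iso_class C p"
      using mem_iso_class[OF p] pullback_coprojection[OF pb' v(1)] by blast
  next
    fix t assume "t \<in> iso_class C p"
    then obtain h where "t = p \<cdot> h" "is_iso C h" "Cod C h = Dom C p" by (auto simp: iso_class_def)
    then show "t \<in> preimage C f (iso_class C n)"
      using is_pullback_precomp_iso[OF pb, of h] iso_class_self[OF n] by (auto simp: preimage_def)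
  qed
qed

lemma image_iso_class:
  assumes "m \<in> Arr C" "p \<in> Arr C" "Cod C p = Dom C m"
  shows "(\<lambda>i. m \<cdot> i) ` iso_class C p = iso_class C (m \<cdot> p)"
proof -
  have "m \<cdot> (p \<cdot> h) = (m \<cdot> p) \<cdot> h" if "is_iso C h" "Cod C h = Dom C p" for h
    using that assms comp_assoc[of h p m] by (simp add: is_iso_def)
  moreover have "Dom C (m \<cdot> p) = Dom C p" using assms by simp
  ultimately show ?thesis unfolding iso_class_def by force
qed

text \<open>The values of r lie in n exactly on generalised elements that factor through
  \<open>fst r\<close> composed with p, the pullback of n along \<open>snd r\<close>; this composite
  represents the summand of X to be tested.\<close>

lemma large_push_preimage:
  assumes U: "U \<in> ultrafilters C X" and r: "rep C U Y r" and n: "coprojection C n" "Cod C n = Y"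
  shows "large C (push C U r) n \<longleftrightarrow>
    (\<lambda>i. fst r \<cdot> i) ` preimage C (snd r) (iso_class C n) \<in> U"
proof -
  note [simp] = repD[OF r]
  obtain p q where pb: "is_pullback C p q (snd r) n"
    using coprojection_pullback[OF n(1), of "snd r"] n(2) by auto
  note D = is_pullbackD[OF pb]
  have cp: "coprojection C (fst r \<cdot> p)"
    using coprojection_compose[OF _ pullback_coprojection[OF pb n(1)], of "fst r"] D by simp
  have "large C (push C U r) n \<longleftrightarrow> ev C U (\<lambda>t. \<exists>z. app C r t z \<and> factors C n z)"
    using large_push[OF r] n by blast
  also have "\<dots> \<longleftrightarrow> large C U (fst r \<cdot> p)"
  proof
    assume "ev C U (\<lambda>t. \<exists>z. app C r t z \<and> factors C n z)"
    then obtain w z where w: "large C U w" "app C r w z" "factors C n z"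
      by (rule ev_E) blast
    obtain b where b: "b \<in> Arr C" "Cod C b = Dom C (fst r)" "Dom C b = Dom C w" "fst r \<cdot> b = w" "snd r \<cdot> b = z"
      "Dom C z = Dom C w" using appE[OF r w(2)] .
    obtain c where c: "c \<in> Arr C" "Cod C c = Dom C n" "Dom C c = Dom C z" "n \<cdot> c = z"
      using factorsE[OF w(3)] .
    obtain h where h: "h \<in> Arr C" "Cod C h = Dom C p" "p \<cdot> h = b"
      using is_pullback_lift[OF pb, of b c] b c by auto
    have "(fst r \<cdot> p) \<cdot> h = w" using h b D(1-8) by simp
    then have "factors C (fst r \<cdot> p) w" using factorsI[of "fst r \<cdot> p" h] h D(1-8) by simp
    then show "large C U (fst r \<cdot> p)" using large_up[OF U w(1) cp] by blast
  next
    assume "large C U (fst r \<cdot> p)"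
    then show "ev C U (\<lambda>t. \<exists>z. app C r t z \<and> factors C n z)"
    proof (rule ev_I)
      fix s assume s: "s \<in> Arr C" "Cod C s = Dom C (fst r \<cdot> p)"
      then have s': "Cod C s = Dom C p" using D by simp
      have "app C r ((fst r \<cdot> p) \<cdot> s) (snd r \<cdot> (p \<cdot> s))" using appI[of "p \<cdot> s" r] s s' D(1-8) by simp
      moreover have "(snd r \<cdot> p) \<cdot> s = n \<cdot> (q \<cdot> s)" using s s' D by simp
      then have "snd r \<cdot> (p \<cdot> s) = n \<cdot> (q \<cdot> s)" using s s' D(1-8) by simp
      then have "factors C n (snd r \<cdot> (p \<cdot> s))" using factorsI[of n "q \<cdot> s"] s s' D by simp
      ultimately show "\<exists>z. app C r ((fst r \<cdot> p) \<cdot> s) z \<and> factors C n z" by blast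
    qed
  qed
  also have "\<dots> \<longleftrightarrow> (\<lambda>i. fst r \<cdot> i) ` preimage C (snd r) (iso_class C n) \<in> U"
    using cp D image_iso_class[of "fst r" p] unfolding preimage_iso_class[OF n(1) pb] by (simp add: large_def)
  finally show ?thesis .
qed

text \<open>Continuity prescribes for each summand of Y whether it belongs to V, and by
  \<open>large_push_preimage\<close> the prescription is that of \<open>push C U r\<close>. So a
  partial map is continuous for exactly one ultrafilter on its codomain.\<close>

lemma partial_continuous_iff:
  assumes U: "U \<in> ultrafilters C X" and V: "V \<in> ultrafilters C Y"
  shows "r \<in> partial_continuous C (X, U) (Y, V) \<longleftrightarrow> rep C U Y r \<and> V = push C U r"
proof -
  let ?P = "\<lambda>W. (\<lambda>i. fst r \<cdot> i) ` preimage C (snd r) W \<in> U"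
  have "r \<in> partial_continuous C (X, U) (Y, V) \<longleftrightarrow>
      rep C U Y r \<and> (\<forall>W \<in> Summands C Y. W \<in> V \<longleftrightarrow> ?P W)"
    using large_Cod[OF U, of "fst r"]
    by (cases r) (auto simp: partial_continuous_def rep_def large_def)
  also have "\<dots> \<longleftrightarrow> rep C U Y r \<and> (\<forall>n. coprojection C n \<longrightarrow> Cod C n = Y \<longrightarrow> (large C V n \<longleftrightarrow> ?P (iso_class C n)))"
    unfolding Summands_def large_def by blast
  also have "\<dots> \<longleftrightarrow> rep C U Y r \<and> V = push C U r"
  proof (intro conj_cong refl)
    assume r: "rep C U Y r"
    have pU: "push C U r \<in> ultrafilters C Y" by (rule push_in_ultrafilters[OF U r])
    show "(\<forall>n. coprojection C n \<longrightarrow> Cod C n = Y \<longrightarrow> (large C V n \<longleftrightarrow> ?P (iso_class C n))) \<longleftrightarrow> V = push C U r"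
      using large_push_preimage[OF U r] ultrafilter_eqI[OF V pU] large_Cod[OF V] large_coprojection[of V] by blast
  qed
  finally show ?thesis .
qed

text \<open>A total map is the partial map defined on the identity summand, and postcomposing the
  members of a preimage with the identity does not change them.\<close>

lemma push_ultrafilter_eq:
  assumes V: "V \<in> ultrafilters C X" and f: "f \<in> Arr C" "Dom C f = X"
  shows "push_ultrafilter C f V = push C V (Id C X, f)"
proof -
  have r: "rep C V (Cod C f) (Id C X, f)" by (rule rep_Id[OF V f refl])
  have eq: "iso_class C n \<in> push_ultrafilter C f V \<longleftrightarrow> iso_class C n \<in> push C V (Id C X, f)"
    if n: "coprojection C n" "Cod C n = Cod C f" for n
  proof -
    have "Id C X \<cdot> i = i" if i: "i \<in> preimage C f (iso_class C n)" for i
    proof -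
      obtain q v where pb: "is_pullback C i q f v" using i by (auto simp: preimage_def)
      show ?thesis using is_pullbackD(4,7)[OF pb] f(2) by simp
    qed
    then have "(\<lambda>i. Id C X \<cdot> i) ` preimage C f (iso_class C n) = preimage C f (iso_class C n)"
      by simp
    then show ?thesis
      using large_push_preimage[OF V r n] n Summands_iff[OF n(1)]
      by (simp add: push_ultrafilter_def large_def)
  qed
  have "push_ultrafilter C f V \<subseteq> Summands C (Cod C f)" "push C V (Id C X, f) \<subseteq> Summands C (Cod C f)"
    by (auto simp: push_ultrafilter_def push_def Summands_def)
  moreover have "W \<in> push_ultrafilter C f V \<longleftrightarrow> W \<in> push C V (Id C X, f)" if W: "W \<in> Summands C (Cod C f)" for W
    using SummandsE[OF W] eq by metis
  ultimately show ?thesis by blast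
qed

text \<open>The common restriction in \<open>germ_eq\<close> gives r and s the same value at one
  large w; precomposition spreads this to all generalised elements of w.\<close>

lemma germ_eq_iff:
  assumes r: "rep C U Y r" and s: "rep C U Y s"
  shows "germ_eq C U r s \<longleftrightarrow> ev C U (\<lambda>t. \<exists>z. app C r t z \<and> app C s t z)"
proof
  assume "germ_eq C U r s"
  then obtain w a b where w: "large C U w" and ab: "a \<in> Hom C (Dom C w) (Dom C (fst r))"
    "b \<in> Hom C (Dom C w) (Dom C (fst s))" "fst r \<cdot> a = w" "fst s \<cdot> b = w" "snd r \<cdot> a = snd s \<cdot> b"
    by (cases r; cases s) (auto simp: germ_eq_def large_def)
  show "ev C U (\<lambda>t. \<exists>z. app C r t z \<and> app C s t z)"
  proof (rule ev_I[OF w])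
    fix x assume x: "x \<in> Arr C" "Cod C x = Dom C w"
    have "app C r w (snd r \<cdot> a)" "app C s w (snd r \<cdot> a)"
      using ab appI[of a r] appI[of b s] by (simp_all add: Hom_iff)
    then show "\<exists>z. app C r (w \<cdot> x) z \<and> app C s (w \<cdot> x) z"
      using app_comp[OF r _ x] app_comp[OF s _ x] by blast
  qed
next
  assume "ev C U (\<lambda>t. \<exists>z. app C r t z \<and> app C s t z)"
  then obtain w z where w: "large C U w" "app C r w z" "app C s w z"
    by (rule ev_E) blast
  obtain a where a: "a \<in> Arr C" "Cod C a = Dom C (fst r)" "Dom C a = Dom C w" "fst r \<cdot> a = w" "snd r \<cdot> a = z"
    using appE[OF r w(2)] .
  obtain b where b: "b \<in> Arr C" "Cod C b = Dom C (fst s)" "Dom C b = Dom C w" "fst s \<cdot> b = w" "snd s \<cdot> b = z"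
    using appE[OF s w(3)] .
  have "\<exists>a \<in> Hom C (Dom C w) (Dom C (fst r)). \<exists>a' \<in> Hom C (Dom C w) (Dom C (fst s)).
      fst r \<cdot> a = w \<and> fst s \<cdot> a' = w \<and> snd r \<cdot> a = snd s \<cdot> a'"
    using a b by (intro bexI[of _ a] bexI[of _ b]) (simp_all add: Hom_iff)
  then show "germ_eq C U r s"
    using w(1) unfolding germ_eq_def large_def case_prod_beta by blast
qed

end

section \<open>Germs, their composition, and the category of ultrafilters\<close>

definition sim :: "('o, 'a) cat \<Rightarrow> 'a set set \<Rightarrow> 'a \<times> 'a \<Rightarrow> 'a \<times> 'a \<Rightarrow> bool" where
  "sim C U r s \<longleftrightarrow> ev C U (\<lambda>t. \<exists>z. app C r t z \<and> app C s t z)"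

context extensive_category
begin

lemma sim_refl: "rep C U Y r \<Longrightarrow> sim C U r r"
  unfolding sim_def by (rule ev_mono[OF ev_app]) auto

lemma sim_sym: "sim C U r s \<Longrightarrow> sim C U s r"
  unfolding sim_def by (erule ev_mono) blast

lemma sim_trans:
  assumes U: "U \<in> ultrafilters C X" and s: "rep C U Y s" and "sim C U r s" "sim C U s s'"
  shows "sim C U r s'"
  using ev_conj[OF U assms(3,4)[unfolded sim_def]] unfolding sim_def
  by (rule ev_mono) (use app_fun[OF s] in blast)

text \<open>Where r and s have the same values, these values lie in the same summands.\<close>

lemma sim_push:
  assumes U: "U \<in> ultrafilters C X" and r: "rep C U Y r" and s: "rep C U Y s" and rs: "sim C U r s"
  shows "push C U r = push C U s"
proof (rule ultrafilter_eqI[OF push_in_ultrafilters[OF U r] push_in_ultrafilters[OF U s]])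
  fix m assume "large C (push C U r) m"
  then have m: "coprojection C m" "Cod C m = Y" "ev C U (\<lambda>t. \<exists>z. app C r t z \<and> factors C m z)"
    using large_push[OF r] by auto
  have "ev C U (\<lambda>t. \<exists>z. app C s t z \<and> factors C m z)"
    using ev_conj[OF U m(3) rs[unfolded sim_def]]
    by (rule ev_mono) (use app_fun[OF r] in blast)
  then show "large C (push C U s) m" using m large_push[OF s] by blast
qed

lemma germ_at_sel [simp]:
  "src (germ_at C X U r) = (X, U)" "tgt (germ_at C X U r) = (Cod C (snd r), push C U r)"
  by (simp_all add: germ_at_def germ_def)

text \<open>The class also demands continuity into the given target. By \<open>sim_push\<close> this
  is a consequence of \<open>sim\<close>, so agreement near U remains as the criterion.\<close>

lemma germ_at_val:
  assumes U: "U \<in> ultrafilters C X" and r: "rep C U Y r"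
  shows "s \<in> val (germ_at C X U r) \<longleftrightarrow> rep C U Y s \<and> sim C U r s"
proof -
  have "s \<in> val (germ_at C X U r) \<longleftrightarrow> rep C U Y s \<and> push C U r = push C U s \<and> germ_eq C U r s"
    using partial_continuous_iff[OF U push_in_ultrafilters[OF U r]] repD(4)[OF r]
    by (auto simp: germ_at_def germ_def)
  then show ?thesis using germ_eq_iff[OF r] sim_push[OF U r] unfolding sim_def by blast
qed

lemma germ_at_eq_iff:
  assumes U: "U \<in> ultrafilters C X" and r: "rep C U Y r" and s: "rep C U Y' s"
  shows "germ_at C X U r = germ_at C X U s \<longleftrightarrow> Y = Y' \<and> sim C U r s"
proof
  assume eq: "germ_at C X U r = germ_at C X U s"
  have "Y = Y'" using arg_cong[OF eq, of tgt] repD(4)[OF r] repD(4)[OF s] by simp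
  moreover have "s \<in> val (germ_at C X U s)" using germ_at_val[OF U s] s sim_refl[OF s] by blast
  ultimately show "Y = Y' \<and> sim C U r s" using germ_at_val[OF U r] eq by simp
next
  assume rs: "Y = Y' \<and> sim C U r s"
  then have s': "rep C U Y s" using s by simp
  show "germ_at C X U r = germ_at C X U s"
  proof (rule arrow.expand, intro conjI)
    show "src (germ_at C X U r) = src (germ_at C X U s)" by simp
    show "tgt (germ_at C X U r) = tgt (germ_at C X U s)"
      using sim_push[OF U r s'] rs repD(4)[OF r] repD(4)[OF s'] by simp
    show "val (germ_at C X U r) = val (germ_at C X U s)"
      using germ_at_val[OF U r] germ_at_val[OF U s'] rs sim_sym sim_trans[OF U r] sim_trans[OF U s'] by blast
  qed
qed

lemma UF_Obj_iff [simp]: "(X, U) \<in> Obj (UF C) \<longleftrightarrow> U \<in> ultrafilters C X"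
  using ultrafilter_Obj by (auto simp: UF_def Let_def)

lemma UF_sel: "Dom (UF C) = src" "Cod (UF C) = tgt"
  by (simp_all add: UF_def Let_def)

lemma germ_at_Arr:
  assumes U: "U \<in> ultrafilters C X" and r: "rep C U Y r"
  shows "germ_at C X U r \<in> Arr (UF C)"
proof -
  let ?Q = "(Y, push C U r)"
  have pU: "push C U r \<in> ultrafilters C Y" by (rule push_in_ultrafilters[OF U r])
  then have "r \<in> partial_continuous C (X, U) ?Q" using partial_continuous_iff[OF U pU] r by blast
  moreover have "germ_at C X U r = germ C (X, U) ?Q r" using repD(4)[OF r] by (simp add: germ_at_def)
  moreover have "(X, U) \<in> {(X, U). X \<in> Obj C \<and> U \<in> ultrafilters C X}"
    "?Q \<in> {(X, U). X \<in> Obj C \<and> U \<in> ultrafilters C X}"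
    using U pU ultrafilter_Obj[OF U] ultrafilter_Obj[OF pU] by auto
  ultimately show ?thesis unfolding UF_def Let_def cat.simps by blast
qed

text \<open>An arrow carries a continuous representative r, and continuity determines its target as
  \<open>push C U r\<close>; from here on arrows are handled through r.\<close>

lemma UF_ArrE:
  assumes "\<phi> \<in> Arr (UF C)"
  obtains X U Y r where "U \<in> ultrafilters C X" "rep C U Y r" "\<phi> = germ_at C X U r"
proof -
  obtain X U Y V r where *: "U \<in> ultrafilters C X" "V \<in> ultrafilters C Y" "\<phi> = germ C (X, U) (Y, V) r"
    "r \<in> partial_continuous C (X, U) (Y, V)"
    using assms by (auto simp: UF_def Let_def)
  then have "rep C U Y r" "V = push C U r" using partial_continuous_iff by blast+
  then show ?thesis using that[of U X Y r] * repD(4)[of U Y r] by (simp add: germ_at_def)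
qed

lemma UF_HomE:
  assumes "\<phi> \<in> Hom (UF C) (X, U) (Y, V)"
  obtains r where "U \<in> ultrafilters C X" "rep C U Y r" "V = push C U r" "\<phi> = germ_at C X U r"
proof -
  have \<phi>: "\<phi> \<in> Arr (UF C)" "src \<phi> = (X, U)" "tgt \<phi> = (Y, V)" using assms by (auto simp: Hom_iff UF_sel)
  obtain X' U' Y' r where r: "U' \<in> ultrafilters C X'" "rep C U' Y' r" "\<phi> = germ_at C X' U' r"
    using UF_ArrE[OF \<phi>(1)] .
  then show ?thesis using that \<phi>(2,3) repD(4)[OF r(2)] by auto
qed

lemma germ_at_Hom:
  "\<lbrakk>U \<in> ultrafilters C X; rep C U Y r\<rbrakk> \<Longrightarrow> germ_at C X U r \<in> Hom (UF C) (X, U) (Y, push C U r)"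
  using germ_at_Arr repD(4) by (auto simp: Hom_iff UF_sel)

text \<open>A change of variables along r turns a summand that is large for the iterated push into a
  condition near U, where s and r' after r have the same values.\<close>

lemma rcomp_push:
  assumes U: "U \<in> ultrafilters C X" and r: "rep C U Y r" and r': "rep C (push C U r) Z r'"
    and s: "rep C U Z s" and comp: "rcomp C U r r' s"
  shows "push C U s = push C (push C U r) r'"
proof (rule sym, rule ultrafilter_eqI[OF push_in_ultrafilters[OF push_in_ultrafilters[OF U r] r'] push_in_ultrafilters[OF U s]])
  fix m assume "large C (push C (push C U r) r') m"
  then have m: "coprojection C m" "Cod C m = Z"
     "ev C (push C U r) (\<lambda>y. \<exists>z. app C r' y z \<and> factors C m z)"
    using large_push[OF r'] by auto
  have "ev C U (\<lambda>t. \<exists>z. app C s t z \<and> factors C m z)"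
    using ev_conj[OF U ev_push[OF r m(3)] comp[unfolded rcomp_def]]
    by (rule ev_mono) (use app_fun[OF r] app_fun[OF r'] in blast)
  then show "large C (push C U s) m" using m large_push[OF s] by blast
qed

text \<open>The domain of r' is large for \<open>push C U r\<close>, so r takes values in it on some
  large w. There the composite is \<open>snd r'\<close> after the factorisation b.\<close>

lemma rcomp_exists:
  assumes U: "U \<in> ultrafilters C X" and r: "rep C U Y r" and r': "rep C (push C U r) Z r'"
  obtains s where "rep C U Z s" "rcomp C U r r' s"
proof -
  have "ev C U (\<lambda>t. \<exists>y. app C r t y \<and> factors C (fst r') y)"
    using repD(6)[OF r'] large_push[OF r] by blast
  then obtain w y where w: "large C U w" "app C r w y" "factors C (fst r') y"
    by (rule ev_E) blast
  obtain b where b: "b \<in> Arr C" "Cod C b = Dom C (fst r')" "Dom C b = Dom C y" "fst r' \<cdot> b = y"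
    using factorsE[OF w(3)] .
  have y: "y \<in> Arr C" "Dom C y = Dom C w" using app_Arr[OF r w(2)] by auto
  define z where "z = snd r' \<cdot> b"
  have z: "z \<in> Arr C" "Dom C z = Dom C w" "Cod C z = Z"
    using b y repD[OF r'] by (simp_all add: z_def)
  have yz: "app C r' y z" using appI[of b r'] b by (simp add: z_def)
  have s: "rep C U Z (w, z)" using w(1) z by (simp add: rep_def Hom_iff)
  moreover have "rcomp C U r r' (w, z)"
    unfolding rcomp_def
  proof (rule ev_I[OF w(1)])
    fix x assume x: "x \<in> Arr C" "Cod C x = Dom C w"
    show "\<exists>y z'. app C r (w \<cdot> x) y \<and> app C r' y z' \<and> app C (w, z) (w \<cdot> x) z'"
      using app_comp[OF r w(2) x] app_comp[OF r' yz] app_comp[OF s app_self[OF s]] x y by auto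
  qed
  ultimately show ?thesis by (rule that)
qed

text \<open>Composition in \<open>UF C\<close> collects the maps equivalent to some pullback
  composite of some representatives. Two facts suffice: each pullback composite represents the
  composite in the sense of \<open>rcomp\<close>, and representatives of the composite agree near U
  whichever representatives of the factors were used.\<close>

lemma Comp_germ_at:
  assumes U: "U \<in> ultrafilters C X" and r: "rep C U Y r" and r': "rep C (push C U r) Z r'"
    and s: "rep C U Z s" and comp: "rcomp C U r r' s"
  shows "Comp (UF C) (germ_at C Y (push C U r) r') (germ_at C X U r) = germ_at C X U s"
proof -
  let ?V = "push C U r"
  have V: "?V \<in> ultrafilters C Y" by (rule push_in_ultrafilters[OF U r])
  have W: "push C ?V r' \<in> ultrafilters C Z" by (rule push_in_ultrafilters[OF V r'])
  have push: "push C U s = push C ?V r'" by (rule rcomp_push[OF assms])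
  note [simp] = repD(4)[OF r] repD(4)[OF r'] repD(4)[OF s]
  show ?thesis
  proof (rule arrow.expand, intro conjI)
    show "src (Comp (UF C) (germ_at C Y ?V r') (germ_at C X U r)) = src (germ_at C X U s)"
      by (simp add: UF_def Let_def)
    show "tgt (Comp (UF C) (germ_at C Y ?V r') (germ_at C X U r)) = tgt (germ_at C X U s)"
      by (simp add: UF_def Let_def push)
    have eq: "val (Comp (UF C) (germ_at C Y ?V r') (germ_at C X U r)) =
       {s' \<in> partial_continuous C (X, U) (Z, push C ?V r').
         \<exists>(m, f) \<in> val (germ_at C X U r). \<exists>(n, g) \<in> val (germ_at C Y ?V r'). \<exists>i q. is_pullback C i q f n \<and>
              germ_eq C U (m \<cdot> i, g \<cdot> q) s'}"
      by (simp add: UF_def Let_def)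
    have pbc: "rep C U Z (fst r1 \<cdot> i, snd r1' \<cdot> q) \<and> rcomp C U r1 r1' (fst r1 \<cdot> i, snd r1' \<cdot> q)"
      if r1: "rep C U Y r1" "sim C U r r1" and r1': "rep C ?V Z r1'" "sim C ?V r' r1'"
        and pb: "is_pullback C i q (snd r1) (fst r1')" for r1 r1' i q
    proof -
      note D = is_pullbackD[OF pb]
      note R = repD[OF r1(1)] and R' = repD[OF r1'(1)]
      have pU: "push C U r1 = ?V" using sim_push[OF U r r1] by simp
      have cp: "coprojection C (fst r1 \<cdot> i)"
        using coprojection_compose[OF R(5) pullback_coprojection[OF pb R'(5)]] D R by simp
      have app: "app C (fst r1 \<cdot> i, snd r1' \<cdot> q) t z" if tyz: "app C r1 t y" "app C r1' y z" for t y z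
      proof -
        obtain b where b: "b \<in> Arr C" "Cod C b = Dom C (fst r1)" "Dom C b = Dom C t" "fst r1 \<cdot> b = t" "snd r1 \<cdot> b = y"
          using appE[OF r1(1) tyz(1)] .
        obtain c where c: "c \<in> Arr C" "Cod C c = Dom C (fst r1')" "Dom C c = Dom C y" "fst r1' \<cdot> c = y" "snd r1' \<cdot> c = z"
          using appE[OF r1'(1) tyz(2)] .
        obtain h where h: "h \<in> Arr C" "Cod C h = Dom C i" "i \<cdot> h = b" "q \<cdot> h = c"
          using is_pullback_lift[OF pb b(1) c(1)] b c R(3) app_Arr(3)[OF r1(1) tyz(1)] by metis
        have "(fst r1 \<cdot> i) \<cdot> h = t" "(snd r1' \<cdot> q) \<cdot> h = z" using h b c D(1-8) R R' by simp_all
        then show ?thesis using appI[of h "(fst r1 \<cdot> i, snd r1' \<cdot> q)"] h D(1-8) R by simp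
      qed
      \<comment> \<open>Existence of some representative s1 shows that the composite is eventually
        defined. By the pullback property the composite of \<open>fst r1\<close> and i then contains
        a large summand, so it is large.\<close>
      obtain s1 where s1: "rep C U Z s1" "rcomp C U r1 r1' s1"
        using rcomp_exists[OF U r1(1), of Z r1'] r1'(1) pU by auto
      have ev: "ev C U (\<lambda>t. \<exists>y z. app C r1 t y \<and> app C r1' y z \<and> app C (fst r1 \<cdot> i, snd r1' \<cdot> q) t z)"
        using s1(2) unfolding rcomp_def by (rule ev_mono) (use app in blast)
      then obtain w y z where w: "large C U w" "app C (fst r1 \<cdot> i, snd r1' \<cdot> q) w z" by (rule ev_E) blast
      then have "factors C (fst r1 \<cdot> i) w" using coprojection_Arr[OF cp] by (auto simp: app_def factors_def)
      then have "large C U (fst r1 \<cdot> i)" using large_up[OF U w(1) cp] by blast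
      then show ?thesis using ev D R R' by (simp add: rep_def rcomp_def Hom_iff)
    qed
    have simc: "sim C U s s1"
      if r1: "rep C U Y r1" "sim C U r r1" and r1': "rep C ?V Z r1'" "sim C ?V r' r1'"
        and s1: "rep C U Z s1" "rcomp C U r1 r1' s1" for r1 r1' s1
    proof -
      \<comment> \<open>All four agreements hold at a common generalised element near U; chaining
        the single-valued \<open>app\<close> equates the values of s and s1.\<close>
      have "ev C U (\<lambda>t. (\<exists>y. app C r t y \<and> (\<exists>z. app C r' y z \<and> app C r1' y z)) \<and>
          (\<exists>y. app C r t y \<and> app C r1 t y) \<and>
          (\<exists>y z. app C r t y \<and> app C r' y z \<and> app C s t z) \<and>
          (\<exists>y z. app C r1 t y \<and> app C r1' y z \<and> app C s1 t z))"
        using ev_push[OF r r1'(2)[unfolded sim_def]] r1(2) comp s1(2) unfolding sim_def rcomp_def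
        by (intro ev_conj[OF U]) auto
      then show ?thesis unfolding sim_def
        by (rule ev_mono)
          (use app_fun[OF r] app_fun[OF r1(1)] app_fun[OF r'] app_fun[OF r1'(1)] in \<open>metis (no_types, lifting)\<close>)
    qed
    show "val (Comp (UF C) (germ_at C Y ?V r') (germ_at C X U r)) = val (germ_at C X U s)"
    proof (intro set_eqI iffI)
      fix s' assume "s' \<in> val (Comp (UF C) (germ_at C Y ?V r') (germ_at C X U r))"
      then obtain r1 r1' i q where s': "s' \<in> partial_continuous C (X, U) (Z, push C ?V r')"
        and r1: "r1 \<in> val (germ_at C X U r)" and r1': "r1' \<in> val (germ_at C Y ?V r')"
        and pb: "is_pullback C i q (snd r1) (fst r1')"
        and ge: "germ_eq C U (fst r1 \<cdot> i, snd r1' \<cdot> q) s'"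
        unfolding eq by (auto simp: case_prod_beta)
      have R: "rep C U Y r1" "sim C U r r1" "rep C ?V Z r1'" "sim C ?V r' r1'" "rep C U Z s'"
        using r1 r1' s' germ_at_val[OF U r] germ_at_val[OF V r'] partial_continuous_iff[OF U W] by auto
      note P = pbc[OF R(1-4) pb]
      have "sim C U s (fst r1 \<cdot> i, snd r1' \<cdot> q)" using simc[OF R(1-4)] P by blast
      moreover have "sim C U (fst r1 \<cdot> i, snd r1' \<cdot> q) s'"
        using ge germ_eq_iff[OF _ R(5)] P unfolding sim_def by blast
      ultimately have "sim C U s s'" using sim_trans[OF U] P by blast
      then show "s' \<in> val (germ_at C X U s)" using germ_at_val[OF U s] R(5) by blast
    next
      fix s' assume "s' \<in> val (germ_at C X U s)"
      then have s': "rep C U Z s'" "sim C U s s'" using germ_at_val[OF U s] by auto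
      have R: "sim C U r r" "sim C ?V r' r'" by (rule sim_refl[OF r], rule sim_refl[OF r'])
      \<comment> \<open>For this inclusion one pullback composite of r and r' themselves is enough,
        since s and all maps in its germ are equivalent to it.\<close>
      obtain i q where pb: "is_pullback C i q (snd r) (fst r')"
        using coprojection_pullback[OF repD(5)[OF r'], of "snd r"] repD[OF r] repD(6)[OF r'] large_Cod[OF V] by metis
      note P = pbc[OF r R(1) r' R(2) pb]
      have "sim C U (fst r \<cdot> i, snd r' \<cdot> q) s'"
        using simc[OF r R(1) r' R(2)] P s' sim_trans[OF U s] sim_sym by blast
      then have "germ_eq C U (fst r \<cdot> i, snd r' \<cdot> q) s'"
        using germ_eq_iff[OF _ s'(1)] P unfolding sim_def by blast
      moreover have "s' \<in> partial_continuous C (X, U) (Z, push C ?V r')"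
        using partial_continuous_iff[OF U W] s' sim_push[OF U s s'] push by simp
      moreover have "r \<in> val (germ_at C X U r)" "r' \<in> val (germ_at C Y ?V r')"
        using germ_at_val[OF U r] germ_at_val[OF V r'] r r' R by auto
      ultimately show "s' \<in> val (Comp (UF C) (germ_at C Y ?V r') (germ_at C X U r))"
        unfolding eq using pb by (force simp: case_prod_beta)
    qed
  qed
qed

lemma push_Id:
  assumes U: "U \<in> ultrafilters C X"
  shows "push C U (Id C X, Id C X) = U"
proof -
  have X: "X \<in> Obj C" by (rule ultrafilter_Obj[OF U])
  have r: "rep C U X (Id C X, Id C X)" using rep_Id[OF U, of "Id C X" X] X by simp
  show ?thesis
  proof (rule sym, rule ultrafilter_eqI[OF U push_in_ultrafilters[OF U r]])
    fix m assume m: "large C U m"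
    have "ev C U (\<lambda>t. \<exists>z. app C (Id C X, Id C X) t z \<and> factors C m z)"
      using ev_conj[OF U ev_large[OF m] ev_True[OF U]]
      by (rule ev_mono) (use app_Id[of "Id C X"] X in auto)
    then show "large C (push C U (Id C X, Id C X)) m"
      using m large_Cod[OF U m] large_push[OF r] large_coprojection by blast
  qed
qed

lemma Id_germ_at:
  assumes U: "U \<in> ultrafilters C X"
  shows "Id (UF C) (X, U) = germ_at C X U (Id C X, Id C X)"
  using push_Id[OF U] ultrafilter_Obj[OF U] by (simp add: germ_at_def UF_def Let_def)

lemma rcomp_Id_left:
  assumes U: "U \<in> ultrafilters C X" and r: "rep C U Y r"
  shows "rcomp C U (Id C X, Id C X) r r"
proof -
  have X: "X \<in> Obj C" by (rule ultrafilter_Obj[OF U])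
  show ?thesis
    unfolding rcomp_def using ev_conj[OF U ev_app[OF r] ev_True[OF U]]
    by (rule ev_mono) (use app_Id[of "Id C X"] X in auto)
qed

lemma rcomp_Id_right:
  assumes U: "U \<in> ultrafilters C X" and r: "rep C U Y r"
  shows "rcomp C U r (Id C Y, Id C Y) r"
proof -
  have Y: "Y \<in> Obj C" by (rule repD(7)[OF r])
  show ?thesis
    unfolding rcomp_def using ev_app[OF r]
    by (rule ev_mono) (use app_Id[of "Id C Y"] Y app_Arr[OF r] in fastforce)
qed

text \<open>This is associativity at the level of representatives: near U both bracketings have the
  same values. \<open>ev_push\<close> brings the statement about r' and r'' back from the pushed
  ultrafilter to U.\<close>

lemma rcomp_assoc:
  assumes U: "U \<in> ultrafilters C X" and r: "rep C U Y r" and r': "rep C (push C U r) Z r'"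
    and r'': "rep C (push C (push C U r) r') W r''" and s: "rep C U Z s" and s': "rep C (push C U r) W s'"
    and 1: "rcomp C U r r' s" and 2: "rcomp C (push C U r) r' r'' s'" and 3: "rcomp C U s r'' k"
  shows "rcomp C U r s' k"
proof -
  have "ev C U (\<lambda>t. (\<exists>y. app C r t y \<and> (\<exists>z u. app C r' y z \<and> app C r'' z u \<and> app C s' y u)) \<and>
      (\<exists>y z. app C r t y \<and> app C r' y z \<and> app C s t z) \<and>
      (\<exists>z u. app C s t z \<and> app C r'' z u \<and> app C k t u))"
    using ev_push[OF r 2[unfolded rcomp_def]] 1 3 unfolding rcomp_def
    by (intro ev_conj[OF U]) auto
  then show ?thesis unfolding rcomp_def
    by (rule ev_mono)
      (use app_fun[OF r] app_fun[OF s] app_fun[OF r'] app_fun[OF r''] in \<open>metis (no_types, lifting)\<close>)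
qed

text \<open>The laws are checked on representatives supplied by \<open>rcomp_exists\<close>;
  \<open>Comp_germ_at\<close> turns relations between representatives into equations between
  germs.\<close>

lemma category_UF: "category (UF C)"
proof
  fix \<phi> assume "\<phi> \<in> Arr (UF C)"
  then obtain X U Y r where r: "U \<in> ultrafilters C X" "rep C U Y r" "\<phi> = germ_at C X U r" by (rule UF_ArrE)
  show "Dom (UF C) \<phi> \<in> Obj (UF C)" "Cod (UF C) \<phi> \<in> Obj (UF C)"
    using r push_in_ultrafilters[OF r(1,2)] repD(4)[OF r(2)] by (auto simp: UF_sel)
next
  fix P assume "P \<in> Obj (UF C)"
  then obtain X U where P: "P = (X, U)" "U \<in> ultrafilters C X" using UF_Obj_iff by (cases P) auto
  have "rep C U X (Id C X, Id C X)" using rep_Id[OF P(2)] ultrafilter_Obj[OF P(2)] by simp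
  then show "Id (UF C) P \<in> Hom (UF C) P P"
    using germ_at_Hom[OF P(2)] Id_germ_at[OF P(2)] push_Id[OF P(2)] P(1) by metis
next
  fix \<phi> \<psi> P Q R assume \<phi>: "\<phi> \<in> Hom (UF C) P Q" and \<psi>: "\<psi> \<in> Hom (UF C) Q R"
  obtain X U Y V Z W where [simp]: "P = (X, U)" "Q = (Y, V)" "R = (Z, W)" by (cases P; cases Q; cases R)
  obtain r where r: "U \<in> ultrafilters C X" "rep C U Y r" "V = push C U r" "\<phi> = germ_at C X U r"
    by (rule UF_HomE[of \<phi> X U Y V]) (use \<phi> in simp)
  obtain r' where r': "V \<in> ultrafilters C Y" "rep C V Z r'" "W = push C V r'" "\<psi> = germ_at C Y V r'"
    by (rule UF_HomE[of \<psi> Y V Z W]) (use \<psi> in simp)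
  obtain s where s: "rep C U Z s" "rcomp C U r r' s" using rcomp_exists[OF r(1,2), of Z r'] r r' by auto
  have "Comp (UF C) \<psi> \<phi> = germ_at C X U s" using Comp_germ_at[OF r(1,2) _ s] r r' by simp
  moreover have "push C U s = W" using rcomp_push[OF r(1,2) _ s] r r' by simp
  ultimately show "Comp (UF C) \<psi> \<phi> \<in> Hom (UF C) P R" using germ_at_Hom[OF r(1) s(1)] by simp
next
  fix \<phi> P Q assume \<phi>: "\<phi> \<in> Hom (UF C) P Q"
  obtain X U Y V where [simp]: "P = (X, U)" "Q = (Y, V)" by (cases P; cases Q)
  obtain r where r: "U \<in> ultrafilters C X" "rep C U Y r" "V = push C U r" "\<phi> = germ_at C X U r"
    by (rule UF_HomE[of \<phi> X U Y V]) (use \<phi> in simp)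
  have V: "V \<in> ultrafilters C Y" using push_in_ultrafilters[OF r(1,2)] r(3) by simp
  have i: "rep C U X (Id C X, Id C X)" "rep C V Y (Id C Y, Id C Y)"
    using rep_Id[OF r(1)] rep_Id[OF V] ultrafilter_Obj[OF r(1)] ultrafilter_Obj[OF V] by simp_all
  show "Comp (UF C) \<phi> (Id (UF C) P) = \<phi>"
    using Comp_germ_at[OF r(1) i(1) _ r(2) rcomp_Id_left[OF r(1,2)]] push_Id[OF r(1)] r Id_germ_at[OF r(1)] by simp
  show "Comp (UF C) (Id (UF C) Q) \<phi> = \<phi>"
    using Comp_germ_at[OF r(1,2) _ r(2) rcomp_Id_right[OF r(1,2)]] i(2) r Id_germ_at[OF V] by simp
next
  fix \<phi> \<psi> \<chi> P Q R S
  assume \<phi>: "\<phi> \<in> Hom (UF C) P Q" and \<psi>: "\<psi> \<in> Hom (UF C) Q R" and \<chi>: "\<chi> \<in> Hom (UF C) R S"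
  obtain X U Y V Z W T O' where [simp]: "P = (X, U)" "Q = (Y, V)" "R = (Z, W)" "S = (T, O')"
    by (cases P; cases Q; cases R; cases S)
  obtain r where r: "U \<in> ultrafilters C X" "rep C U Y r" "V = push C U r" "\<phi> = germ_at C X U r"
    by (rule UF_HomE[of \<phi> X U Y V]) (use \<phi> in simp)
  obtain r' where r': "V \<in> ultrafilters C Y" "rep C V Z r'" "W = push C V r'" "\<psi> = germ_at C Y V r'"
    by (rule UF_HomE[of \<psi> Y V Z W]) (use \<psi> in simp)
  obtain r'' where r'': "W \<in> ultrafilters C Z" "rep C W T r''" "O' = push C W r''" "\<chi> = germ_at C Z W r''"
    by (rule UF_HomE[of \<chi> Z W T O']) (use \<chi> in simp)
  obtain s where s: "rep C U Z s" "rcomp C U r r' s" using rcomp_exists[OF r(1,2), of Z r'] r r' by auto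
  obtain s' where s': "rep C V T s'" "rcomp C V r' r'' s'" using rcomp_exists[OF r'(1,2), of T r''] r' r'' by auto
  have W: "push C U s = W" using rcomp_push[OF r(1,2) _ s] r r' by simp
  obtain k where k: "rep C U T k" "rcomp C U s r'' k" using rcomp_exists[OF r(1) s(1), of T r''] W r'' by auto
  have k': "rcomp C U r s' k"
    using rcomp_assoc[OF r(1,2) _ _ s(1) _ s(2) _ k(2), of T s'] r r' r'' s' by simp
  have "Comp (UF C) \<psi> \<phi> = germ_at C X U s" using Comp_germ_at[OF r(1,2) _ s] r r' by simp
  moreover have "Comp (UF C) \<chi> \<psi> = germ_at C Y V s'" using Comp_germ_at[OF r'(1,2) _ s'] r' r'' by simp
  moreover have "Comp (UF C) \<chi> (germ_at C X U s) = germ_at C X U k"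
    using Comp_germ_at[OF r(1) s(1) _ k] W r'' by simp
  moreover have "Comp (UF C) (germ_at C Y V s') \<phi> = germ_at C X U k"
    using Comp_germ_at[OF r(1,2) _ k(1) k'] r s' by simp
  ultimately show "Comp (UF C) \<chi> (Comp (UF C) \<psi> \<phi>) = Comp (UF C) (Comp (UF C) \<chi> \<psi>) \<phi>" by simp
qed

end

section \<open>Set-valued functors\<close>

lemma Set_cat_sel [simp]:
  "Obj Set_cat = UNIV" "Dom Set_cat = src" "Cod Set_cat = tgt"
  "Id Set_cat A = Arrow A A (\<lambda>x \<in> A. x)"
  "Comp Set_cat g f = Arrow (src f) (tgt g) (compose (src f) (val g) (val f))"
  by (simp_all add: Set_cat_def)

lemma Set_Arr_iff [simp]: "f \<in> Arr Set_cat \<longleftrightarrow> val f \<in> src f \<rightarrow>\<^sub>E tgt f"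
  by (cases f) (auto simp: Set_cat_def)

lemma Set_Hom_iff: "f \<in> Hom Set_cat A B \<longleftrightarrow> src f = A \<and> tgt f = B \<and> val f \<in> A \<rightarrow>\<^sub>E B"
  by (auto simp: Hom_iff)

lemma category_Set: "category Set_cat"
proof
  fix f g X Y Z assume f: "f \<in> Hom Set_cat X Y" and g: "g \<in> Hom Set_cat Y Z"
  then show "Comp Set_cat g f \<in> Hom Set_cat X Z"
    by (auto simp: Set_Hom_iff compose_def PiE_iff)
next
  fix f X Y assume f: "f \<in> Hom Set_cat X Y"
  then show "Comp Set_cat f (Id Set_cat X) = f"
    by (cases f) (auto simp: Set_Hom_iff compose_def PiE_iff extensional_def fun_eq_iff)
  show "Comp Set_cat (Id Set_cat Y) f = f"
    using f by (cases f) (auto simp: Set_Hom_iff compose_def PiE_iff extensional_def fun_eq_iff)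
next
  fix f g h W X Y Z
  assume "f \<in> Hom Set_cat W X" "g \<in> Hom Set_cat X Y" "h \<in> Hom Set_cat Y Z"
  then show "Comp Set_cat h (Comp Set_cat g f) = Comp Set_cat (Comp Set_cat h g) f"
    by (auto simp: Set_Hom_iff compose_def PiE_iff)
qed (auto simp: Set_Hom_iff)

lemma functor_cat_sel:
  "F \<in> Obj (functor_cat D E) \<longleftrightarrow> is_functor D E F \<and> ob F \<in> extensional (Obj D) \<and> ar F \<in> extensional (Arr D)"
  "Dom (functor_cat D E) = src" "Cod (functor_cat D E) = tgt"
  "Id (functor_cat D E) F = Arrow F F (\<lambda>X \<in> Obj D. Id E (ob F X))"
  "Comp (functor_cat D E) \<beta> \<alpha> = Arrow (src \<alpha>) (tgt \<beta>) (\<lambda>X \<in> Obj D. Comp E (val \<beta> X) (val \<alpha> X))"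
  by (auto simp: functor_cat_def Let_def)

lemma functor_cat_Hom:
  "\<alpha> \<in> Hom (functor_cat D E) F G \<longleftrightarrow> src \<alpha> = F \<and> tgt \<alpha> = G \<and> F \<in> Obj (functor_cat D E) \<and>
    G \<in> Obj (functor_cat D E) \<and> nat_trans D E F G (val \<alpha>) \<and> val \<alpha> \<in> extensional (Obj D)"
  unfolding Hom_iff functor_cat_sel by (cases \<alpha>) (auto simp: functor_cat_def Let_def)

lemma category_functor_cat:
  assumes D: "category D" and E: "category E"
  shows "category (functor_cat D E)"
proof -
  interpret D: category D by fact
  interpret E: category E by fact
  let ?FC = "functor_cat D E"
  have nt: "val \<alpha> X \<in> Arr E" "Dom E (val \<alpha> X) = ob F X" "Cod E (val \<alpha> X) = ob G X"
    if "\<alpha> \<in> Hom ?FC F G" "X \<in> Obj D" for \<alpha> F G X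
    using that unfolding functor_cat_Hom nat_trans_def by (auto simp: Hom_iff)
  have nat: "Comp E (ar G f) (val \<alpha> (Dom D f)) = Comp E (val \<alpha> (Cod D f)) (ar F f)"
    if "\<alpha> \<in> Hom ?FC F G" "f \<in> Arr D" for \<alpha> F G f
    using that by (auto simp: functor_cat_Hom nat_trans_def)
  show ?thesis
  proof
    fix \<alpha> assume "\<alpha> \<in> Arr ?FC"
    then have "\<alpha> \<in> Hom ?FC (src \<alpha>) (tgt \<alpha>)" by (simp add: Hom_iff functor_cat_sel)
    then show "Dom ?FC \<alpha> \<in> Obj ?FC" "Cod ?FC \<alpha> \<in> Obj ?FC"
      by (simp_all add: functor_cat_Hom functor_cat_sel(2,3))
  next
    fix F assume F: "F \<in> Obj ?FC"
    then have "is_functor D E F" by (simp add: functor_cat_sel)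
    note Fs = is_functorD[OF this]
    have "nat_trans D E F F (\<lambda>X \<in> Obj D. Id E (ob F X))"
      using Fs by (auto simp: nat_trans_def Hom_iff)
    then show "Id ?FC F \<in> Hom ?FC F F"
      using F by (simp add: functor_cat_Hom functor_cat_sel(4))
  next
    fix \<alpha> \<beta> F G H assume a: "\<alpha> \<in> Hom ?FC F G" and b: "\<beta> \<in> Hom ?FC G H"
    have F: "is_functor D E F" and G: "is_functor D E G" and H: "is_functor D E H"
      using a b by (auto simp: functor_cat_Hom functor_cat_sel(1))
    note Fs = is_functorD(4-6)[OF F] is_functorD(4-6)[OF G] is_functorD(4-6)[OF H]
    have "nat_trans D E F H (\<lambda>X \<in> Obj D. Comp E (val \<beta> X) (val \<alpha> X))"
      unfolding nat_trans_def
    proof (intro conjI ballI)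
      fix X assume "X \<in> Obj D"
      then show "(\<lambda>X \<in> Obj D. Comp E (val \<beta> X) (val \<alpha> X)) X \<in> Hom E (ob F X) (ob H X)"
        using nt[OF a] nt[OF b] by (simp add: Hom_iff)
    next
      fix f assume f: "f \<in> Arr D"
      note [simp] = nt[OF a D.Obj_Dom[OF f]] nt[OF a D.Obj_Cod[OF f]]
        nt[OF b D.Obj_Dom[OF f]] nt[OF b D.Obj_Cod[OF f]]
      have "Comp E (ar H f) (Comp E (val \<beta> (Dom D f)) (val \<alpha> (Dom D f))) =
          Comp E (Comp E (ar H f) (val \<beta> (Dom D f))) (val \<alpha> (Dom D f))"
        using f by (simp add: Fs)
      also have "\<dots> = Comp E (val \<beta> (Cod D f)) (Comp E (ar G f) (val \<alpha> (Dom D f)))"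
        unfolding nat[OF b f] using f by (simp add: Fs)
      also have "\<dots> = Comp E (Comp E (val \<beta> (Cod D f)) (val \<alpha> (Cod D f))) (ar F f)"
        unfolding nat[OF a f] using f by (simp add: Fs)
      finally show "Comp E (ar H f) ((\<lambda>X \<in> Obj D. Comp E (val \<beta> X) (val \<alpha> X)) (Dom D f)) =
         Comp E ((\<lambda>X \<in> Obj D. Comp E (val \<beta> X) (val \<alpha> X)) (Cod D f)) (ar F f)"
        using f by simp
    qed
    then show "Comp ?FC \<beta> \<alpha> \<in> Hom ?FC F H"
      using a b by (simp add: functor_cat_Hom functor_cat_sel(5))
  next
    fix \<alpha> F G assume a: "\<alpha> \<in> Hom ?FC F G"
    have st: "src \<alpha> = F" "tgt \<alpha> = G" "val \<alpha> \<in> extensional (Obj D)" using a by (auto simp: functor_cat_Hom)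
    \<comment> \<open>Composition restricts to the objects of D, so the identity laws hold as
      equations because transformations are extensional.\<close>
    have v: "(\<lambda>X \<in> Obj D. val \<alpha> X) = val \<alpha>" using st(3) by (rule extensional_restrict)
    have "(\<lambda>X \<in> Obj D. Comp E (val \<alpha> X) ((\<lambda>X \<in> Obj D. Id E (ob F X)) X)) = (\<lambda>X \<in> Obj D. val \<alpha> X)"
      "(\<lambda>X \<in> Obj D. Comp E ((\<lambda>X \<in> Obj D. Id E (ob G X)) X) (val \<alpha> X)) = (\<lambda>X \<in> Obj D. val \<alpha> X)"
      using nt[OF a] by (auto intro!: restrict_ext)
    then show "Comp ?FC \<alpha> (Id ?FC F) = \<alpha>" "Comp ?FC (Id ?FC G) \<alpha> = \<alpha>"
      unfolding functor_cat_sel(4,5) v using st by (cases \<alpha>; simp)+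
  next
    fix \<alpha> \<beta> \<gamma> F G H K
    assume "\<alpha> \<in> Hom ?FC F G" "\<beta> \<in> Hom ?FC G H" "\<gamma> \<in> Hom ?FC H K"
    then show "Comp ?FC \<gamma> (Comp ?FC \<beta> \<alpha>) = Comp ?FC (Comp ?FC \<gamma> \<beta>) \<alpha>"
      unfolding functor_cat_sel(5) using nt by (auto intro!: restrict_ext)
  qed
qed

lemma full_subcat_sel:
  "X \<in> Obj (full_subcat D P) \<longleftrightarrow> X \<in> Obj D \<and> P X"
  "Dom (full_subcat D P) = Dom D" "Cod (full_subcat D P) = Cod D"
  "Id (full_subcat D P) = Id D" "Comp (full_subcat D P) = Comp D"
  by (auto simp: full_subcat_def)

lemma full_subcat_Hom: "f \<in> Hom (full_subcat D P) X Y \<longleftrightarrow> f \<in> Hom D X Y \<and> P X \<and> P Y"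
  by (auto simp: full_subcat_def Hom_iff)

lemma category_full_subcat:
  assumes "category D"
  shows "category (full_subcat D P)"
proof -
  interpret category D by fact
  show ?thesis
  proof
    fix f assume "f \<in> Arr (full_subcat D P)"
    then show "Dom (full_subcat D P) f \<in> Obj (full_subcat D P)" "Cod (full_subcat D P) f \<in> Obj (full_subcat D P)"
      by (auto simp: full_subcat_def)
  qed (auto simp: full_subcat_sel full_subcat_Hom intro: Id_Hom Comp_Hom Comp_Id Id_Comp Comp_assoc)
qed

lemma full_subcat_iso:
  assumes "is_iso D f" "f \<in> Hom D X Y" "P X" "P Y"
  shows "is_iso (full_subcat D P) f"
  using assms by (auto simp: is_iso_def full_subcat_sel full_subcat_Hom) (auto simp: Hom_iff full_subcat_def)

section \<open>Set-valued functors and their transformations through elements\<close>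

abbreviation act :: "('o, 'a, 's) set_fnctr \<Rightarrow> 'a \<Rightarrow> 's \<Rightarrow> 's" where
  "act F f x \<equiv> val (ar F f) x"

lemma set_functorD:
  assumes "is_functor D Set_cat F"
  shows "f \<in> Arr D \<Longrightarrow> ar F f = Arrow (ob F (Dom D f)) (ob F (Cod D f)) (val (ar F f))"
    "f \<in> Arr D \<Longrightarrow> val (ar F f) \<in> extensional (ob F (Dom D f))"
    "\<lbrakk>f \<in> Arr D; x \<in> ob F (Dom D f)\<rbrakk> \<Longrightarrow> act F f x \<in> ob F (Cod D f)"
    "\<lbrakk>X \<in> Obj D; x \<in> ob F X\<rbrakk> \<Longrightarrow> act F (Id D X) x = x"
    "\<lbrakk>f \<in> Arr D; g \<in> Arr D; Dom D g = Cod D f; x \<in> ob F (Dom D f)\<rbrakk> \<Longrightarrow>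
      act F (Comp D g f) x = act F g (act F f x)"
proof -
  note Fs = is_functorD[OF assms]
  have f: "src (ar F f) = ob F (Dom D f) \<and> tgt (ar F f) = ob F (Cod D f) \<and>
    val (ar F f) \<in> ob F (Dom D f) \<rightarrow>\<^sub>E ob F (Cod D f)" if "f \<in> Arr D" for f
    using Fs(4-6)[OF that] by simp
  show "f \<in> Arr D \<Longrightarrow> ar F f = Arrow (ob F (Dom D f)) (ob F (Cod D f)) (val (ar F f))"
    using f[of f] by (metis arrow.collapse)
  show "f \<in> Arr D \<Longrightarrow> val (ar F f) \<in> extensional (ob F (Dom D f))"
    "\<lbrakk>f \<in> Arr D; x \<in> ob F (Dom D f)\<rbrakk> \<Longrightarrow> act F f x \<in> ob F (Cod D f)"
    using f[of f] by (auto simp: PiE_iff)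
  show "\<lbrakk>X \<in> Obj D; x \<in> ob F X\<rbrakk> \<Longrightarrow> act F (Id D X) x = x"
    using Fs(7)[of X] by simp
  show "\<lbrakk>f \<in> Arr D; g \<in> Arr D; Dom D g = Cod D f; x \<in> ob F (Dom D f)\<rbrakk> \<Longrightarrow>
      act F (Comp D g f) x = act F g (act F f x)"
    using Fs(8)[of f g] f[of f] by (simp add: compose_def)
qed

text \<open>The restrictions supply the extensionality that the functor category demands, so that
  for a functor given by plain functions only the pointwise conditions of \<open>mkF_Obj\<close>
  remain.\<close>

definition mkF :: "('o, 'a) cat \<Rightarrow> ('o \<Rightarrow> 's set) \<Rightarrow> ('a \<Rightarrow> 's \<Rightarrow> 's) \<Rightarrow> ('o, 'a, 's) set_fnctr" where
  "mkF D S a = Functor (\<lambda>X \<in> Obj D. S X)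
     (\<lambda>f \<in> Arr D. Arrow (S (Dom D f)) (S (Cod D f)) (\<lambda>x \<in> S (Dom D f). a f x))"

lemma mkF_sel [simp]:
  "X \<in> Obj D \<Longrightarrow> ob (mkF D S a) X = S X"
  "\<lbrakk>f \<in> Arr D; x \<in> S (Dom D f)\<rbrakk> \<Longrightarrow> act (mkF D S a) f x = a f x"
  by (simp_all add: mkF_def)

lemma mkF_Obj:
  assumes D: "category D"
    and map: "\<And>f x. \<lbrakk>f \<in> Arr D; x \<in> S (Dom D f)\<rbrakk> \<Longrightarrow> a f x \<in> S (Cod D f)"
    and Id: "\<And>X x. \<lbrakk>X \<in> Obj D; x \<in> S X\<rbrakk> \<Longrightarrow> a (Id D X) x = x"
    and Comp: "\<And>f g x. \<lbrakk>f \<in> Arr D; g \<in> Arr D; Dom D g = Cod D f; x \<in> S (Dom D f)\<rbrakk> \<Longrightarrow>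
      a (Comp D g f) x = a g (a f x)"
  shows "mkF D S a \<in> Obj (functor_cat D Set_cat)"
proof -
  interpret category D by fact
  have "is_functor D Set_cat (mkF D S a)"
    unfolding is_functor_def
  proof (intro conjI ballI impI D category_Set)
    fix f assume "f \<in> Arr D"
    then show "ar (mkF D S a) f \<in> Hom Set_cat (ob (mkF D S a) (Dom D f)) (ob (mkF D S a) (Cod D f))"
      using map by (auto simp: mkF_def Set_Hom_iff)
  next
    fix X assume "X \<in> Obj D"
    then show "ar (mkF D S a) (Id D X) = Id Set_cat (ob (mkF D S a) X)"
      using Id by (auto simp: mkF_def intro!: restrict_ext)
  next
    fix f g assume "f \<in> Arr D" "g \<in> Arr D" "Dom D g = Cod D f"
    then show "ar (mkF D S a) (Comp D g f) = Comp Set_cat (ar (mkF D S a) g) (ar (mkF D S a) f)"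
      using Comp map by (auto simp: mkF_def compose_def intro!: restrict_ext)
  qed simp
  then show ?thesis by (simp add: functor_cat_sel(1)) (simp add: mkF_def)
qed

definition mkT :: "('o, 'a) cat \<Rightarrow> ('o, 'a, 's) set_fnctr \<Rightarrow> ('o, 'a, 's) set_fnctr \<Rightarrow>
    ('o \<Rightarrow> 's \<Rightarrow> 's) \<Rightarrow> ('o, 'a, 's) set_trans" where
  "mkT D F G t = Arrow F G (\<lambda>X \<in> Obj D. Arrow (ob F X) (ob G X) (\<lambda>x \<in> ob F X. t X x))"

lemma mkT_sel [simp]:
  "src (mkT D F G t) = F" "tgt (mkT D F G t) = G"
  "\<lbrakk>X \<in> Obj D; x \<in> ob F X\<rbrakk> \<Longrightarrow> val (val (mkT D F G t) X) x = t X x"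
  by (simp_all add: mkT_def)

lemma mkT_cong: "(\<And>X x. \<lbrakk>X \<in> Obj D; x \<in> ob F X\<rbrakk> \<Longrightarrow> t X x = u X x) \<Longrightarrow> mkT D F G t = mkT D F G u"
  by (auto simp: mkT_def intro!: restrict_ext)

lemma mkT_Hom:
  assumes F: "F \<in> Obj (functor_cat D Set_cat)" and G: "G \<in> Obj (functor_cat D Set_cat)"
    and map: "\<And>X x. \<lbrakk>X \<in> Obj D; x \<in> ob F X\<rbrakk> \<Longrightarrow> t X x \<in> ob G X"
    and nat: "\<And>f x. \<lbrakk>f \<in> Arr D; x \<in> ob F (Dom D f)\<rbrakk> \<Longrightarrow> act G f (t (Dom D f) x) = t (Cod D f) (act F f x)"
  shows "mkT D F G t \<in> Hom (functor_cat D Set_cat) F G"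
proof -
  have FF: "is_functor D Set_cat F" and GF: "is_functor D Set_cat G" using F G by (auto simp: functor_cat_sel)
  interpret category D by (rule is_functorD[OF FF])
  have "nat_trans D Set_cat F G (\<lambda>X \<in> Obj D. Arrow (ob F X) (ob G X) (\<lambda>x \<in> ob F X. t X x))"
    unfolding nat_trans_def
  proof (intro conjI ballI)
    fix f assume f: "f \<in> Arr D"
    then show "Comp Set_cat (ar G f) ((\<lambda>X \<in> Obj D. Arrow (ob F X) (ob G X) (\<lambda>x \<in> ob F X. t X x)) (Dom D f)) =
      Comp Set_cat ((\<lambda>X \<in> Obj D. Arrow (ob F X) (ob G X) (\<lambda>x \<in> ob F X. t X x)) (Cod D f)) (ar F f)"
      using is_functorD(4-6)[OF FF f] is_functorD(4-6)[OF GF f] nat[OF f] set_functorD(3)[OF FF f]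
      by (auto simp: compose_def intro!: restrict_ext)
  qed (use map in \<open>auto simp: Set_Hom_iff\<close>)
  then show ?thesis using F G by (simp add: functor_cat_Hom) (simp add: mkT_def)
qed

text \<open>A transformation and its components are extensional, so it can be rebuilt from its
  values on elements. Hence arrows of the functor category are all given by \<open>mkT\<close>, and
  equations between them reduce to \<open>mkT_cong\<close>.\<close>

lemma functor_cat_HomD:
  assumes "\<alpha> \<in> Hom (functor_cat D Set_cat) F G"
  shows "\<alpha> = mkT D F G (\<lambda>X. val (val \<alpha> X))"
    "F \<in> Obj (functor_cat D Set_cat)" "G \<in> Obj (functor_cat D Set_cat)"
    "\<lbrakk>X \<in> Obj D; x \<in> ob F X\<rbrakk> \<Longrightarrow> val (val \<alpha> X) x \<in> ob G X"
    "\<lbrakk>f \<in> Arr D; y \<in> ob F (Dom D f)\<rbrakk> \<Longrightarrow>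
      act G f (val (val \<alpha> (Dom D f)) y) = val (val \<alpha> (Cod D f)) (act F f y)"
proof -
  have \<alpha>: "src \<alpha> = F" "tgt \<alpha> = G" "F \<in> Obj (functor_cat D Set_cat)" "G \<in> Obj (functor_cat D Set_cat)"
    "val \<alpha> \<in> extensional (Obj D)" "nat_trans D Set_cat F G (val \<alpha>)"
    using assms by (auto simp: functor_cat_Hom)
  then have FF: "is_functor D Set_cat F" and GF: "is_functor D Set_cat G" by (auto simp: functor_cat_sel)
  have X: "src (val \<alpha> X) = ob F X \<and> tgt (val \<alpha> X) = ob G X \<and> val (val \<alpha> X) \<in> ob F X \<rightarrow>\<^sub>E ob G X"
    if "X \<in> Obj D" for X
    using \<alpha>(6) that by (simp add: nat_trans_def Set_Hom_iff)
  have "val \<alpha> = (\<lambda>X \<in> Obj D. Arrow (ob F X) (ob G X) (\<lambda>x \<in> ob F X. val (val \<alpha> X) x))"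
  proof
    fix Y
    show "val \<alpha> Y = (\<lambda>X \<in> Obj D. Arrow (ob F X) (ob G X) (\<lambda>x \<in> ob F X. val (val \<alpha> X) x)) Y"
    proof (cases "Y \<in> Obj D")
      case True
      have "(\<lambda>x \<in> ob F Y. val (val \<alpha> Y) x) = val (val \<alpha> Y)"
        using X[OF True] by (intro extensional_restrict) (simp add: PiE_iff)
      then have "val \<alpha> Y = Arrow (ob F Y) (ob G Y) (\<lambda>x \<in> ob F Y. val (val \<alpha> Y) x)"
        using X[OF True] by (cases "val \<alpha> Y") simp
      then show ?thesis using True by simp
    qed (use \<alpha>(5) in \<open>simp add: extensional_def\<close>)
  qed
  then have eq: "\<alpha> = mkT D F G (\<lambda>X. val (val \<alpha> X))"
    using \<alpha>(1,2) by (cases \<alpha>) (simp add: mkT_def)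
  have map: "val (val \<alpha> X) x \<in> ob G X" if "X \<in> Obj D" "x \<in> ob F X" for X x
    using X[OF that(1)] that(2) by auto
  have nat: "act G f (val (val \<alpha> (Dom D f)) x) = val (val \<alpha> (Cod D f)) (act F f x)"
    if f: "f \<in> Arr D" "x \<in> ob F (Dom D f)" for f x
  proof -
    interpret category D by (rule is_functorD[OF FF])
    have "Comp Set_cat (ar G f) (val \<alpha> (Dom D f)) = Comp Set_cat (val \<alpha> (Cod D f)) (ar F f)"
      using \<alpha>(6) f(1) unfolding nat_trans_def by blast
    then have "val (Comp Set_cat (ar G f) (val \<alpha> (Dom D f))) x = val (Comp Set_cat (val \<alpha> (Cod D f)) (ar F f)) x"
      by (simp only:)
    then show ?thesis
      using X[OF Obj_Dom[OF f(1)]] is_functorD(5)[OF FF f(1)] f(2) by (simp add: compose_def)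
  qed
  show "\<alpha> = mkT D F G (\<lambda>X. val (val \<alpha> X))" by (rule eq)
  show "F \<in> Obj (functor_cat D Set_cat)" "G \<in> Obj (functor_cat D Set_cat)" by (rule \<alpha>)+
  show "\<lbrakk>X \<in> Obj D; x \<in> ob F X\<rbrakk> \<Longrightarrow> val (val \<alpha> X) x \<in> ob G X" by (rule map)
  show "\<lbrakk>f \<in> Arr D; y \<in> ob F (Dom D f)\<rbrakk> \<Longrightarrow>
      act G f (val (val \<alpha> (Dom D f)) y) = val (val \<alpha> (Cod D f)) (act F f y)" by (rule nat)
qed

lemma mkT_HomD:
  assumes t: "mkT D F G t \<in> Hom (functor_cat D Set_cat) F G"
  shows "F \<in> Obj (functor_cat D Set_cat)" "G \<in> Obj (functor_cat D Set_cat)"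
    "\<lbrakk>X \<in> Obj D; x \<in> ob F X\<rbrakk> \<Longrightarrow> t X x \<in> ob G X"
    "\<lbrakk>f \<in> Arr D; y \<in> ob F (Dom D f)\<rbrakk> \<Longrightarrow> act G f (t (Dom D f) y) = t (Cod D f) (act F f y)"
proof -
  note FG = functor_cat_HomD(2,3)[OF t] and map = functor_cat_HomD(4)[OF t] and nat = functor_cat_HomD(5)[OF t]
  show "F \<in> Obj (functor_cat D Set_cat)" "G \<in> Obj (functor_cat D Set_cat)" by (rule FG)+
  then have FF: "is_functor D Set_cat F" by (simp add: functor_cat_sel)
  interpret category D by (rule is_functorD[OF FF])
  show "\<lbrakk>X \<in> Obj D; x \<in> ob F X\<rbrakk> \<Longrightarrow> t X x \<in> ob G X"
    using map[of X x] by simp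
  show "\<lbrakk>f \<in> Arr D; y \<in> ob F (Dom D f)\<rbrakk> \<Longrightarrow> act G f (t (Dom D f) y) = t (Cod D f) (act F f y)"
    using nat[of f y] set_functorD(3)[OF FF, of f y] by simp
qed

lemma Comp_mkT:
  assumes "\<And>X x. \<lbrakk>X \<in> Obj D; x \<in> ob F X\<rbrakk> \<Longrightarrow> t X x \<in> ob G X"
  shows "Comp (functor_cat D Set_cat) (mkT D G H u) (mkT D F G t) = mkT D F H (\<lambda>X x. u X (t X x))"
  using assms by (auto simp: functor_cat_sel mkT_def compose_def intro!: restrict_ext)

lemma Id_mkT: "Id (functor_cat D Set_cat) F = mkT D F F (\<lambda>X x. x)"
  by (auto simp: functor_cat_sel mkT_def)

text \<open>Pointwise inverses are again natural: naturality of t at the inverse image of y,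
  followed by the inverse over the codomain of f, moves the inverse across the action of f.\<close>

lemma mkT_iso:
  assumes t: "mkT D F G t \<in> Hom (functor_cat D Set_cat) F G"
    and bij: "\<And>X. X \<in> Obj D \<Longrightarrow> bij_betw (t X) (ob F X) (ob G X)"
  shows "is_iso (functor_cat D Set_cat) (mkT D F G t)"
proof -
  have FG: "F \<in> Obj (functor_cat D Set_cat)" "G \<in> Obj (functor_cat D Set_cat)"
    using t by (auto simp: functor_cat_Hom)
  have FF: "is_functor D Set_cat F" and GF: "is_functor D Set_cat G" using FG by (auto simp: functor_cat_sel)
  interpret category D by (rule is_functorD[OF FF])
  define u where "u = (\<lambda>X. inv_into (ob F X) (t X))"
  have map: "t X x \<in> ob G X" if "X \<in> Obj D" "x \<in> ob F X" for X x
    using bij[OF that(1)] that(2) by (auto simp: bij_betw_def)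
  have umap: "u X y \<in> ob F X" "t X (u X y) = y" if "X \<in> Obj D" "y \<in> ob G X" for X y
    using bij[OF that(1)] that(2) by (auto simp: bij_betw_def u_def inv_into_into f_inv_into_f)
  have ut: "u X (t X x) = x" if "X \<in> Obj D" "x \<in> ob F X" for X x
    using bij[OF that(1)] that(2) by (auto simp: bij_betw_def u_def)
  note nat = mkT_HomD(4)[OF t]
  have "mkT D G F u \<in> Hom (functor_cat D Set_cat) G F"
  proof (rule mkT_Hom[OF FG(2,1)])
    fix f y assume f: "f \<in> Arr D" and y: "y \<in> ob G (Dom D f)"
    have "act G f y = t (Cod D f) (act F f (u (Dom D f) y))"
      using nat[OF f, of "u (Dom D f) y"] umap[OF Obj_Dom[OF f] y] by simp
    then show "act F f (u (Dom D f) y) = u (Cod D f) (act G f y)"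
      using ut[OF Obj_Cod[OF f]] set_functorD(3)[OF FF f] umap[OF Obj_Dom[OF f] y] by simp
  qed (use umap in simp)
  moreover have "Comp (functor_cat D Set_cat) (mkT D G F u) (mkT D F G t) = Id (functor_cat D Set_cat) F"
    unfolding Id_mkT by (subst Comp_mkT) (use map ut in \<open>auto intro!: mkT_cong\<close>)
  moreover have "Comp (functor_cat D Set_cat) (mkT D F G t) (mkT D G F u) = Id (functor_cat D Set_cat) G"
    unfolding Id_mkT by (subst Comp_mkT) (use umap in \<open>auto intro!: mkT_cong\<close>)
  ultimately show ?thesis
    using t unfolding is_iso_def functor_cat_sel(2,3) mkT_sel(1,2) by (auto simp: Hom_iff)
qed

lemma mkT_iso_bij:
  assumes iso: "is_iso (functor_cat D Set_cat) (mkT D F G t)" and X: "X \<in> Obj D"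
  shows "bij_betw (t X) (ob F X) (ob G X)"
proof -
  let ?FC = "functor_cat D Set_cat"
  have t: "mkT D F G t \<in> Hom ?FC F G" using iso by (auto simp: is_iso_def Hom_iff functor_cat_sel)
  obtain \<beta> where \<beta>: "\<beta> \<in> Hom ?FC G F" "Comp ?FC \<beta> (mkT D F G t) = Id ?FC F" "Comp ?FC (mkT D F G t) \<beta> = Id ?FC G"
    using iso unfolding is_iso_def functor_cat_sel(2,3) mkT_sel(1,2) by blast
  obtain u where u: "\<beta> = mkT D G F u" "\<And>X x. \<lbrakk>X \<in> Obj D; x \<in> ob G X\<rbrakk> \<Longrightarrow> u X x \<in> ob F X"
    using functor_cat_HomD(1,4)[OF \<beta>(1)] by blast
  note map = mkT_HomD(3)[OF t]
  have "mkT D F F (\<lambda>X x. u X (t X x)) = Comp ?FC \<beta> (mkT D F G t)"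
    unfolding u(1) by (rule Comp_mkT[symmetric]) (use map in blast)
  also have "\<dots> = mkT D F F (\<lambda>X x. x)" unfolding \<beta>(2) Id_mkT ..
  finally have 1: "mkT D F F (\<lambda>X x. u X (t X x)) = mkT D F F (\<lambda>X x. x)" .
  have "u X (t X x) = x" if "x \<in> ob F X" for x
    using arg_cong[OF 1, of "\<lambda>\<gamma>. val (val \<gamma> X) x"] that X by simp
  moreover have "mkT D G G (\<lambda>X x. t X (u X x)) = Comp ?FC (mkT D F G t) \<beta>"
    unfolding u(1) by (rule Comp_mkT[symmetric]) (use u(2) in blast)
  then have 2: "mkT D G G (\<lambda>X x. t X (u X x)) = mkT D G G (\<lambda>X x. x)" unfolding \<beta>(3) Id_mkT .
  have "t X (u X x) = x" if "x \<in> ob G X" for x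
    using arg_cong[OF 2, of "\<lambda>\<gamma>. val (val \<gamma> X) x"] that X by simp
  ultimately show ?thesis using map[OF X] u(2)[OF X]
    by (auto intro!: bij_betw_byWitness[where f' = "u X"])
qed

section \<open>The initial object and coproducts in the category of sets\<close>

lemma Set_initial_iff: "is_initial Set_cat S \<longleftrightarrow> S = {}"
proof
  assume S: "is_initial Set_cat S"
  then obtain f where "f \<in> Hom Set_cat S {}" unfolding is_initial_def Set_cat_sel(1) by blast
  then show "S = {}" by (auto simp: Set_Hom_iff)
next
  assume "S = {}"
  then have "f \<in> Hom Set_cat S X \<longleftrightarrow> f = Arrow {} X (\<lambda>x. undefined)" for f X
    by (cases f) (auto simp: Set_Hom_iff)
  then show "is_initial Set_cat S" by (simp add: is_initial_def)
qed

lemma Set_coproductI: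
  assumes i: "val i \<in> src i \<rightarrow>\<^sub>E X" "tgt i = X" and j: "val j \<in> src j \<rightarrow>\<^sub>E X" "tgt j = X"
    and inj: "inj_on (val i) (src i)" "inj_on (val j) (src j)"
    and disj: "val i ` src i \<inter> val j ` src j = {}" and cover: "X = val i ` src i \<union> val j ` src j"
  shows "is_coproduct Set_cat i j"
proof -
  interpret S: category Set_cat by (rule category_Set)
  show ?thesis
  proof (rule S.is_coproductI)
    fix f g assume fg: "f \<in> Arr Set_cat" "g \<in> Arr Set_cat" "Dom Set_cat f = Dom Set_cat i"
      "Dom Set_cat g = Dom Set_cat j" "Cod Set_cat f = Cod Set_cat g"
    let ?u = "\<lambda>x \<in> X. if x \<in> val i ` src i then val f (inv_into (src i) (val i) x)
      else val g (inv_into (src j) (val j) x)"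
    have ui: "?u (val i a) = val f a" if "a \<in> src i" for a using that i inj by auto
    have uj: "?u (val j b) = val g b" if "b \<in> src j" for b using that j inj disj by auto
    have fm: "val f a \<in> tgt f" if "a \<in> src i" for a using fg that by auto
    have germ_at: "val g b \<in> tgt f" if "b \<in> src j" for b using fg that by auto
    have "?u x \<in> tgt f" if "x \<in> X" for x
      using that fm germ_at ui uj unfolding cover by (metis (no_types, lifting) UnE imageE)
    then have "?u \<in> X \<rightarrow>\<^sub>E tgt f" by auto
    moreover have "compose (src i) ?u (val i) = val f" "compose (src j) ?u (val j) = val g"
      using ui uj fg by (auto simp: compose_def fun_eq_iff PiE_iff extensional_def)
    ultimately show "\<exists>u. u \<in> Arr Set_cat \<and> Dom Set_cat u = Cod Set_cat i \<and> Cod Set_cat u = Cod Set_cat f \<and>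
        Comp Set_cat u i = f \<and> Comp Set_cat u j = g"
      using fg i j by (intro exI[of _ "Arrow X (tgt f) ?u"]) (cases f; cases g; simp)
  next
    fix u v assume uv: "u \<in> Arr Set_cat" "v \<in> Arr Set_cat" "Dom Set_cat u = Cod Set_cat i" "Dom Set_cat v = Cod Set_cat i"
      "Cod Set_cat u = Cod Set_cat v" "Comp Set_cat u i = Comp Set_cat v i" "Comp Set_cat u j = Comp Set_cat v j"
    have "val u (val i a) = val v (val i a)" if "a \<in> src i" for a
      using uv(6) that by (simp add: compose_def fun_eq_iff restrict_def) metis
    moreover have "val u (val j a) = val v (val j a)" if "a \<in> src j" for a
      using uv(7) that by (simp add: compose_def fun_eq_iff restrict_def) metis
    ultimately have "val u x = val v x" if "x \<in> X" for x using that unfolding cover by auto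
    then have "val u = val v" using uv i by (intro extensionalityI[of _ X]) (auto simp: PiE_iff)
    then show "u = v" using uv i by (cases u; cases v) simp
  qed (use i j in simp_all)
qed

text \<open>Arrows into the two-element set of a and b detect everything: the indicator of a point
  gives injectivity, two different constants give disjointness, and two arrows differing at one
  uncovered point give covering. Objects are subsets of the universe, so it has to contain two
  distinct elements.\<close>

lemma Set_coproductD:
  assumes ab: "(a :: 's) \<noteq> b" and cop: "is_coproduct (Set_cat :: ('s set, _) cat) i j"
  shows "inj_on (val i) (src i)" "val i ` src i \<inter> val j ` src j = {}"
    "tgt i = val i ` src i \<union> val j ` src j"
proof -
  interpret S: category "Set_cat :: ('s set, _) cat" by (rule category_Set)
  note D = S.is_coproductD[OF cop]
  have lift: "\<exists>u. (\<forall>x \<in> src i. u (val i x) = f x) \<and> (\<forall>x \<in> src j. u (val j x) = g x)"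
    if fg: "f ` src i \<subseteq> {a, b}" "g ` src j \<subseteq> {a, b}" for f g
  proof -
    let ?f = "Arrow (src i) {a, b} (restrict f (src i))" and ?g = "Arrow (src j) {a, b} (restrict g (src j))"
    have "?f \<in> Arr Set_cat" "?g \<in> Arr Set_cat" "Dom Set_cat ?f = Dom Set_cat i"
      "Dom Set_cat ?g = Dom Set_cat j" "Cod Set_cat ?f = Cod Set_cat ?g" using fg by auto
    then obtain u where u: "Comp Set_cat u i = ?f" "Comp Set_cat u j = ?g"
      using S.is_coproduct_copair[OF cop] by metis
    have "val u (val i x) = f x" if "x \<in> src i" for x
      using arg_cong[OF u(1), of "\<lambda>h. val h x"] that by (simp add: compose_def)
    moreover have "val u (val j x) = g x" if "x \<in> src j" for x
      using arg_cong[OF u(2), of "\<lambda>h. val h x"] that by (simp add: compose_def)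
    ultimately show ?thesis by blast
  qed
  show "inj_on (val i) (src i)"
  proof (rule inj_onI, rule ccontr)
    fix x y assume xy: "x \<in> src i" "y \<in> src i" "val i x = val i y" "x \<noteq> y"
    obtain u where "\<forall>z \<in> src i. u (val i z) = (if z = x then a else b)"
      using lift[of "\<lambda>z. if z = x then a else b" "\<lambda>_. a"] by auto
    then show False using xy ab by metis
  qed
  show "val i ` src i \<inter> val j ` src j = {}"
  proof (rule ccontr)
    assume "val i ` src i \<inter> val j ` src j \<noteq> {}"
    then obtain x y where xy: "x \<in> src i" "y \<in> src j" "val i x = val j y" by blast
    obtain u where "\<forall>z \<in> src i. u (val i z) = a" "\<forall>z \<in> src j. u (val j z) = b"
      using lift[of "\<lambda>_. a" "\<lambda>_. b"] by auto
    then show False using xy ab by metis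
  qed
  show "tgt i = val i ` src i \<union> val j ` src j"
  proof (rule ccontr)
    assume "tgt i \<noteq> val i ` src i \<union> val j ` src j"
    then obtain x where x: "x \<in> tgt i" "x \<notin> val i ` src i" "x \<notin> val j ` src j"
      using D by (auto simp: PiE_iff)
    let ?u = "Arrow (tgt i) {a, b} (\<lambda>y \<in> tgt i. a)"
    let ?v = "Arrow (tgt i) {a, b} (\<lambda>y \<in> tgt i. if y = x then b else a)"
    have "Comp Set_cat ?u i = Comp Set_cat ?v i" "Comp Set_cat ?u j = Comp Set_cat ?v j"
      using x D by (auto simp: compose_def PiE_iff intro!: restrict_ext)
    then have "?u = ?v" using S.is_coproduct_eq[OF cop, of ?u ?v] by auto
    then have "(\<lambda>y \<in> tgt i. a) x = (\<lambda>y \<in> tgt i. if y = x then b else a) x" by (metis arrow.inject)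
    then show False using x(1) ab by simp
  qed
qed

section \<open>From functors on C to functors on UF\<close>

text \<open>Preservation of finite coproducts on elements. Injectivity is written for the first
  coprojection; exchanging the two coprojections gives it for the second.\<close>

definition splits_coproducts :: "('o, 'a) cat \<Rightarrow> ('o, 'a, 's) set_fnctr \<Rightarrow> bool" where
  "splits_coproducts C F \<longleftrightarrow> (\<forall>Z. is_initial C Z \<longrightarrow> ob F Z = {}) \<and>
    (\<forall>i j. is_coproduct C i j \<longrightarrow> inj_on (act F i) (ob F (Dom C i)) \<and>
       act F i ` ob F (Dom C i) \<inter> act F j ` ob F (Dom C j) = {} \<and>
       ob F (Cod C i) = act F i ` ob F (Dom C i) \<union> act F j ` ob F (Dom C j))"

text \<open>The element map inside \<open>tilde_ob\<close>, separated so that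
  \<open>tilde_ob\<close> becomes an instance of \<open>mkF\<close>. The description ranges over all
  representatives of the germ; \<open>tilde_act_eq\<close> shows that they give one value.\<close>

definition tilde_act :: "('o, 'a) cat \<Rightarrow> ('o, 'a, 's) set_fnctr \<Rightarrow>
    (('o, 'a) uf, ('a \<times> 'a) set) arrow \<Rightarrow> 's \<Rightarrow> 's" where
  "tilde_act C A \<phi> x = (THE y. \<exists>(m, f) \<in> val \<phi>. \<exists>x' \<in> ob A (Dom C m). act A m x' = x \<and> y = act A f x')"

text \<open>The injections code the three kinds of sets formed outside the universe: hom-sets of C,
  hom-sets of the category of ultrafilters, and sets of pairs of an ultrafilter and an
  element.\<close>

locale extensive_universe = extensive_category C for C :: "('o, 'a) cat" +
  fixes e_hom :: "'a \<Rightarrow> 's"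
    and e_uf :: "(('o, 'a) uf, ('a \<times> 'a) set) arrow \<Rightarrow> 's"
    and e_pair :: "'a set set \<times> 's \<Rightarrow> 's"
  assumes inj_hom: "\<And>X Y. X \<in> Obj C \<Longrightarrow> Y \<in> Obj C \<Longrightarrow> inj_on e_hom (Hom C X Y)"
    and inj_uf: "\<And>P Q. P \<in> Obj (UF C) \<Longrightarrow> Q \<in> Obj (UF C) \<Longrightarrow> inj_on e_uf (Hom (UF C) P Q)"
    and inj_pair: "\<And>Y. Y \<in> Obj C \<Longrightarrow> inj_on e_pair (ultrafilters C Y \<times> UNIV)"
begin

abbreviation Sets :: "('s set, ('s set, 's \<Rightarrow> 's) arrow) cat" where "Sets \<equiv> Set_cat"
abbreviation CSet :: "(('o, 'a, 's) set_fnctr, ('o, 'a, 's) set_trans) cat" where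
  "CSet \<equiv> functor_cat C Set_cat"
abbreviation UFSet :: "((('o, 'a) uf, (('o, 'a) uf, ('a \<times> 'a) set) arrow, 's) set_fnctr,
    (('o, 'a) uf, (('o, 'a) uf, ('a \<times> 'a) set) arrow, 's) set_trans) cat" where
  "UFSet \<equiv> functor_cat (UF C) Set_cat"
abbreviation FCSet :: "(('o, 'a, 's) set_fnctr, ('o, 'a, 's) set_trans) cat" where
  "FCSet \<equiv> FC C"

lemma category_CSet: "category CSet"
  by (rule category_functor_cat[OF category_axioms category_Set])

lemma category_UFSet: "category UFSet"
  by (rule category_functor_cat[OF category_UF category_Set])

lemma category_FCSet: "category FCSet"
  unfolding FC_def by (rule category_full_subcat[OF category_CSet])

text \<open>
  If \<open>'s\<close> has at most one element, then the two coprojections \<open>X \<rightarrow> X + X\<close> coincide for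
  every \<open>X\<close>, so that all objects are initial; otherwise coproduct cocones in sets are recognised by
  maps into a two-element set.
\<close>

lemma preserves_finite_coproducts_iff:
  fixes F :: "('o, 'a, 's) set_fnctr"
  assumes F: "F \<in> Obj CSet"
  shows "preserves_finite_coproducts C Sets F \<longleftrightarrow> splits_coproducts C F"
proof
  have FF: "is_functor C Sets F" using F by (simp add: functor_cat_sel)
  note Fs = is_functorD(4-6)[OF FF]
  assume p: "preserves_finite_coproducts C Sets F"
  have init: "ob F Z = {}" if "is_initial C Z" for Z
    using p that by (simp add: preserves_finite_coproducts_def Set_initial_iff)
  show "splits_coproducts C F"
    unfolding splits_coproducts_def
  proof (intro conjI allI impI)
    show "ob F Z = {}" if "is_initial C Z" for Z by (rule init[OF that])
    fix i j assume ij: "is_coproduct C i j"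
    note D = is_coproductD[OF ij]
    have cop: "is_coproduct Sets (ar F i) (ar F j)" using p ij by (simp add: preserves_finite_coproducts_def)
    have "inj_on (act F i) (ob F (Dom C i)) \<and>
       act F i ` ob F (Dom C i) \<inter> act F j ` ob F (Dom C j) = {} \<and>
       ob F (Cod C i) = act F i ` ob F (Dom C i) \<union> act F j ` ob F (Dom C j)"
    proof (cases "\<exists>a b :: 's. a \<noteq> b")
      case True
      then obtain a b :: 's where "a \<noteq> b" by blast
      then show ?thesis using Set_coproductD[OF _ cop] Fs D by simp
    next
      case False
      have "is_initial C X" if X: "X \<in> Obj C" for X
      proof -
        note k = coproj[OF X X] and ks = coproj_simps[OF X X]
        have "e_hom (inl X X) = e_hom (inr X X)" using False by blast
        then have "inl X X = inr X X"
          using inj_hom[OF X, of "coprod C X X"] ks X by (auto simp: inj_on_def Hom_iff)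
        then show ?thesis using coproduct_disjoint[OF k(1), of "Id C X" "Id C X"] ks X by simp
      qed
      then have "ob F X = {}" if "X \<in> Obj C" for X using init that by blast
      then show ?thesis using D by simp
    qed
    then show "inj_on (act F i) (ob F (Dom C i))"
      "act F i ` ob F (Dom C i) \<inter> act F j ` ob F (Dom C j) = {}"
      "ob F (Cod C i) = act F i ` ob F (Dom C i) \<union> act F j ` ob F (Dom C j)" by blast+
  qed
next
  have FF: "is_functor C Sets F" using F by (simp add: functor_cat_sel)
  note Fs = is_functorD(4-6)[OF FF]
  assume g: "splits_coproducts C F"
  show "preserves_finite_coproducts C Sets F"
    unfolding preserves_finite_coproducts_def
  proof (intro conjI allI impI)
    show "is_initial Sets (ob F Z)" if "is_initial C Z" for Z
      using g that by (simp add: splits_coproducts_def Set_initial_iff)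
    fix i j assume ij: "is_coproduct C i j"
    note D = is_coproductD[OF ij]
    have gi: "inj_on (act F i) (ob F (Dom C i))" "inj_on (act F j) (ob F (Dom C j))"
       "act F i ` ob F (Dom C i) \<inter> act F j ` ob F (Dom C j) = {}"
       "ob F (Cod C i) = act F i ` ob F (Dom C i) \<union> act F j ` ob F (Dom C j)"
      using g ij is_coproduct_sym[OF ij] unfolding splits_coproducts_def by blast+
    show "is_coproduct Sets (ar F i) (ar F j)"
      by (rule Set_coproductI[where X = "ob F (Cod C i)"])
        (use gi Fs[OF D(1)] Fs[OF D(2)] D(3) in simp_all)
  qed
qed

lemma FC_Obj_iff: "A \<in> Obj FCSet \<longleftrightarrow> A \<in> Obj CSet \<and> splits_coproducts C A"
  unfolding FC_def full_subcat_sel using preserves_finite_coproducts_iff by blast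

lemma FC_Hom: "\<alpha> \<in> Hom FCSet A B \<longleftrightarrow> A \<in> Obj FCSet \<and> B \<in> Obj FCSet \<and> \<alpha> \<in> Hom CSet A B"
  unfolding FC_def full_subcat_sel full_subcat_Hom using functor_cat_Hom[of \<alpha> C Set_cat A B] by blast

lemma FC_sel: "Dom FCSet = src" "Cod FCSet = tgt" "Id FCSet = Id CSet" "Comp FCSet = Comp CSet"
  by (simp_all add: FC_def full_subcat_sel functor_cat_sel)

lemma FC_iso: "\<lbrakk>is_iso CSet \<alpha>; \<alpha> \<in> Hom FCSet A B\<rbrakk> \<Longrightarrow> is_iso FCSet \<alpha>"
  using full_subcat_iso[of CSet \<alpha> A B] unfolding FC_def full_subcat_Hom by blast

lemma FC_D:
  assumes A: "A \<in> Obj FCSet"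
  shows "is_functor C Sets A"
    "coprojection C m \<Longrightarrow> inj_on (act A m) (ob A (Dom C m))"
    "is_initial C Z \<Longrightarrow> ob A Z = {}"
    "is_coproduct C i j \<Longrightarrow> x \<in> ob A (Cod C i) \<Longrightarrow>
       x \<in> act A i ` ob A (Dom C i) \<longleftrightarrow> x \<notin> act A j ` ob A (Dom C j)"
  using A unfolding FC_Obj_iff splits_coproducts_def functor_cat_sel(1) coprojection_def by blast+

text \<open>A member of U is a whole isomorphism class, and each of its elements represents it, so
  the union in \<open>tilde_set\<close> ranges exactly over the representatives.\<close>

lemma Union_ultrafilter_iff:
  assumes U: "U \<in> ultrafilters C X"
  shows "m \<in> \<Union> U \<longleftrightarrow> large C U m"
proof
  assume "m \<in> \<Union> U"
  then obtain V where V: "V \<in> U" "m \<in> V" by blast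
  then have "V \<in> Summands C X" using ultrafilter_filter(1)[OF U] by (auto simp: filter_iff)
  then obtain n where n: "coprojection C n" "V = iso_class C n" by (rule SummandsE)
  then have "coprojection C m \<and> factors C n m \<and> factors C m n" using V(2) mem_iso_class by blast
  moreover from this have "iso_class C m = iso_class C n" using n(1) iso_class_eq_iff by blast
  ultimately show "large C U m" using n V(1) by (simp add: large_def)
next
  assume "large C U m"
  then show "m \<in> \<Union> U" using iso_class_self[of m] by (auto simp: large_def)
qed

section \<open>The functor \<open>tilde_ob C A\<close> and its dependence on A\<close>

lemma tilde_set_iff:
  assumes "U \<in> ultrafilters C X"
  shows "x \<in> tilde_set C A (X, U) \<longleftrightarrow>
    x \<in> ob A X \<and> (\<forall>m. large C U m \<longrightarrow> (\<exists>y \<in> ob A (Dom C m). act A m y = x))"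
proof -
  have "x \<in> tilde_set C A (X, U) \<longleftrightarrow> x \<in> ob A X \<and> (\<forall>m \<in> \<Union> U. x \<in> act A m ` ob A (Dom C m))"
    by (simp add: tilde_set_def)
  also have "\<dots> \<longleftrightarrow> x \<in> ob A X \<and> (\<forall>m. large C U m \<longrightarrow> x \<in> act A m ` ob A (Dom C m))"
    using Union_ultrafilter_iff[OF assms] by blast
  also have "\<dots> \<longleftrightarrow> x \<in> ob A X \<and> (\<forall>m. large C U m \<longrightarrow> (\<exists>y \<in> ob A (Dom C m). act A m y = x))"
    by blast
  finally show ?thesis .
qed

text \<open>The factorisation b behind \<open>app\<close> carries x' to a second lift of the same
  element along the coprojection \<open>fst r\<close>, and A sends coprojections to
  injections.\<close>

lemma act_app:
  assumes A: "A \<in> Obj FCSet" and r: "rep C U Y r" and tz: "app C r t z"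
    and x: "x \<in> ob A (Dom C (fst r))" and x': "x' \<in> ob A (Dom C t)"
    and eq: "act A (fst r) x = act A t x'"
  shows "act A (snd r) x = act A z x'"
proof -
  note [simp] = repD[OF r]
  note AF = set_functorD[OF FC_D(1)[OF A]]
  obtain b where b: "b \<in> Arr C" "Cod C b = Dom C (fst r)" "Dom C b = Dom C t" "fst r \<cdot> b = t" "snd r \<cdot> b = z"
    using appE[OF r tz] .
  have bx: "act A b x' \<in> ob A (Dom C (fst r))" using AF(3)[of b x'] b x' by simp
  have "act A (fst r) (act A b x') = act A (fst r) x"
    using AF(5)[of b "fst r" x'] b x' eq by simp
  then have "act A b x' = x"
    using FC_D(2)[OF A, of "fst r"] bx x by (auto simp: inj_on_def)
  then show ?thesis using AF(5)[of b "snd r" x'] b x' by simp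
qed

text \<open>Values may be computed at any generalised element t on which r is defined and to which x
  lifts. This freedom lets a single lift serve for several germs at once.\<close>

lemma tilde_act_eq:
  assumes A: "A \<in> Obj FCSet" and U: "U \<in> ultrafilters C X" and r: "rep C U Y r"
    and x: "x \<in> tilde_set C A (X, U)" and tz: "app C r t z"
    and x': "x' \<in> ob A (Dom C t)" "act A t x' = x"
  shows "tilde_act C A (germ_at C X U r) x = act A z x'"
  unfolding tilde_act_def
proof (rule the_equality)
  obtain x1 where x1: "x1 \<in> ob A (Dom C (fst r))" "act A (fst r) x1 = x"
    using x repD(6)[OF r] tilde_set_iff[OF U] by metis
  have eq1: "act A (snd r) x1 = act A z x'" using act_app[OF A r tz x1(1) x'(1)] x1(2) x'(2) by simp
  have "r \<in> val (germ_at C X U r)" using germ_at_val[OF U r] r sim_refl[OF r] by blast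
  then show "\<exists>(m, f) \<in> val (germ_at C X U r). \<exists>x'' \<in> ob A (Dom C m). act A m x'' = x \<and> act A z x' = act A f x''"
    using x1 eq1 by (intro bexI[of _ r]) (auto simp: case_prod_beta)
  fix y assume "\<exists>(m, f) \<in> val (germ_at C X U r). \<exists>x'' \<in> ob A (Dom C m). act A m x'' = x \<and> y = act A f x''"
  then obtain r1 x2 where r1: "r1 \<in> val (germ_at C X U r)" and x2: "x2 \<in> ob A (Dom C (fst r1))"
     "act A (fst r1) x2 = x" "y = act A (snd r1) x2"
    unfolding case_prod_beta by blast
  have r1': "rep C U Y r1" "sim C U r r1" using r1 germ_at_val[OF U r] by auto
  \<comment> \<open>Another representative r1 agrees with r on some large w, to which x lifts as
    well; both values are then computed from that lift.\<close>
  obtain w z' where w: "large C U w" "app C r w z'" "app C r1 w z'"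
    using r1'(2) unfolding sim_def by (rule ev_E) blast
  obtain xw where xw: "xw \<in> ob A (Dom C w)" "act A w xw = x" using x w(1) tilde_set_iff[OF U] by metis
  have "y = act A z' xw" using act_app[OF A r1'(1) w(3) x2(1) xw(1)] x2 xw by simp
  also have "\<dots> = act A (snd r) x1" using act_app[OF A r w(2) x1(1) xw(1)] x1 xw by simp
  finally show "y = act A z x'" using eq1 by simp
qed

text \<open>A summand n in the pushed ultrafilter contains the value of r on some large w. A lift of
  x to w, carried along the factorisation of this value through n, is the required preimage.\<close>

lemma tilde_act_in:
  assumes A: "A \<in> Obj FCSet" and U: "U \<in> ultrafilters C X" and r: "rep C U Y r"
    and x: "x \<in> tilde_set C A (X, U)"
  shows "tilde_act C A (germ_at C X U r) x \<in> tilde_set C A (Y, push C U r)"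
proof -
  note AF = set_functorD[OF FC_D(1)[OF A]]
  have V: "push C U r \<in> ultrafilters C Y" by (rule push_in_ultrafilters[OF U r])
  have *: "\<exists>x' \<in> ob A (Dom C w). act A z x' \<in> ob A Y \<and> tilde_act C A (germ_at C X U r) x = act A z x'"
    if w: "large C U w" "app C r w z" for w z
  proof -
    obtain x' where x': "x' \<in> ob A (Dom C w)" "act A w x' = x" using x w(1) tilde_set_iff[OF U] by metis
    have "act A z x' \<in> ob A Y" using AF(3)[of z x'] app_Arr[OF r w(2)] x' by simp
    then show ?thesis using tilde_act_eq[OF A U r x w(2) x'] x' by auto
  qed
  show ?thesis
    unfolding tilde_set_iff[OF V]
  proof (intro conjI allI impI)
    show "tilde_act C A (germ_at C X U r) x \<in> ob A Y" using *[OF repD(6)[OF r] app_self[OF r]] by auto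
    fix n assume n: "large C (push C U r) n"
    then have "ev C U (\<lambda>t. \<exists>z. app C r t z \<and> factors C n z)" using large_push[OF r] by blast
    then obtain w z where w: "large C U w" "app C r w z" "factors C n z" by (rule ev_E) blast
    obtain x' where x': "x' \<in> ob A (Dom C w)" "tilde_act C A (germ_at C X U r) x = act A z x'"
      using *[OF w(1,2)] by auto
    obtain b where b: "n \<in> Arr C" "b \<in> Arr C" "Cod C b = Dom C n" "Dom C b = Dom C z" "n \<cdot> b = z"
      using factorsE[OF w(3)] .
    have bz: "Dom C b = Dom C w" using b app_Arr[OF r w(2)] by simp
    then have "act A b x' \<in> ob A (Dom C n)" "act A n (act A b x') = act A z x'"
      using AF(3)[of b x'] AF(5)[of b n x'] b x' by simp_all
    then show "\<exists>y \<in> ob A (Dom C n). act A n y = tilde_act C A (germ_at C X U r) x" using x' by auto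
  qed
qed

text \<open>On a common large w the values of s and of r' after r agree, and one lift x' of x to w
  computes all three actions.\<close>

lemma tilde_act_comp:
  assumes A: "A \<in> Obj FCSet" and U: "U \<in> ultrafilters C X" and r: "rep C U Y r"
    and r': "rep C (push C U r) Z r'" and s: "rep C U Z s" and comp: "rcomp C U r r' s"
    and x: "x \<in> tilde_set C A (X, U)"
  shows "tilde_act C A (germ_at C X U s) x =
    tilde_act C A (germ_at C Y (push C U r) r') (tilde_act C A (germ_at C X U r) x)"
proof -
  note AF = set_functorD[OF FC_D(1)[OF A]]
  have V: "push C U r \<in> ultrafilters C Y" by (rule push_in_ultrafilters[OF U r])
  obtain w y z where w: "large C U w" "app C r w y" "app C r' y z" "app C s w z"
    using comp unfolding rcomp_def by (rule ev_E) blast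
  obtain x' where x': "x' \<in> ob A (Dom C w)" "act A w x' = x" using x w(1) tilde_set_iff[OF U] by metis
  have "tilde_act C A (germ_at C X U s) x = act A z x'" by (rule tilde_act_eq[OF A U s x w(4) x'])
  moreover have e: "tilde_act C A (germ_at C X U r) x = act A y x'" by (rule tilde_act_eq[OF A U r x w(2) x'])
  moreover have "tilde_act C A (germ_at C Y (push C U r) r') (act A y x') = act A z x'"
    by (rule tilde_act_eq[OF A V r' _ w(3)])
      (use tilde_act_in[OF A U r x] e x' app_Arr[OF r w(2)] in simp_all)
  ultimately show ?thesis by simp
qed

lemma tilde_ob_mkF: "tilde_ob C A = mkF (UF C) (tilde_set C A) (tilde_act C A)"
  unfolding tilde_ob_def mkF_def tilde_act_def UF_sel ..

lemma tilde_ob_Obj: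
  assumes A: "A \<in> Obj FCSet"
  shows "tilde_ob C A \<in> Obj UFSet"
  unfolding tilde_ob_mkF
proof (rule mkF_Obj[OF category_UF])
  fix \<phi> x assume "\<phi> \<in> Arr (UF C)" and x: "x \<in> tilde_set C A (Dom (UF C) \<phi>)"
  then obtain X U Y r where r: "U \<in> ultrafilters C X" "rep C U Y r" "\<phi> = germ_at C X U r" by (auto elim: UF_ArrE)
  then show "tilde_act C A \<phi> x \<in> tilde_set C A (Cod (UF C) \<phi>)"
    using tilde_act_in[OF A r(1,2), of x] x repD(4)[OF r(2)] by (simp add: UF_sel)
next
  fix P x assume P: "P \<in> Obj (UF C)" and x: "x \<in> tilde_set C A P"
  obtain X U where [simp]: "P = (X, U)" by (cases P)
  have U: "U \<in> ultrafilters C X" using P by simp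
  have X: "X \<in> Obj C" by (rule ultrafilter_Obj[OF U])
  have xX: "x \<in> ob A X" using x tilde_set_iff[OF U, of x A] by (metis \<open>P = (X, U)\<close>)
  have i: "rep C U X (Id C X, Id C X)" using rep_Id[OF U] X by simp
  show "tilde_act C A (Id (UF C) P) x = x"
    using tilde_act_eq[OF A U i _ app_self[OF i], of x x] x xX X set_functorD(4)[OF FC_D(1)[OF A] X xX]
      Id_germ_at[OF U] by simp
next
  fix \<phi> \<psi> x assume \<phi>: "\<phi> \<in> Arr (UF C)" and \<psi>: "\<psi> \<in> Arr (UF C)" and eq: "Dom (UF C) \<psi> = Cod (UF C) \<phi>"
    and x: "x \<in> tilde_set C A (Dom (UF C) \<phi>)"
  obtain X U Y r where r: "U \<in> ultrafilters C X" "rep C U Y r" "\<phi> = germ_at C X U r" using UF_ArrE[OF \<phi>] .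
  obtain Y' V Z r' where "V \<in> ultrafilters C Y'" "rep C V Z r'" "\<psi> = germ_at C Y' V r'" using UF_ArrE[OF \<psi>] .
  then have r': "rep C (push C U r) Z r'" "\<psi> = germ_at C Y (push C U r) r'"
    using eq r repD(4)[OF r(2)] by (simp_all add: UF_sel)
  obtain s where s: "rep C U Z s" "rcomp C U r r' s" using rcomp_exists[OF r(1,2) r'(1)] .
  show "tilde_act C A (Comp (UF C) \<psi> \<phi>) x = tilde_act C A \<psi> (tilde_act C A \<phi> x)"
    using tilde_act_comp[OF A r(1,2) r'(1) s] Comp_germ_at[OF r(1,2) r'(1) s] x r(3) r'(2) by (simp add: UF_sel)
qed

lemma tilde_ob_sel:
  "P \<in> Obj (UF C) \<Longrightarrow> ob (tilde_ob C A) P = tilde_set C A P"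
  "\<lbrakk>\<phi> \<in> Arr (UF C); x \<in> tilde_set C A (src \<phi>)\<rbrakk> \<Longrightarrow> act (tilde_ob C A) \<phi> x = tilde_act C A \<phi> x"
  by (simp_all add: tilde_ob_mkF UF_sel)

text \<open>Naturality of t at a coprojection m carries a lift of x along m in A to a lift of
  \<open>t X x\<close> along m in B, so t restricts to the sets \<open>tilde_set\<close>. Naturality
  at \<open>snd r\<close> gives compatibility with germs.\<close>

lemma tilde_trans:
  assumes A: "A \<in> Obj FCSet" and B: "B \<in> Obj FCSet" and t: "mkT C A B t \<in> Hom CSet A B"
  shows "ar (tilde C) (mkT C A B t) = mkT (UF C) (tilde_ob C A) (tilde_ob C B) (\<lambda>P. t (fst P))"
    "mkT (UF C) (tilde_ob C A) (tilde_ob C B) (\<lambda>P. t (fst P)) \<in> Hom UFSet (tilde_ob C A) (tilde_ob C B)"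
proof -
  note AF = set_functorD[OF FC_D(1)[OF A]]
  note T = mkT_HomD[OF t]
  have sub: "fst P \<in> Obj C" "tilde_set C A P \<subseteq> ob A (fst P)" if "P \<in> Obj (UF C)" for P
    using that ultrafilter_Obj by (cases P; auto simp: tilde_set_def)+
  have vv: "val (val (mkT C A B t) (fst P)) x = t (fst P) x" if "P \<in> Obj (UF C)" "x \<in> tilde_set C A P" for P x
    using sub[OF that(1)] that(2) by (intro mkT_sel(3)) auto
  show "ar (tilde C) (mkT C A B t) = mkT (UF C) (tilde_ob C A) (tilde_ob C B) (\<lambda>P. t (fst P))"
    unfolding tilde_def mkT_def[of "UF C"] fnctr.sel mkT_sel
    by (simp add: tilde_ob_sel(1) vv cong: restrict_cong)
  have tm: "act B w (t (Dom C w) y) = t X x"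
    if "w \<in> Arr C" "y \<in> ob A (Dom C w)" "act A w y = x" "Cod C w = X" for w y x X
    using T(4)[of w y] that by simp
  have in_tilde: "t X x \<in> tilde_set C B (X, U)" if U: "U \<in> ultrafilters C X" and x: "x \<in> tilde_set C A (X, U)" for X U x
    unfolding tilde_set_iff[OF U]
  proof (intro conjI allI impI)
    have "x \<in> ob A X" using x unfolding tilde_set_iff[OF U] by blast
    then show "t X x \<in> ob B X" by (rule T(3)[OF ultrafilter_Obj[OF U]])
    fix m assume m: "large C U m"
    have mA: "m \<in> Arr C" by (rule large_Arr[OF m])
    obtain y where y: "y \<in> ob A (Dom C m)" "act A m y = x" using x m tilde_set_iff[OF U] by metis
    show "\<exists>y \<in> ob B (Dom C m). act B m y = t X x"
      using tm[OF mA y large_Cod[OF U m]] T(3)[OF _ y(1)] mA by auto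
  qed
  show "mkT (UF C) (tilde_ob C A) (tilde_ob C B) (\<lambda>P. t (fst P)) \<in> Hom UFSet (tilde_ob C A) (tilde_ob C B)"
  proof (rule mkT_Hom[OF tilde_ob_Obj[OF A] tilde_ob_Obj[OF B]])
    fix P x assume P: "P \<in> Obj (UF C)" and x: "x \<in> ob (tilde_ob C A) P"
    then show "t (fst P) x \<in> ob (tilde_ob C B) P"
      using in_tilde by (cases P) (simp add: tilde_ob_sel)
  next
    fix \<phi> x assume \<phi>: "\<phi> \<in> Arr (UF C)" and x': "x \<in> ob (tilde_ob C A) (Dom (UF C) \<phi>)"
    obtain X U Y r where U: "U \<in> ultrafilters C X" and r: "rep C U Y r" and \<phi>r: "\<phi> = germ_at C X U r"
      using UF_ArrE[OF \<phi>] .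
    have x: "x \<in> tilde_set C A (X, U)" using x' U by (simp add: \<phi>r UF_sel tilde_ob_sel)
    have m: "large C U (fst r)" "fst r \<in> Arr C" "Cod C (fst r) = X" using repD[OF r] large_Cod[OF U] by auto
    obtain y where y: "y \<in> ob A (Dom C (fst r))" "act A (fst r) y = x" using x m(1) tilde_set_iff[OF U] by metis
    have ty: "t (Dom C (fst r)) y \<in> ob B (Dom C (fst r))" using T(3)[OF _ y(1)] m by simp
    have "tilde_act C B \<phi> (t X x) = act B (snd r) (t (Dom C (fst r)) y)"
      unfolding \<phi>r
      by (rule tilde_act_eq[OF B U r in_tilde[OF U x] app_self[OF r] ty tm[OF m(2) y m(3)]])
    also have "\<dots> = t Y (act A (snd r) y)" using T(4)[of "snd r" y] y repD[OF r] by simp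
    also have "act A (snd r) y = tilde_act C A \<phi> x"
      unfolding \<phi>r by (rule tilde_act_eq[OF A U r x app_self[OF r] y, symmetric])
    finally show "act (tilde_ob C B) \<phi> (t (fst (Dom (UF C) \<phi>)) x) = t (fst (Cod (UF C) \<phi>)) (act (tilde_ob C A) \<phi> x)"
      using \<phi> \<phi>r x in_tilde[OF U x] repD(4)[OF r] by (simp add: UF_sel tilde_ob_sel(2))
  qed
qed

lemma tilde_functor: "is_functor FCSet UFSet (tilde C)"
  unfolding is_functor_def
proof (intro conjI ballI impI category_FCSet category_UFSet)
  fix A :: "('o, 'a, 's) set_fnctr" assume A: "A \<in> Obj FCSet"
  show "ob (tilde C) A \<in> Obj UFSet" using tilde_ob_Obj[OF A] by (simp add: tilde_def)
  have i: "mkT C A A (\<lambda>X x. x) \<in> Hom CSet A A"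
    using category.Id_Hom[OF category_FCSet A] unfolding FC_Hom FC_sel Id_mkT by simp
  show "ar (tilde C) (Id FCSet A) = Id UFSet (ob (tilde C) A)"
    unfolding FC_sel Id_mkT tilde_trans(1)[OF A A i] by (simp add: tilde_def)
next
  fix \<alpha> :: "('o, 'a, 's) set_trans" assume "\<alpha> \<in> Arr FCSet"
  then have \<alpha>: "\<alpha> \<in> Hom FCSet (src \<alpha>) (tgt \<alpha>)" by (simp add: Hom_iff FC_sel)
  then have h: "src \<alpha> \<in> Obj FCSet" "tgt \<alpha> \<in> Obj FCSet" "\<alpha> \<in> Hom CSet (src \<alpha>) (tgt \<alpha>)"
    by (simp_all add: FC_Hom)
  note eq = functor_cat_HomD(1)[OF h(3)]
  have "mkT C (src \<alpha>) (tgt \<alpha>) (\<lambda>X. val (val \<alpha> X)) \<in> Hom CSet (src \<alpha>) (tgt \<alpha>)" using h(3) eq by simp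
  note tt = tilde_trans[OF h(1,2) this]
  show "ar (tilde C) \<alpha> \<in> Hom UFSet (ob (tilde C) (Dom FCSet \<alpha>)) (ob (tilde C) (Cod FCSet \<alpha>))"
    using tt unfolding eq[symmetric] FC_sel by (simp add: tilde_def)
next
  fix \<alpha> \<beta> :: "('o, 'a, 's) set_trans"
  assume a: "\<alpha> \<in> Arr FCSet" and b: "\<beta> \<in> Arr FCSet" and ab: "Dom FCSet \<beta> = Cod FCSet \<alpha>"
  define A B D where "A = src \<alpha>" and "B = tgt \<alpha>" and "D = tgt \<beta>"
  have h: "\<alpha> \<in> Hom FCSet A B" "\<beta> \<in> Hom FCSet B D"
    using a b ab by (simp_all add: Hom_iff FC_sel A_def B_def D_def)
  have O: "A \<in> Obj FCSet" "B \<in> Obj FCSet" "D \<in> Obj FCSet" "\<alpha> \<in> Hom CSet A B" "\<beta> \<in> Hom CSet B D"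
    using h by (simp_all add: FC_Hom)
  obtain t u where eq: "\<alpha> = mkT C A B t" "\<beta> = mkT C B D u"
    using functor_cat_HomD(1)[OF O(4)] functor_cat_HomD(1)[OF O(5)] by blast
  note t = O(4)[unfolded eq] and u = O(5)[unfolded eq]
  have ut: "Comp CSet \<beta> \<alpha> = mkT C A D (\<lambda>X x. u X (t X x))"
    unfolding eq by (rule Comp_mkT) (rule mkT_HomD(3)[OF t])
  have uth: "mkT C A D (\<lambda>X x. u X (t X x)) \<in> Hom CSet A D"
    using category.Comp_Hom[OF category_CSet O(4,5)] ut by simp
  show "ar (tilde C) (Comp FCSet \<beta> \<alpha>) = Comp UFSet (ar (tilde C) \<beta>) (ar (tilde C) \<alpha>)"
    unfolding FC_sel ut tilde_trans(1)[OF O(1,3) uth]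
    unfolding eq tilde_trans(1)[OF O(1,2) t] tilde_trans(1)[OF O(2,3) u]
    by (rule Comp_mkT[symmetric]) (rule mkT_HomD(3)[OF tilde_trans(2)[OF O(1,2) t]])
qed

end

section \<open>From functors on UF to functors on C\<close>

text \<open>The element map inside \<open>int_ob\<close>, in the form that \<open>mkF\<close>
  expects. Codes are decoded by \<open>inv_into\<close>, which \<open>inv_pairs\<close>
  evaluates.\<close>

definition int_act :: "('a set set \<times> 's \<Rightarrow> 's) \<Rightarrow> ('o, 'a) cat \<Rightarrow>
    (('o, 'a) uf, (('o, 'a) uf, ('a \<times> 'a) set) arrow, 's) set_fnctr \<Rightarrow> 'a \<Rightarrow> 's \<Rightarrow> 's" where
  "int_act e C B f s = (let (V, b) = inv_into (int_pairs C B (Dom C f)) e s;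
                W = push_ultrafilter C f V;
                \<phi> = germ C (Dom C f, V) (Cod C f, W) (Id C (Dom C f), f)
            in e (W, val (ar B \<phi>) b))"

definition int_snd :: "('a set set \<times> 's \<Rightarrow> 's) \<Rightarrow> ('o, 'a) cat \<Rightarrow>
    (('o, 'a) uf, (('o, 'a) uf, ('a \<times> 'a) set) arrow, 's) set_fnctr \<Rightarrow> 'o \<Rightarrow> 's \<Rightarrow> 's" where
  "int_snd e C B Y s = snd (inv_into (int_pairs C B Y) e s)"

definition int_trans :: "('a set set \<times> 's \<Rightarrow> 's) \<Rightarrow> ('o, 'a) cat \<Rightarrow>
    (('o, 'a) uf, (('o, 'a) uf, ('a \<times> 'a) set) arrow, 's) set_fnctr \<Rightarrow>
    (('o, 'a) uf \<Rightarrow> 's \<Rightarrow> 's) \<Rightarrow> 'o \<Rightarrow> 's \<Rightarrow> 's" where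
  "int_trans e C B t Y s = (let (V, b) = inv_into (int_pairs C B Y) e s in e (V, t (Y, V) b))"

context extensive_universe
begin

abbreviation tot :: "'a \<Rightarrow> 'a \<times> 'a" where "tot f \<equiv> (Id C (Dom C f), f)"

lemma rep_tot: "\<lbrakk>U \<in> ultrafilters C (Dom C f); f \<in> Arr C\<rbrakk> \<Longrightarrow> rep C U (Cod C f) (tot f)"
  by (rule rep_Id) simp_all

lemma app_tot: "f \<in> Arr C \<Longrightarrow> app C (tot f) t z \<longleftrightarrow> t \<in> Arr C \<and> Cod C t = Dom C f \<and> z = f \<cdot> t"
  by (rule app_Id)

lemma rcomp_tot:
  assumes U: "U \<in> ultrafilters C (Dom C f)" and f: "f \<in> Arr C" and g: "g \<in> Arr C" "Dom C g = Cod C f"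
  shows "rcomp C U (tot f) (tot g) (tot (g \<cdot> f))"
  unfolding rcomp_def using ev_True[OF U]
proof (rule ev_mono)
  fix t assume "t \<in> Arr C \<and> Cod C t = Dom C f"
  then show "\<exists>y z. app C (tot f) t y \<and> app C (tot g) y z \<and> app C (tot (g \<cdot> f)) t z"
    using app_tot[OF f, of t "f \<cdot> t"] app_tot[OF g(1), of "f \<cdot> t" "g \<cdot> f \<cdot> t"]
      app_tot[of "g \<cdot> f" t "g \<cdot> f \<cdot> t"] f g by (intro exI[of _ "f \<cdot> t"] exI[of _ "g \<cdot> f \<cdot> t"]) simp
qed

lemma rep_restrict: "large C U m \<Longrightarrow> rep C U (Dom C m) (m, Id C (Dom C m))"
  using large_Arr[of U m] by (simp add: rep_def Hom_iff)

text \<open>Every germ is a germ of a total map after the restriction to its domain of definition.\<close>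

lemma rcomp_restrict:
  assumes r: "rep C U Y r"
  shows "rcomp C U (fst r, Id C (Dom C (fst r))) (tot (snd r)) r"
  unfolding rcomp_def using ev_app[OF r]
proof (rule ev_mono)
  note [simp] = repD[OF r]
  fix t assume "\<exists>z. app C r t z"
  then obtain z where z: "app C r t z" by blast
  obtain b where b: "b \<in> Arr C" "Cod C b = Dom C (fst r)" "Dom C b = Dom C t" "fst r \<cdot> b = t" "snd r \<cdot> b = z"
    using appE[OF r z] .
  have "app C (fst r, Id C (Dom C (fst r))) t b"
    using appI[of b "(fst r, Id C (Dom C (fst r)))"] b by simp
  moreover have "app C (tot (snd r)) b z" using app_tot[of "snd r" b z] b by simp
  ultimately show "\<exists>y z. app C (fst r, Id C (Dom C (fst r))) t y \<and> app C (tot (snd r)) y z \<and> app C r t z"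
    using z by blast
qed

text \<open>All values of m, taken as a total map, factor through m.\<close>

lemma large_push_coprojection:
  assumes V: "V \<in> ultrafilters C (Dom C m)" and m: "coprojection C m"
  shows "large C (push C V (tot m)) m"
proof -
  have mA: "m \<in> Arr C" by (rule coprojection_Arr[OF m])
  have "ev C V (\<lambda>t. \<exists>z. app C (tot m) t z \<and> factors C m z)"
    using ev_True[OF V] by (rule ev_mono) (use app_tot[OF mA] factorsI[OF mA] in blast)
  then show ?thesis using large_push[OF rep_tot[OF V mA]] m by blast
qed

text \<open>Half of the fact that the inclusion of a member of an ultrafilter is invertible in the
  category of ultrafilters: restriction undoes inclusion. \<open>restrict_include\<close> supplies
  the other half on elements.\<close>

lemma rcomp_include_restrict:
  assumes V: "V \<in> ultrafilters C (Dom C m)" and m: "coprojection C m"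
  shows "rcomp C V (tot m) (m, Id C (Dom C m)) (Id C (Dom C m), Id C (Dom C m))"
  unfolding rcomp_def using ev_True[OF V]
proof (rule ev_mono)
  have mA: "m \<in> Arr C" by (rule coprojection_Arr[OF m])
  fix t assume t: "t \<in> Arr C \<and> Cod C t = Dom C m"
  then show "\<exists>y z. app C (tot m) t y \<and> app C (m, Id C (Dom C m)) y z \<and>
      app C (Id C (Dom C m), Id C (Dom C m)) t z"
    using app_tot[OF mA, of t "m \<cdot> t"] appI[of t "(m, Id C (Dom C m))"] app_tot[of "Id C (Dom C m)" t t] mA
    by auto
qed

section \<open>The functor \<open>int_ob e_pair C B\<close> for a fixed B\<close>

context
  fixes B :: "(('o, 'a) uf, (('o, 'a) uf, ('a \<times> 'a) set) arrow, 's) set_fnctr"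
  assumes B: "B \<in> Obj UFSet"
begin

lemma UFSet_functor: "is_functor (UF C) Set_cat B"
  using B by (simp add: functor_cat_sel)

lemma act_germ_at_in:
  assumes U: "U \<in> ultrafilters C X" and r: "rep C U Y r" and b: "b \<in> ob B (X, U)"
  shows "act B (germ_at C X U r) b \<in> ob B (Y, push C U r)"
  using set_functorD(3)[OF UFSet_functor germ_at_Arr[OF U r]] b repD(4)[OF r] by (simp add: UF_sel)

lemma act_germ_at_comp:
  assumes U: "U \<in> ultrafilters C X" and r: "rep C U Y r" and r': "rep C (push C U r) Z r'"
    and s: "rep C U Z s" and comp: "rcomp C U r r' s" and b: "b \<in> ob B (X, U)"
  shows "act B (germ_at C X U s) b = act B (germ_at C Y (push C U r) r') (act B (germ_at C X U r) b)"
  using set_functorD(5)[OF UFSet_functor germ_at_Arr[OF U r] germ_at_Arr[OF push_in_ultrafilters[OF U r] r'], of b]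
    Comp_germ_at[OF U r r' s comp] b repD(4)[OF r] by (simp add: UF_sel)

lemma act_germ_at_Id:
  assumes U: "U \<in> ultrafilters C X" and b: "b \<in> ob B (X, U)"
  shows "act B (germ_at C X U (Id C X, Id C X)) b = b"
  using set_functorD(4)[OF UFSet_functor, of "(X, U)" b] U b Id_germ_at[OF U] by simp

lemma inv_pairs:
  assumes "V \<in> ultrafilters C Y" "b \<in> ob B (Y, V)"
  shows "inv_into (int_pairs C B Y) e_pair (e_pair (V, b)) = (V, b)"
proof (rule inv_into_f_f)
  show "inj_on e_pair (int_pairs C B Y)"
    using inj_pair[OF ultrafilter_Obj[OF assms(1)]] by (rule inj_on_subset) (auto simp: int_pairs_def)
qed (use assms in \<open>auto simp: int_pairs_def\<close>)

lemma int_ob_mkF: "int_ob e_pair C B = mkF C (\<lambda>Y. e_pair ` int_pairs C B Y) (int_act e_pair C B)"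
  unfolding int_ob_def mkF_def int_act_def ..

lemma int_obI: "\<lbrakk>V \<in> ultrafilters C Y; b \<in> ob B (Y, V)\<rbrakk> \<Longrightarrow> e_pair (V, b) \<in> ob (int_ob e_pair C B) Y"
  using ultrafilter_Obj by (auto simp: int_ob_mkF int_pairs_def)

lemma int_obE:
  assumes "s \<in> ob (int_ob e_pair C B) Y" "Y \<in> Obj C"
  obtains V b where "V \<in> ultrafilters C Y" "b \<in> ob B (Y, V)" "s = e_pair (V, b)"
  using assms by (auto simp: int_ob_mkF int_pairs_def)

lemma int_act_pair:
  assumes f: "f \<in> Arr C" and V: "V \<in> ultrafilters C (Dom C f)" and b: "b \<in> ob B (Dom C f, V)"
  shows "int_act e_pair C B f (e_pair (V, b)) = e_pair (push C V (tot f), act B (germ_at C (Dom C f) V (tot f)) b)"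
  using inv_pairs[OF V b] push_ultrafilter_eq[OF V f refl] by (simp add: int_act_def germ_at_def Let_def)

lemma int_ob_act:
  assumes f: "f \<in> Arr C" and V: "V \<in> ultrafilters C (Dom C f)" and b: "b \<in> ob B (Dom C f, V)"
  shows "act (int_ob e_pair C B) f (e_pair (V, b)) =
    e_pair (push C V (tot f), act B (germ_at C (Dom C f) V (tot f)) b)"
  using int_act_pair[OF assms] V b unfolding int_ob_mkF by (subst mkF_sel) (auto simp: f int_pairs_def)

lemma int_ob_CSet: "int_ob e_pair C B \<in> Obj CSet"
  unfolding int_ob_mkF
proof (rule mkF_Obj[OF category_axioms])
  fix f s assume f: "f \<in> Arr C" and s: "s \<in> e_pair ` int_pairs C B (Dom C f)"
  then obtain V b where V: "V \<in> ultrafilters C (Dom C f)" "b \<in> ob B (Dom C f, V)" "s = e_pair (V, b)"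
    by (auto simp: int_pairs_def)
  show "int_act e_pair C B f s \<in> e_pair ` int_pairs C B (Cod C f)"
    unfolding V(3) int_act_pair[OF f V(1,2)]
    using push_in_ultrafilters[OF V(1) rep_tot[OF V(1) f]] act_germ_at_in[OF V(1) rep_tot[OF V(1) f] V(2)]
    by (auto simp: int_pairs_def)
next
  fix X s assume X: "X \<in> Obj C" and s: "s \<in> e_pair ` int_pairs C B X"
  then obtain V b where V: "V \<in> ultrafilters C X" "b \<in> ob B (X, V)" "s = e_pair (V, b)"
    by (auto simp: int_pairs_def)
  show "int_act e_pair C B (Id C X) s = s"
    using int_act_pair[of "Id C X" V b] V X push_Id[OF V(1)] act_germ_at_Id[OF V(1,2)] by simp
next
  fix f g s assume f: "f \<in> Arr C" and g: "g \<in> Arr C" "Dom C g = Cod C f"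
    and s: "s \<in> e_pair ` int_pairs C B (Dom C f)"
  obtain V b where V: "V \<in> ultrafilters C (Dom C f)" "b \<in> ob B (Dom C f, V)" "s = e_pair (V, b)"
    using s by (auto simp: int_pairs_def)
  let ?W = "push C V (tot f)"
  note rf = rep_tot[OF V(1) f]
  have W: "?W \<in> ultrafilters C (Dom C g)" using push_in_ultrafilters[OF V(1) rf] g by simp
  have rg: "rep C ?W (Cod C g) (tot g)" by (rule rep_tot[OF W g(1)])
  have rgf: "rep C V (Cod C g) (tot (g \<cdot> f))" using rep_tot[of V "g \<cdot> f"] V(1) f g by simp
  note comp = rcomp_tot[OF V(1) f g]
  have b: "act B (germ_at C (Dom C f) V (tot f)) b \<in> ob B (Dom C g, ?W)" using act_germ_at_in[OF V(1) rf V(2)] g by simp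
  show "int_act e_pair C B (g \<cdot> f) s = int_act e_pair C B g (int_act e_pair C B f s)"
    unfolding V(3) int_act_pair[OF f V(1,2)] int_act_pair[OF g(1) W b]
    using int_act_pair[of "g \<cdot> f" V b] f g V rcomp_push[OF V(1) rf rg rgf comp]
      act_germ_at_comp[OF V(1) rf rg rgf comp V(2)] by simp
qed

text \<open>The restriction germ to m is a retraction of the inclusion germ, so both the ultrafilter
  V and the element b are recovered from their images. This yields injectivity of the action of
  m.\<close>

lemma int_ob_coprojection_inj:
  assumes m: "coprojection C m" and V: "V \<in> ultrafilters C (Dom C m)" "b \<in> ob B (Dom C m, V)"
  shows "V = push C (push C V (tot m)) (m, Id C (Dom C m))"
    "b = act B (germ_at C (Cod C m) (push C V (tot m)) (m, Id C (Dom C m))) (act B (germ_at C (Dom C m) V (tot m)) b)"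
proof -
  have mA: "m \<in> Arr C" by (rule coprojection_Arr[OF m])
  note rm = rep_tot[OF V(1) mA] and rr = rep_restrict[OF large_push_coprojection[OF V(1) m]]
  have ri: "rep C V (Dom C m) (Id C (Dom C m), Id C (Dom C m))" using rep_Id[OF V(1)] mA by simp
  note c = rcomp_include_restrict[OF V(1) m]
  show "V = push C (push C V (tot m)) (m, Id C (Dom C m))"
    using rcomp_push[OF V(1) rm rr ri c] push_Id[OF V(1)] by simp
  show "b = act B (germ_at C (Cod C m) (push C V (tot m)) (m, Id C (Dom C m))) (act B (germ_at C (Dom C m) V (tot m)) b)"
    using act_germ_at_comp[OF V(1) rm rr ri c V(2)] act_germ_at_Id[OF V] by simp
qed

text \<open>Restricting to m and including again is the partial map \<open>(m, m)\<close>, which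
  agrees with the identity near U. Hence the restriction of b is a preimage of the pair of U and b
  under m.\<close>

lemma restrict_include:
  assumes U: "U \<in> ultrafilters C X" and m: "large C U m" and b: "b \<in> ob B (X, U)"
  defines "V \<equiv> push C U (m, Id C (Dom C m))"
    and "b' \<equiv> act B (germ_at C X U (m, Id C (Dom C m))) b"
  shows "V \<in> ultrafilters C (Dom C m)" "b' \<in> ob B (Dom C m, V)"
    "act (int_ob e_pair C B) m (e_pair (V, b')) = e_pair (U, b)"
proof -
  have mA: "m \<in> Arr C" by (rule large_Arr[OF m])
  have mX: "Cod C m = X" by (rule large_Cod[OF U m])
  note rr = rep_restrict[OF m]
  show V: "V \<in> ultrafilters C (Dom C m)" unfolding V_def by (rule push_in_ultrafilters[OF U rr])
  show b': "b' \<in> ob B (Dom C m, V)" unfolding V_def b'_def by (rule act_germ_at_in[OF U rr b])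
  have rm: "rep C V X (tot m)" using rep_tot[OF V mA] mX by simp
  have mm: "rep C U X (m, m)" using m mA mX by (simp add: rep_def Hom_iff)
  have ri: "rep C U X (Id C X, Id C X)" using rep_Id[OF U] ultrafilter_Obj[OF U] by simp
  have c: "rcomp C U (m, Id C (Dom C m)) (tot m) (m, m)" using rcomp_restrict[OF mm] by simp
  have "sim C U (m, m) (Id C X, Id C X)"
    unfolding sim_def using ev_app[OF mm]
  proof (rule ev_mono)
    fix t assume t: "\<exists>z. app C (m, m) t z" "t \<in> Arr C"
    then have "app C (m, m) t t \<and> Cod C t = X" using mA mX by (auto simp: app_def)
    then show "\<exists>z. app C (m, m) t z \<and> app C (Id C X, Id C X) t z"
      using app_tot[of "Id C X" t t] ultrafilter_Obj[OF U] t(2) by auto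
  qed
  then have "germ_at C X U (m, m) = germ_at C X U (Id C X, Id C X)" "push C U (m, m) = push C U (Id C X, Id C X)"
    using germ_at_eq_iff[OF U mm ri] sim_push[OF U mm ri] by auto
  then have "push C V (tot m) = U" "act B (germ_at C (Dom C m) V (tot m)) b' = b"
    using rcomp_push[OF U rr rm[unfolded V_def] mm c] act_germ_at_comp[OF U rr rm[unfolded V_def] mm c b]
      push_Id[OF U] act_germ_at_Id[OF U b] unfolding V_def b'_def by simp_all
  then show "act (int_ob e_pair C B) m (e_pair (V, b')) = e_pair (U, b)"
    using int_ob_act[OF mA V b'] by simp
qed

lemma pair_eq_iff:
  assumes "V \<in> ultrafilters C Y" "W \<in> ultrafilters C Y"
  shows "e_pair (V, b) = e_pair (W, c) \<longleftrightarrow> V = W \<and> b = c"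
  using inj_on_eq_iff[OF inj_pair[OF ultrafilter_Obj[OF assms(1)]], of "(V, b)" "(W, c)"] assms by simp

text \<open>An image under m lies over an ultrafilter pushed along m, in which m is large;
  conversely, a large m allows b to be restricted to it.\<close>

lemma int_ob_image_iff:
  assumes U: "U \<in> ultrafilters C X" and m: "coprojection C m" "Cod C m = X" and b: "b \<in> ob B (X, U)"
  shows "e_pair (U, b) \<in> act (int_ob e_pair C B) m ` ob (int_ob e_pair C B) (Dom C m) \<longleftrightarrow> large C U m"
proof
  have mA: "m \<in> Arr C" by (rule coprojection_Arr[OF m(1)])
  assume "e_pair (U, b) \<in> act (int_ob e_pair C B) m ` ob (int_ob e_pair C B) (Dom C m)"
  then obtain s where s: "s \<in> ob (int_ob e_pair C B) (Dom C m)" "e_pair (U, b) = act (int_ob e_pair C B) m s"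
    by blast
  obtain V c where V: "V \<in> ultrafilters C (Dom C m)" "c \<in> ob B (Dom C m, V)" "s = e_pair (V, c)"
    using int_obE[OF s(1)] mA by auto
  have "U = push C V (tot m)"
    using s(2) int_ob_act[OF mA V(1,2)] V(3) push_in_ultrafilters[OF V(1) rep_tot[OF V(1) mA]] U m(2)
    by (simp add: pair_eq_iff)
  then show "large C U m" using large_push_coprojection[OF V(1) m(1)] by simp
next
  assume "large C U m"
  note r = restrict_include[OF U this b]
  show "e_pair (U, b) \<in> act (int_ob e_pair C B) m ` ob (int_ob e_pair C B) (Dom C m)"
    unfolding r(3)[symmetric] by (rule imageI[OF int_obI[OF r(1,2)]])
qed

lemma int_ob_FC: "int_ob e_pair C B \<in> Obj FCSet"
  unfolding FC_Obj_iff splits_coproducts_def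
proof (intro conjI allI impI int_ob_CSet)
  let ?I = "int_ob e_pair C B"
  fix Z assume Z: "is_initial C Z"
  then have ZO: "Z \<in> Obj C" by (simp add: is_initial_def)
  \<comment> \<open>The identity of Z would be a large summand with initial domain.\<close>
  have "V \<notin> ultrafilters C Z" for V
    using large_Id[of V Z] large_not_initial[of V Z "Id C Z"] Z ZO by auto
  then show "ob ?I Z = {}" using int_obE[OF _ ZO] by blast
next
  let ?I = "int_ob e_pair C B"
  fix i j assume ij: "is_coproduct C i j"
  note D = is_coproductD[OF ij]
  have c: "coprojection C i" "coprojection C j" using coprojectionI[OF ij] coprojectionI2[OF ij] .
  have I: "is_functor C Set_cat ?I" using int_ob_CSet by (simp add: functor_cat_sel)
  note IF = set_functorD(3)[OF I]
  show "inj_on (act ?I i) (ob ?I (Dom C i))"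
  proof (rule inj_onI)
    fix s s' assume s: "s \<in> ob ?I (Dom C i)" "s' \<in> ob ?I (Dom C i)" "act ?I i s = act ?I i s'"
    obtain V b where V: "V \<in> ultrafilters C (Dom C i)" "b \<in> ob B (Dom C i, V)" "s = e_pair (V, b)"
      using int_obE[OF s(1)] D by auto
    obtain W c where W: "W \<in> ultrafilters C (Dom C i)" "c \<in> ob B (Dom C i, W)" "s' = e_pair (W, c)"
      using int_obE[OF s(2)] D by auto
    have eq: "push C V (tot i) = push C W (tot i)"
      "act B (germ_at C (Dom C i) V (tot i)) b = act B (germ_at C (Dom C i) W (tot i)) c"
      using s(3) unfolding V(3) W(3) int_ob_act[OF D(1) V(1,2)] int_ob_act[OF D(1) W(1,2)]
      using pair_eq_iff[OF push_in_ultrafilters[OF V(1) rep_tot[OF V(1) D(1)]]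
        push_in_ultrafilters[OF W(1) rep_tot[OF W(1) D(1)]]] by blast+
    have i: "coprojection C i" by (rule coprojectionI[OF ij])
    have "V = W" "b = c"
      using int_ob_coprojection_inj[OF i V(1,2)] int_ob_coprojection_inj[OF i W(1,2)] eq by simp_all
    then show "s = s'" using V W by simp
  qed
  \<comment> \<open>The images are complementary because exactly one of i and j is large for the
    ultrafilter under each element.\<close>
  have key: "x \<in> act ?I i ` ob ?I (Dom C i) \<longleftrightarrow> x \<notin> act ?I j ` ob ?I (Dom C j)" if x: "x \<in> ob ?I (Cod C i)" for x
  proof -
    obtain U b where U: "U \<in> ultrafilters C (Cod C i)" "b \<in> ob B (Cod C i, U)" "x = e_pair (U, b)"
      using int_obE[OF x] D by auto
    show ?thesis
      unfolding U(3) int_ob_image_iff[OF U(1) c(1) refl U(2)] int_ob_image_iff[OF U(1) c(2) D(3) U(2)]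
      by (rule large_complement[OF U(1) ij refl])
  qed
  have sub: "act ?I i ` ob ?I (Dom C i) \<subseteq> ob ?I (Cod C i)" "act ?I j ` ob ?I (Dom C j) \<subseteq> ob ?I (Cod C i)"
    using IF[OF D(1)] IF[OF D(2)] D(3) by auto
  show "act ?I i ` ob ?I (Dom C i) \<inter> act ?I j ` ob ?I (Dom C j) = {}" using key sub by blast
  show "ob ?I (Cod C i) = act ?I i ` ob ?I (Dom C i) \<union> act ?I j ` ob ?I (Dom C j)" using key sub by blast
qed

lemma int_snd_pair: "\<lbrakk>V \<in> ultrafilters C Y; b \<in> ob B (Y, V)\<rbrakk> \<Longrightarrow> int_snd e_pair C B Y (e_pair (V, b)) = b"
  using inv_pairs by (simp add: int_snd_def)

lemma int_trans_pair:
  "\<lbrakk>V \<in> ultrafilters C Y; b \<in> ob B (Y, V)\<rbrakk> \<Longrightarrow> int_trans e_pair C B t Y (e_pair (V, b)) = e_pair (V, t (Y, V) b)"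
  using inv_pairs by (simp add: int_trans_def)

text \<open>By \<open>int_ob_image_iff\<close>, an element over V that lies in the images of all
  summands of U forces U to be contained in V, hence equal to it.\<close>

lemma tilde_int:
  assumes U: "U \<in> ultrafilters C X"
  shows "tilde_set C (int_ob e_pair C B) (X, U) = (\<lambda>b. e_pair (U, b)) ` ob B (X, U)"
proof (intro set_eqI iffI)
  let ?I = "int_ob e_pair C B"
  fix s assume s: "s \<in> tilde_set C ?I (X, U)"
  then have sX: "s \<in> ob ?I X" and im: "\<And>m. large C U m \<Longrightarrow> s \<in> act ?I m ` ob ?I (Dom C m)"
    unfolding tilde_set_iff[OF U] by blast+
  obtain V b where V: "V \<in> ultrafilters C X" "b \<in> ob B (X, V)" "s = e_pair (V, b)"
    using int_obE[OF sX ultrafilter_Obj[OF U]] .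
  have "U = V"
    by (rule ultrafilter_eqI[OF U V(1)])
      (use im int_ob_image_iff[OF V(1) _ _ V(2)] large_Cod[OF U] large_coprojection[of U] V(3) in blast)
  then show "s \<in> (\<lambda>b. e_pair (U, b)) ` ob B (X, U)" using V by blast
next
  fix s assume "s \<in> (\<lambda>b. e_pair (U, b)) ` ob B (X, U)"
  then obtain b where b: "b \<in> ob B (X, U)" "s = e_pair (U, b)" by blast
  show "s \<in> tilde_set C (int_ob e_pair C B) (X, U)"
    unfolding tilde_set_iff[OF U] b(2)
  proof (intro conjI allI impI int_obI[OF U b(1)])
    fix m assume m: "large C U m"
    show "\<exists>y \<in> ob (int_ob e_pair C B) (Dom C m). act (int_ob e_pair C B) m y = e_pair (U, b)"
      using restrict_include[OF U m b(1)] int_obI by blast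
  qed
qed

end

text \<open>The transformation acts over each ultrafilter separately, and its naturality at f is
  naturality of t at the germ of f as a total map.\<close>

lemma int_functor_trans:
  assumes A: "A \<in> Obj UFSet" and B: "B \<in> Obj UFSet" and t: "mkT (UF C) A B t \<in> Hom UFSet A B"
  shows "ar (int_functor e_pair C) (mkT (UF C) A B t) =
      mkT C (int_ob e_pair C A) (int_ob e_pair C B) (int_trans e_pair C A t)"
    "mkT C (int_ob e_pair C A) (int_ob e_pair C B) (int_trans e_pair C A t) \<in>
      Hom FCSet (int_ob e_pair C A) (int_ob e_pair C B)"
proof -
  note T = mkT_HomD(3,4)[OF t]
  have v: "(let (V, b) = inv_into (int_pairs C A Y) e_pair s in e_pair (V, val (val (mkT (UF C) A B t) (Y, V)) b)) =
      int_trans e_pair C A t Y s" if s: "s \<in> e_pair ` int_pairs C A Y" "Y \<in> Obj C" for Y s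
  proof -
    obtain V b where V: "V \<in> ultrafilters C Y" "b \<in> ob A (Y, V)" "s = e_pair (V, b)"
      using s by (auto simp: int_pairs_def)
    then show ?thesis using inv_pairs[OF A V(1,2)] by (simp add: int_trans_def)
  qed
  show "ar (int_functor e_pair C) (mkT (UF C) A B t) =
      mkT C (int_ob e_pair C A) (int_ob e_pair C B) (int_trans e_pair C A t)"
    unfolding int_functor_def mkT_def[of C] fnctr.sel mkT_sel
    by (simp add: int_ob_mkF[OF A] int_ob_mkF[OF B] v cong: restrict_cong)
  show "mkT C (int_ob e_pair C A) (int_ob e_pair C B) (int_trans e_pair C A t) \<in>
      Hom FCSet (int_ob e_pair C A) (int_ob e_pair C B)"
    unfolding FC_Hom
  proof (intro conjI int_ob_FC[OF A] int_ob_FC[OF B] mkT_Hom int_ob_CSet[OF A] int_ob_CSet[OF B])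
    fix Y s assume Y: "Y \<in> Obj C" and s: "s \<in> ob (int_ob e_pair C A) Y"
    obtain V b where V: "V \<in> ultrafilters C Y" "b \<in> ob A (Y, V)" "s = e_pair (V, b)"
      using int_obE[OF A s Y] .
    then show "int_trans e_pair C A t Y s \<in> ob (int_ob e_pair C B) Y"
      using int_trans_pair[OF A V(1,2)] int_obI[OF B V(1)] T(1)[of "(Y, V)" b] by simp
  next
    fix f s assume f: "f \<in> Arr C" and s: "s \<in> ob (int_ob e_pair C A) (Dom C f)"
    obtain V b where V: "V \<in> ultrafilters C (Dom C f)" "b \<in> ob A (Dom C f, V)" "s = e_pair (V, b)"
      using int_obE[OF A s] f by auto
    note r = rep_tot[OF V(1) f]
    have tb: "t (Dom C f, V) b \<in> ob B (Dom C f, V)" using T(1)[of "(Dom C f, V)" b] V by simp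
    have "act B (germ_at C (Dom C f) V (tot f)) (t (Dom C f, V) b) =
        t (Cod C f, push C V (tot f)) (act A (germ_at C (Dom C f) V (tot f)) b)"
      using T(2)[OF germ_at_Arr[OF V(1) r], of b] V(2) by (simp add: UF_sel)
    then show "act (int_ob e_pair C B) f (int_trans e_pair C A t (Dom C f) s) =
        int_trans e_pair C A t (Cod C f) (act (int_ob e_pair C A) f s)"
      unfolding V(3) int_trans_pair[OF A V(1,2)] int_ob_act[OF B f V(1) tb] int_ob_act[OF A f V(1,2)]
        int_trans_pair[OF A push_in_ultrafilters[OF V(1) r] act_germ_at_in[OF A V(1) r V(2)]]
      by simp
  qed
qed

lemma int_functor: "is_functor UFSet FCSet (int_functor e_pair C)"
  unfolding is_functor_def
proof (intro conjI ballI impI category_FCSet category_UFSet)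
  fix A assume A: "A \<in> Obj UFSet"
  show "ob (int_functor e_pair C) A \<in> Obj FCSet" using int_ob_FC[OF A] by (simp add: int_functor_def)
  have i: "mkT (UF C) A A (\<lambda>X x. x) \<in> Hom UFSet A A"
    using category.Id_Hom[OF category_UFSet A] unfolding Id_mkT by simp
  have "mkT C (int_ob e_pair C A) (int_ob e_pair C A) (int_trans e_pair C A (\<lambda>X x. x)) =
     mkT C (int_ob e_pair C A) (int_ob e_pair C A) (\<lambda>X x. x)"
  proof (rule mkT_cong)
    fix Y s assume Y: "Y \<in> Obj C" and s: "s \<in> ob (int_ob e_pair C A) Y"
    show "int_trans e_pair C A (\<lambda>X x. x) Y s = s"
      using int_obE[OF A s Y] int_trans_pair[OF A] by metis
  qed
  then show "ar (int_functor e_pair C) (Id UFSet A) = Id FCSet (ob (int_functor e_pair C) A)"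
    unfolding FC_sel Id_mkT int_functor_trans(1)[OF A A i] by (simp add: int_functor_def)
next
  fix \<alpha> assume "\<alpha> \<in> Arr UFSet"
  then have \<alpha>: "\<alpha> \<in> Hom UFSet (src \<alpha>) (tgt \<alpha>)" by (simp add: Hom_iff functor_cat_sel)
  note h = functor_cat_HomD(1-3)[OF \<alpha>]
  have "mkT (UF C) (src \<alpha>) (tgt \<alpha>) (\<lambda>X. val (val \<alpha> X)) \<in> Hom UFSet (src \<alpha>) (tgt \<alpha>)" using \<alpha> h(1) by simp
  note tt = int_functor_trans[OF h(2,3) this]
  show "ar (int_functor e_pair C) \<alpha> \<in>
      Hom FCSet (ob (int_functor e_pair C) (Dom UFSet \<alpha>)) (ob (int_functor e_pair C) (Cod UFSet \<alpha>))"
    using tt unfolding h(1)[symmetric] functor_cat_sel(2,3) by (simp add: int_functor_def)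
next
  fix \<alpha> \<beta> assume a: "\<alpha> \<in> Arr UFSet" and b: "\<beta> \<in> Arr UFSet" and ab: "Dom UFSet \<beta> = Cod UFSet \<alpha>"
  define A B D where "A = src \<alpha>" and "B = tgt \<alpha>" and "D = tgt \<beta>"
  have h: "\<alpha> \<in> Hom UFSet A B" "\<beta> \<in> Hom UFSet B D"
    using a b ab by (simp_all add: Hom_iff functor_cat_sel(2,3) A_def B_def D_def)
  note O = functor_cat_HomD(2)[OF h(1)] functor_cat_HomD(2,3)[OF h(2)]
  obtain t u where eq: "\<alpha> = mkT (UF C) A B t" "\<beta> = mkT (UF C) B D u"
    using functor_cat_HomD(1)[OF h(1)] functor_cat_HomD(1)[OF h(2)] by blast
  note t = h(1)[unfolded eq] and u = h(2)[unfolded eq]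
  have ut: "Comp UFSet \<beta> \<alpha> = mkT (UF C) A D (\<lambda>X x. u X (t X x))"
    unfolding eq by (rule Comp_mkT) (rule mkT_HomD(3)[OF t])
  have uth: "mkT (UF C) A D (\<lambda>X x. u X (t X x)) \<in> Hom UFSet A D"
    using category.Comp_Hom[OF category_UFSet h] ut by simp
  note it = int_functor_trans(2)[OF O(1,2) t, unfolded FC_Hom]
  have "Comp CSet (mkT C (int_ob e_pair C B) (int_ob e_pair C D) (int_trans e_pair C B u))
      (mkT C (int_ob e_pair C A) (int_ob e_pair C B) (int_trans e_pair C A t)) =
    mkT C (int_ob e_pair C A) (int_ob e_pair C D) (\<lambda>X x. int_trans e_pair C B u X (int_trans e_pair C A t X x))"
    using it by (intro Comp_mkT) (blast intro: mkT_HomD(3))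
  also have "\<dots> = mkT C (int_ob e_pair C A) (int_ob e_pair C D) (int_trans e_pair C A (\<lambda>X x. u X (t X x)))"
  proof (rule mkT_cong)
    fix Y s assume Y: "Y \<in> Obj C" and s: "s \<in> ob (int_ob e_pair C A) Y"
    obtain V b where V: "V \<in> ultrafilters C Y" "b \<in> ob A (Y, V)" "s = e_pair (V, b)"
      using int_obE[OF O(1) s Y] .
    have "t (Y, V) b \<in> ob B (Y, V)" using mkT_HomD(3)[OF t, of "(Y, V)" b] V by simp
    then show "int_trans e_pair C B u Y (int_trans e_pair C A t Y s) = int_trans e_pair C A (\<lambda>X x. u X (t X x)) Y s"
      unfolding V(3) by (simp add: int_trans_pair[OF O(1) V(1,2)] int_trans_pair[OF O(2) V(1)])
  qed
  finally show "ar (int_functor e_pair C) (Comp UFSet \<beta> \<alpha>) =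
      Comp FCSet (ar (int_functor e_pair C) \<beta>) (ar (int_functor e_pair C) \<alpha>)"
    unfolding FC_sel ut int_functor_trans(1)[OF O(1,3) uth]
    unfolding eq int_functor_trans(1)[OF O(1,2) t] int_functor_trans(1)[OF O(2,3) u] by simp
qed

end

section \<open>The equivalence\<close>

context extensive_universe
begin

text \<open>If m were large for U but not for V, its complement n would be large for V, and x would
  lie in the images of m and n, which are disjoint.\<close>

lemma tilde_unique:
  assumes A: "A \<in> Obj FCSet" and U: "U \<in> ultrafilters C X" and V: "V \<in> ultrafilters C X"
    and x: "x \<in> tilde_set C A (X, U)" "x \<in> tilde_set C A (X, V)"
  shows "U = V"
proof (rule ultrafilter_eqI[OF U V])
  fix m assume m: "large C U m"
  have mX: "Cod C m = X" by (rule large_Cod[OF U m])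
  obtain n where mn: "is_coproduct C m n" using m by (auto simp: large_def coprojection_def)
  have xX: "x \<in> ob A (Cod C m)" using x(1) mX unfolding tilde_set_iff[OF U] by simp
  show "large C V m"
  proof (rule ccontr)
    assume "\<not> large C V m"
    then have "large C V n" using large_complement[OF V mn mX] by blast
    then have "x \<in> act A n ` ob A (Dom C n)" using x(2) unfolding tilde_set_iff[OF V] by blast
    moreover have "x \<in> act A m ` ob A (Dom C m)" using x(1) m unfolding tilde_set_iff[OF U] by blast
    ultimately show False using FC_D(4)[OF A mn xX] by blast
  qed
qed

text \<open>The ultrafilter consists of the summands whose image contains x. Upward closure is
  functoriality, and the complement condition is the splitting of coproducts by A; directedness
  takes a decomposition.\<close>

lemma tilde_exists:
  assumes A: "A \<in> Obj FCSet" and X: "X \<in> Obj C" and x: "x \<in> ob A X"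
  obtains U where "U \<in> ultrafilters C X" "x \<in> tilde_set C A (X, U)"
proof -
  note AF = set_functorD[OF FC_D(1)[OF A]]
  define im where "im m \<longleftrightarrow> x \<in> act A m ` ob A (Dom C m)" for m
  define U where "U = {iso_class C m | m. coprojection C m \<and> Cod C m = X \<and> im m}"
  have up: "im n" if mn: "im m" "factors C n m" for m n
  proof -
    obtain b where b: "n \<in> Arr C" "b \<in> Arr C" "Cod C b = Dom C n" "Dom C b = Dom C m" "n \<cdot> b = m"
      using factorsE[OF mn(2)] .
    obtain y where y: "y \<in> ob A (Dom C m)" "x = act A m y" using mn(1) by (auto simp: im_def)
    have "act A b y \<in> ob A (Dom C n)" "x = act A n (act A b y)"
      using AF(3)[of b y] AF(5)[of b n y] b y by simp_all
    then show ?thesis by (auto simp: im_def)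
  qed
  have L: "large C U m \<longleftrightarrow> coprojection C m \<and> Cod C m = X \<and> im m" for m
  proof
    assume "large C U m"
    then obtain n where n: "coprojection C m" "iso_class C m = iso_class C n" "coprojection C n" "Cod C n = X" "im n"
      by (auto simp: large_def U_def)
    then have "factors C m n" using iso_class_eq_iff by blast
    then show "coprojection C m \<and> Cod C m = X \<and> im m" using n up factors_Arr by metis
  qed (auto simp: large_def U_def)
  have UU: "U \<in> ultrafilters C X"
  proof (rule ultrafilterI[OF X])
    show "U \<subseteq> Summands C X" by (auto simp: U_def Summands_def)
    show "large C U n" if "large C U m" "coprojection C n" "factors C n m" for m n
      using that up factors_Arr[OF that(3)] unfolding L by auto
    show compl: "large C U m \<longleftrightarrow> \<not> large C U n" if mn: "is_coproduct C m n" "Cod C m = X" for m n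
      unfolding L im_def
      using FC_D(4)[OF A mn(1), of x] x mn coprojectionI[OF mn(1)] coprojectionI2[OF mn(1)] is_coproductD(3)[OF mn(1)]
      by simp
    show "\<exists>w. large C U w \<and> factors C m w \<and> factors C n w" if "large C U m" "large C U n" for m n
    proof -
      have m: "coprojection C m" "Cod C m = X" "im m" and n: "coprojection C n" "Cod C n = X" "im n"
        using that L by auto
      have mA: "m \<in> Arr C" by (rule coprojection_Arr[OF m(1)])
      obtain n' where nn: "is_coproduct C n n'" using n(1) by (auto simp: coprojection_def)
      have mn: "Cod C m = Cod C n" using m n by simp
      \<comment> \<open>The domain of m is split into its intersections with n and with the
        complement n'. The lift y of x to m cannot lie in the second part, since x would then lie in
        the image of n'. So it lies in the first, and the image of the meet of m and n contains
        x.\<close>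
      obtain p p' a b where s: "is_coproduct C p p'" "is_pullback C p a m n" "is_pullback C p' b m n'"
        using coproduct_split[OF nn mA mn] .
      note P = is_pullbackD[OF s(2)] and P' = is_pullbackD[OF s(3)]
      obtain y where y: "y \<in> ob A (Dom C m)" "x = act A m y" using m(3) by (auto simp: im_def)
      have "y \<notin> act A p' ` ob A (Dom C p')"
      proof
        assume "y \<in> act A p' ` ob A (Dom C p')"
        then obtain y' where y': "y' \<in> ob A (Dom C p')" "y = act A p' y'" by blast
        have "x = act A n' (act A b y')"
          using y y' AF(5)[of p' m y'] AF(5)[of b n' y'] P' by simp
        then have "x \<in> act A n' ` ob A (Dom C n')" using AF(3)[of b y'] y' P' by auto
        then show False using n FC_D(4)[OF A nn, of x] x unfolding im_def by simp
      qed
      then have "y \<in> act A p ` ob A (Dom C p)" using FC_D(4)[OF A s(1), of y] y P by simp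
      then obtain y' where y': "y' \<in> ob A (Dom C p)" "y = act A p y'" by blast
      have "x = act A (m \<cdot> p) y'" "y' \<in> ob A (Dom C (m \<cdot> p))" using y y' AF(5)[of p m y'] P(1-8) by simp_all
      then have "im (m \<cdot> p)" unfolding im_def by blast
      moreover have "coprojection C (m \<cdot> p)" using coprojection_compose[OF m(1) coprojectionI[OF s(1)]] P by simp
      moreover have "factors C m (m \<cdot> p)" using factorsI[of m p] P by simp
      moreover have "factors C n (m \<cdot> p)" using factorsI[of n a] P by simp
      ultimately show ?thesis unfolding L using m(2) factors_Arr by metis
    qed
  qed
  have "x \<in> tilde_set C A (X, U)"
    unfolding tilde_set_iff[OF UU] using x L by (auto simp: im_def)
  then show ?thesis by (rule that[OF UU])
qed

text \<open>The component at X forgets the ultrafilter. It is bijective because each element of A X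
  lies over exactly one ultrafilter; naturality at f comes from evaluating the germ of f at the
  identity.\<close>

lemma counit:
  assumes A: "A \<in> Obj FCSet"
  defines "\<epsilon> \<equiv> mkT C (int_ob e_pair C (tilde_ob C A)) A (int_snd e_pair C (tilde_ob C A))"
  shows "\<epsilon> \<in> Hom FCSet (int_ob e_pair C (tilde_ob C A)) A" "is_iso FCSet \<epsilon>"
proof -
  let ?B = "tilde_ob C A"
  have B: "?B \<in> Obj UFSet" by (rule tilde_ob_Obj[OF A])
  have ACS: "A \<in> Obj CSet" using A FC_Obj_iff by blast
  have sub: "x \<in> ob ?B (Y, V) \<longleftrightarrow> x \<in> tilde_set C A (Y, V)" if "V \<in> ultrafilters C Y" for x Y V
    using that by (simp add: tilde_ob_sel)
  have sub': "x \<in> ob A Y" if "V \<in> ultrafilters C Y" "x \<in> tilde_set C A (Y, V)" for x Y V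
    using that(2) unfolding tilde_set_iff[OF that(1)] by blast
  have h: "\<epsilon> \<in> Hom CSet (int_ob e_pair C ?B) A"
    unfolding \<epsilon>_def
  proof (rule mkT_Hom[OF int_ob_CSet[OF B] ACS])
    fix Y s assume Y: "Y \<in> Obj C" and s: "s \<in> ob (int_ob e_pair C ?B) Y"
    obtain V x where V: "V \<in> ultrafilters C Y" "x \<in> ob ?B (Y, V)" "s = e_pair (V, x)"
      using int_obE[OF B s Y] .
    show "int_snd e_pair C ?B Y s \<in> ob A Y"
      unfolding V(3) int_snd_pair[OF B V(1,2)] using sub' V sub by blast
  next
    fix f s assume f: "f \<in> Arr C" and s: "s \<in> ob (int_ob e_pair C ?B) (Dom C f)"
    obtain V x where V: "V \<in> ultrafilters C (Dom C f)" "x \<in> ob ?B (Dom C f, V)" "s = e_pair (V, x)"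
      using int_obE[OF B s] f by auto
    note r = rep_tot[OF V(1) f]
    have x: "x \<in> tilde_set C A (Dom C f, V)" using V sub by blast
    then have xA: "x \<in> ob A (Dom C f)" by (rule sub'[OF V(1)])
    have "act ?B (germ_at C (Dom C f) V (tot f)) x = tilde_act C A (germ_at C (Dom C f) V (tot f)) x"
      by (rule tilde_ob_sel(2)[OF germ_at_Arr[OF V(1) r]]) (simp add: x)
    also have "\<dots> = act A f x"
      by (rule tilde_act_eq[OF A V(1) r x, where t = "Id C (Dom C f)" and x' = x])
        (use app_tot[OF f, of "Id C (Dom C f)" f] f xA set_functorD(4)[OF FC_D(1)[OF A]] in simp_all)
    finally have e: "act ?B (germ_at C (Dom C f) V (tot f)) x = act A f x" .
    have fx: "act A f x \<in> ob ?B (Cod C f, push C V (tot f))" using act_germ_at_in[OF B V(1) r V(2)] e by simp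
    show "act A f (int_snd e_pair C ?B (Dom C f) s) =
        int_snd e_pair C ?B (Cod C f) (act (int_ob e_pair C ?B) f s)"
      unfolding V(3) int_ob_act[OF B f V(1,2)] int_snd_pair[OF B V(1,2)]
        e int_snd_pair[OF B push_in_ultrafilters[OF V(1) r] fx] ..
  qed
  then show hF: "\<epsilon> \<in> Hom FCSet (int_ob e_pair C ?B) A"
    using A int_ob_FC[OF B] by (simp add: FC_Hom)
  have "is_iso CSet \<epsilon>"
    unfolding \<epsilon>_def
  proof (rule mkT_iso[OF h[unfolded \<epsilon>_def]])
    fix X assume X: "X \<in> Obj C"
    show "bij_betw (int_snd e_pair C ?B X) (ob (int_ob e_pair C ?B) X) (ob A X)"
      unfolding bij_betw_def
    proof (intro conjI inj_onI equalityI subsetI)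
      fix s s' assume s: "s \<in> ob (int_ob e_pair C ?B) X" "s' \<in> ob (int_ob e_pair C ?B) X"
        "int_snd e_pair C ?B X s = int_snd e_pair C ?B X s'"
      obtain V x where V: "V \<in> ultrafilters C X" "x \<in> ob ?B (X, V)" "s = e_pair (V, x)"
        using int_obE[OF B s(1) X] .
      obtain W y where W: "W \<in> ultrafilters C X" "y \<in> ob ?B (X, W)" "s' = e_pair (W, y)"
        using int_obE[OF B s(2) X] .
      have "x = y" using s(3) unfolding V(3) W(3) int_snd_pair[OF B V(1,2)] int_snd_pair[OF B W(1,2)] .
      moreover from this have "V = W" using tilde_unique[OF A V(1) W(1)] V(2) W(2) sub V(1) W(1) by blast
      ultimately show "s = s'" using V W by simp
    next
      fix x assume "x \<in> int_snd e_pair C ?B X ` ob (int_ob e_pair C ?B) X"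
      then show "x \<in> ob A X" using mkT_HomD(3)[OF h[unfolded \<epsilon>_def] X] by blast
    next
      fix x assume "x \<in> ob A X"
      then obtain U where U: "U \<in> ultrafilters C X" "x \<in> tilde_set C A (X, U)" using tilde_exists[OF A X] by blast
      then have x: "x \<in> ob ?B (X, U)" using sub by blast
      show "x \<in> int_snd e_pair C ?B X ` ob (int_ob e_pair C ?B) X"
        using imageI[OF int_obI[OF B U(1) x], of "int_snd e_pair C ?B X"] int_snd_pair[OF B U(1) x] by simp
    qed
  qed
  then show "is_iso FCSet \<epsilon>" by (rule FC_iso[OF _ hF])
qed

text \<open>Over \<open>(X, U)\<close> both sides consist of the elements of B there, on one side
  paired with U. For naturality a germ is split into restriction to its domain and a total map,
  because only total maps act on the integral.\<close>

lemma unit: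
  assumes B: "B \<in> Obj UFSet"
  defines "\<eta> \<equiv> mkT (UF C) (tilde_ob C (int_ob e_pair C B)) B (\<lambda>P. int_snd e_pair C B (fst P))"
  shows "\<eta> \<in> Hom UFSet (tilde_ob C (int_ob e_pair C B)) B" "is_iso UFSet \<eta>"
proof -
  let ?I = "int_ob e_pair C B"
  have I: "?I \<in> Obj FCSet" by (rule int_ob_FC[OF B])
  have T: "s \<in> ob (tilde_ob C ?I) (X, U) \<longleftrightarrow> (\<exists>b \<in> ob B (X, U). s = e_pair (U, b))" if "U \<in> ultrafilters C X" for X U s
    using that tilde_int[OF B that] by (auto simp: tilde_ob_sel)
  show h: "\<eta> \<in> Hom UFSet (tilde_ob C ?I) B"
    unfolding \<eta>_def
  proof (rule mkT_Hom[OF tilde_ob_Obj[OF I] B])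
    fix P s assume P: "P \<in> Obj (UF C)" and s: "s \<in> ob (tilde_ob C ?I) P"
    obtain X U where PXU: "P = (X, U)" by (cases P)
    have U: "U \<in> ultrafilters C X" using P PXU by simp
    then obtain b where "b \<in> ob B (X, U)" "s = e_pair (U, b)" using s T PXU by blast
    then show "int_snd e_pair C B (fst P) s \<in> ob B P" using int_snd_pair[OF B U] PXU by simp
  next
    fix \<phi> s assume \<phi>: "\<phi> \<in> Arr (UF C)" and s: "s \<in> ob (tilde_ob C ?I) (Dom (UF C) \<phi>)"
    obtain X U Y r where U: "U \<in> ultrafilters C X" and r: "rep C U Y r" and \<phi>r: "\<phi> = germ_at C X U r"
      using UF_ArrE[OF \<phi>] .
    note rD = repD[OF r]
    obtain b where b: "b \<in> ob B (X, U)" "s = e_pair (U, b)" using s T[OF U] by (auto simp: \<phi>r UF_sel)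
    have sT: "s \<in> tilde_set C ?I (X, U)" using b tilde_int[OF B U] by blast
    let ?m = "fst r" and ?f = "snd r"
    let ?\<rho> = "(?m, Id C (Dom C ?m))"
    define V where "V = push C U ?\<rho>"
    define b' where "b' = act B (germ_at C X U ?\<rho>) b"
    note ri = restrict_include[OF B U rD(6) b(1), folded V_def b'_def]
    note rr = rep_restrict[OF rD(6)]
    have Vf: "V \<in> ultrafilters C (Dom C ?f)" "b' \<in> ob B (Dom C ?f, V)" using ri(1,2) rD by simp_all
    have rf: "rep C V Y (tot ?f)" using rep_tot[OF Vf(1) rD(2)] rD by simp
    \<comment> \<open>The lift of s along the domain of r is the restricted pair
      \<open>(V, b')\<close>, by the last part of \<open>restrict_include\<close>.\<close>
    have "tilde_act C ?I \<phi> s = act ?I ?f (e_pair (V, b'))"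
      unfolding \<phi>r
      by (rule tilde_act_eq[OF I U r sT app_self[OF r] int_obI[OF B ri(1,2)]]) (use ri(3) b(2) in simp)
    also have "\<dots> = e_pair (push C V (tot ?f), act B (germ_at C (Dom C ?f) V (tot ?f)) b')"
      by (rule int_ob_act[OF B rD(2) Vf])
    also have "act B (germ_at C (Dom C ?f) V (tot ?f)) b' = act B \<phi> b"
      using act_germ_at_comp[OF B U rr rf[unfolded V_def] r rcomp_restrict[OF r] b(1)] rD
      unfolding \<phi>r b'_def V_def by simp
    also have "push C V (tot ?f) = push C U r"
      using rcomp_push[OF U rr rf[unfolded V_def] r rcomp_restrict[OF r]] unfolding V_def by simp
    finally have e: "tilde_act C ?I \<phi> s = e_pair (push C U r, act B \<phi> b)" .
    have "act (tilde_ob C ?I) \<phi> s = e_pair (push C U r, act B \<phi> b)"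
      using tilde_ob_sel(2)[OF \<phi>, of s ?I] sT e by (simp add: \<phi>r)
    moreover have "act B \<phi> b \<in> ob B (Y, push C U r)" unfolding \<phi>r by (rule act_germ_at_in[OF B U r b(1)])
    ultimately show "act B \<phi> (int_snd e_pair C B (fst (Dom (UF C) \<phi>)) s) =
        int_snd e_pair C B (fst (Cod (UF C) \<phi>)) (act (tilde_ob C ?I) \<phi> s)"
      using int_snd_pair[OF B U b(1)] int_snd_pair[OF B push_in_ultrafilters[OF U r]] b(2) rD
      by (simp add: \<phi>r UF_sel)
  qed
  show "is_iso UFSet \<eta>"
    unfolding \<eta>_def
  proof (rule mkT_iso[OF h[unfolded \<eta>_def]])
    fix P assume P: "P \<in> Obj (UF C)"
    obtain X U where PXU: "P = (X, U)" by (cases P)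
    have U: "U \<in> ultrafilters C X" using P PXU by simp
    have s: "int_snd e_pair C B X (e_pair (U, b)) = b" if "b \<in> ob B (X, U)" for b
      by (rule int_snd_pair[OF B U that])
    have "ob (tilde_ob C ?I) P = (\<lambda>b. e_pair (U, b)) ` ob B (X, U)" using T[OF U] PXU by auto
    then show "bij_betw (int_snd e_pair C B (fst P)) (ob (tilde_ob C ?I) P) (ob B P)"
      using s PXU by (auto intro!: bij_betw_byWitness[where f' = "\<lambda>b. e_pair (U, b)"])
  qed
qed

text \<open>Both composites apply t and drop the ultrafilter, which the induced transformation on
  the integral leaves unchanged.\<close>

lemma counit_natural:
  assumes \<alpha>: "\<alpha> \<in> Hom FCSet A B"
  shows "Comp FCSet \<alpha> (mkT C (int_ob e_pair C (tilde_ob C A)) A (int_snd e_pair C (tilde_ob C A))) =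
    Comp FCSet (mkT C (int_ob e_pair C (tilde_ob C B)) B (int_snd e_pair C (tilde_ob C B)))
      (ar (int_functor e_pair C) (ar (tilde C) \<alpha>))"
proof -
  have A: "A \<in> Obj FCSet" and B: "B \<in> Obj FCSet" and \<alpha>C: "\<alpha> \<in> Hom CSet A B" using \<alpha> by (auto simp: FC_Hom)
  obtain t where \<alpha>t: "\<alpha> = mkT C A B t" using functor_cat_HomD(1)[OF \<alpha>C] by blast
  note t = \<alpha>C[unfolded \<alpha>t]
  let ?A = "tilde_ob C A" and ?B = "tilde_ob C B"
  have TA: "?A \<in> Obj UFSet" and TB: "?B \<in> Obj UFSet" using tilde_ob_Obj A B by blast+
  note tt = tilde_trans[OF A B t]
  note it = int_functor_trans[OF TA TB tt(2)]
  let ?t' = "int_trans e_pair C ?A (\<lambda>P. t (fst P))"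
  have "Comp CSet (mkT C A B t) (mkT C (int_ob e_pair C ?A) A (int_snd e_pair C ?A)) =
      mkT C (int_ob e_pair C ?A) B (\<lambda>X s. t X (int_snd e_pair C ?A X s))"
    using counit(1)[OF A] by (intro Comp_mkT) (blast intro: mkT_HomD(3) dest: FC_Hom[THEN iffD1])
  also have "\<dots> = mkT C (int_ob e_pair C ?A) B (\<lambda>X s. int_snd e_pair C ?B X (?t' X s))"
  proof (rule mkT_cong)
    fix X s assume X: "X \<in> Obj C" and s: "s \<in> ob (int_ob e_pair C ?A) X"
    obtain V x where V: "V \<in> ultrafilters C X" "x \<in> ob ?A (X, V)" "s = e_pair (V, x)"
      using int_obE[OF TA s X] .
    have "t X x \<in> ob ?B (X, V)" using mkT_HomD(3)[OF tt(2), of "(X, V)" x] V by simp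
    then show "t X (int_snd e_pair C ?A X s) = int_snd e_pair C ?B X (?t' X s)"
      unfolding V(3) by (simp add: int_snd_pair[OF TA V(1,2)] int_trans_pair[OF TA V(1,2)] int_snd_pair[OF TB V(1)])
  qed
  also have "\<dots> = Comp CSet (mkT C (int_ob e_pair C ?B) B (int_snd e_pair C ?B))
      (mkT C (int_ob e_pair C ?A) (int_ob e_pair C ?B) ?t')"
    using it(2) by (intro Comp_mkT[symmetric]) (blast intro: mkT_HomD(3) dest: FC_Hom[THEN iffD1])
  finally show ?thesis unfolding \<alpha>t tt(1) it(1) FC_sel .
qed

lemma unit_natural:
  assumes \<alpha>: "\<alpha> \<in> Hom UFSet A B"
  shows "Comp UFSet \<alpha> (mkT (UF C) (tilde_ob C (int_ob e_pair C A)) A (\<lambda>P. int_snd e_pair C A (fst P))) =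
    Comp UFSet (mkT (UF C) (tilde_ob C (int_ob e_pair C B)) B (\<lambda>P. int_snd e_pair C B (fst P)))
      (ar (tilde C) (ar (int_functor e_pair C) \<alpha>))"
proof -
  note A = functor_cat_HomD(2)[OF \<alpha>] and B = functor_cat_HomD(3)[OF \<alpha>]
  obtain t where \<alpha>t: "\<alpha> = mkT (UF C) A B t" using functor_cat_HomD(1)[OF \<alpha>] by blast
  note t = \<alpha>[unfolded \<alpha>t]
  let ?A = "int_ob e_pair C A" and ?B = "int_ob e_pair C B"
  have IA: "?A \<in> Obj FCSet" and IB: "?B \<in> Obj FCSet" using int_ob_FC A B by blast+
  note it = int_functor_trans[OF A B t]
  have itC: "mkT C ?A ?B (int_trans e_pair C A t) \<in> Hom CSet ?A ?B" using it(2) by (simp add: FC_Hom)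
  note tt = tilde_trans[OF IA IB itC]
  let ?t' = "\<lambda>P. int_trans e_pair C A t (fst P)"
  have "Comp UFSet (mkT (UF C) A B t) (mkT (UF C) (tilde_ob C ?A) A (\<lambda>P. int_snd e_pair C A (fst P))) =
      mkT (UF C) (tilde_ob C ?A) B (\<lambda>P s. t P (int_snd e_pair C A (fst P) s))"
    using unit(1)[OF A] by (intro Comp_mkT) (rule mkT_HomD(3))
  also have "\<dots> = mkT (UF C) (tilde_ob C ?A) B (\<lambda>P s. int_snd e_pair C B (fst P) (?t' P s))"
  proof (rule mkT_cong)
    fix P s assume P: "P \<in> Obj (UF C)" and s: "s \<in> ob (tilde_ob C ?A) P"
    obtain X U where PXU: "P = (X, U)" by (cases P)
    have U: "U \<in> ultrafilters C X" using P PXU by simp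
    obtain b where b: "b \<in> ob A (X, U)" "s = e_pair (U, b)"
      using s tilde_int[OF A U] P PXU by (auto simp: tilde_ob_sel)
    have "t (X, U) b \<in> ob B (X, U)" using mkT_HomD(3)[OF t, of "(X, U)" b] U b by simp
    then show "t P (int_snd e_pair C A (fst P) s) = int_snd e_pair C B (fst P) (?t' P s)"
      unfolding b(2) PXU
      by (simp add: int_snd_pair[OF A U b(1)] int_trans_pair[OF A U b(1)] int_snd_pair[OF B U])
  qed
  also have "\<dots> = Comp UFSet (mkT (UF C) (tilde_ob C ?B) B (\<lambda>P. int_snd e_pair C B (fst P)))
      (mkT (UF C) (tilde_ob C ?A) (tilde_ob C ?B) ?t')"
    using tt(2) by (intro Comp_mkT[symmetric]) (rule mkT_HomD(3))
  finally show ?thesis unfolding \<alpha>t it(1) tt(1) .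
qed

lemma equivalence_tilde_int: "equivalence FCSet UFSet (tilde C) (int_functor e_pair C)"
  unfolding equivalence_def
proof (intro conjI tilde_functor int_functor)
  have sel: "ob (tilde C) A = tilde_ob C A" "ob (int_functor e_pair C) B = int_ob e_pair C B" for A B
    by (simp_all add: tilde_def int_functor_def)
  show "naturally_isomorphic FCSet FCSet (comp_functor (int_functor e_pair C) (tilde C)) id_functor"
    unfolding naturally_isomorphic_def
  proof (intro exI conjI ballI)
    let ?\<epsilon> = "\<lambda>A. mkT C (int_ob e_pair C (tilde_ob C A)) A (int_snd e_pair C (tilde_ob C A))"
    show "nat_trans FCSet FCSet (comp_functor (int_functor e_pair C) (tilde C)) id_functor ?\<epsilon>"
      unfolding nat_trans_def comp_functor_def id_functor_def fnctr.sel o_apply sel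
    proof (intro conjI ballI)
      fix \<alpha> :: "('o, 'a, 's) set_trans" assume "\<alpha> \<in> Arr FCSet"
      then show "Comp FCSet \<alpha> (?\<epsilon> (Dom FCSet \<alpha>)) =
          Comp FCSet (?\<epsilon> (Cod FCSet \<alpha>)) (ar (int_functor e_pair C) (ar (tilde C) \<alpha>))"
        by (intro counit_natural) (simp add: Hom_iff)
    qed (rule counit(1))
    show "is_iso FCSet (?\<epsilon> A)" if "A \<in> Obj FCSet" for A by (rule counit(2)[OF that])
  qed
  show "naturally_isomorphic UFSet UFSet (comp_functor (tilde C) (int_functor e_pair C)) id_functor"
    unfolding naturally_isomorphic_def
  proof (intro exI conjI ballI)
    let ?\<eta> = "\<lambda>B. mkT (UF C) (tilde_ob C (int_ob e_pair C B)) B (\<lambda>P. int_snd e_pair C B (fst P))"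
    show "nat_trans UFSet UFSet (comp_functor (tilde C) (int_functor e_pair C)) id_functor ?\<eta>"
      unfolding nat_trans_def comp_functor_def id_functor_def fnctr.sel o_apply sel
    proof (intro conjI ballI)
      fix \<alpha> assume "\<alpha> \<in> Arr UFSet"
      then show "Comp UFSet \<alpha> (?\<eta> (Dom UFSet \<alpha>)) =
          Comp UFSet (?\<eta> (Cod UFSet \<alpha>)) (ar (tilde C) (ar (int_functor e_pair C) \<alpha>))"
        by (intro unit_natural) (simp add: Hom_iff)
    qed (rule unit(1))
    show "is_iso UFSet (?\<eta> B)" if "B \<in> Obj UFSet" for B by (rule unit(2)[OF that])
  qed
qed

end

section \<open>The ultrahom functor\<close>

definition hom_act :: "('a \<Rightarrow> 's) \<Rightarrow> ('o, 'a) cat \<Rightarrow> 'o \<Rightarrow> 'a \<Rightarrow> 's \<Rightarrow> 's" where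
  "hom_act e D X f s = e (Comp D f (inv_into (Hom D X (Dom D f)) e s))"

text \<open>The cocone condition sits inside a \<open>let\<close> of \<open>is_colimit\<close> and
  is restated here. The comparison arrows compose to endomorphisms compatible with the legs, hence
  to identities.\<close>

lemma colimit_unique:
  assumes D: "category D" and L: "is_colimit J D F L \<kappa>" and M: "is_colimit J D F M \<mu>"
  shows "isomorphic D L M"
proof -
  interpret category D by fact
  define cocone where "cocone = (\<lambda>M \<mu>. M \<in> Obj D \<and> (\<forall>j \<in> Obj J. \<mu> j \<in> Hom D (ob F j) M) \<and>
           (\<forall>t \<in> Arr J. Comp D (\<mu> (Cod J t)) (ar F t) = \<mu> (Dom J t)))"
  have L': "cocone L \<kappa>" "\<And>M \<mu>. cocone M \<mu> \<Longrightarrow> \<exists>!u. u \<in> Hom D L M \<and> (\<forall>j \<in> Obj J. Comp D u (\<kappa> j) = \<mu> j)"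
    using L unfolding is_colimit_def Let_def cocone_def by blast+
  have M': "cocone M \<mu>" "\<And>L \<kappa>. cocone L \<kappa> \<Longrightarrow> \<exists>!u. u \<in> Hom D M L \<and> (\<forall>j \<in> Obj J. Comp D u (\<mu> j) = \<kappa> j)"
    using M unfolding is_colimit_def Let_def cocone_def by blast+
  obtain u where u: "u \<in> Hom D L M" "\<And>j. j \<in> Obj J \<Longrightarrow> Comp D u (\<kappa> j) = \<mu> j" using L'(2)[OF M'(1)] by blast
  obtain v where v: "v \<in> Hom D M L" "\<And>j. j \<in> Obj J \<Longrightarrow> Comp D v (\<mu> j) = \<kappa> j" using M'(2)[OF L'(1)] by blast
  have h: "\<kappa> j \<in> Hom D (ob F j) L" "\<mu> j \<in> Hom D (ob F j) M" if "j \<in> Obj J" for j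
    using L'(1) M'(1) that unfolding cocone_def by blast+
  have LM: "L \<in> Obj D" "M \<in> Obj D" using L'(1) M'(1) unfolding cocone_def by blast+
  have "Comp D (Comp D v u) (\<kappa> j) = \<kappa> j" if "j \<in> Obj J" for j
    using u v h[OF that] that by (simp add: Hom_iff)
  then have "Comp D v u = Id D L"
    using L'(2)[OF L'(1)] Comp_Hom[OF u(1) v(1)] Id_Hom[OF LM(1)] h(1) Id_Comp by metis
  moreover have "Comp D (Comp D u v) (\<mu> j) = \<mu> j" if "j \<in> Obj J" for j
    using u v h[OF that] that by (simp add: Hom_iff)
  then have "Comp D u v = Id D M"
    using M'(2)[OF M'(1)] Comp_Hom[OF v(1) u(1)] Id_Hom[OF LM(2)] h(2) Id_Comp by metis
  ultimately have "is_iso D u" using u(1) v(1) by (intro is_isoI[where g = v]) (simp_all add: Hom_iff)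
  then show ?thesis using u(1) by (auto simp: isomorphic_def)
qed

section \<open>Representable functors coded in the universe\<close>

text \<open>Abstracted over the category so as to apply twice: to C with \<open>e_hom\<close>, for
  the diagram of the ultrahom functor, and to \<open>UF C\<close> with \<open>e_uf\<close>, for the
  representable functor.\<close>

locale hom_coded_category = category C for C :: "('p, 'b) cat" +
  fixes e :: "'b \<Rightarrow> 's"
  assumes inj_e: "\<And>X Y. X \<in> Obj C \<Longrightarrow> Y \<in> Obj C \<Longrightarrow> inj_on e (Hom C X Y)"
begin

lemma inv_e: "f \<in> Hom C X Y \<Longrightarrow> inv_into (Hom C X Y) e (e f) = f"
  using inj_e[of X Y] by (intro inv_into_f_f) (auto simp: Hom_iff)

lemma hom_functor_mkF: "hom_functor e C X = mkF C (\<lambda>Y. e ` Hom C X Y) (hom_act e C X)"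
  unfolding hom_functor_def mkF_def hom_act_def ..

lemma hom_act_e: "\<lbrakk>f \<in> Arr C; k \<in> Hom C X (Dom C f)\<rbrakk> \<Longrightarrow> hom_act e C X f (e k) = e (f \<cdot> k)"
  by (simp add: hom_act_def inv_e)

lemma hom_functor_Obj: "hom_functor e C X \<in> Obj (functor_cat C Set_cat)"
  unfolding hom_functor_mkF
proof (rule mkF_Obj[OF category_axioms])
  fix f s assume f: "f \<in> Arr C" and "s \<in> e ` Hom C X (Dom C f)"
  then obtain k where k: "k \<in> Hom C X (Dom C f)" "s = e k" by blast
  have "f \<cdot> k \<in> Hom C X (Cod C f)" using k(1) f by (simp add: Hom_iff)
  then show "hom_act e C X f s \<in> e ` Hom C X (Cod C f)" using hom_act_e[OF f k(1)] k(2) by simp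
next
  fix Y s assume Y: "Y \<in> Obj C" and "s \<in> e ` Hom C X Y"
  then obtain k where k: "k \<in> Hom C X Y" "s = e k" by blast
  then show "hom_act e C X (Id C Y) s = s" using hom_act_e[of "Id C Y" k X] Y by (simp add: Hom_iff)
next
  fix f g s assume f: "f \<in> Arr C" and g: "g \<in> Arr C" "Dom C g = Cod C f" and "s \<in> e ` Hom C X (Dom C f)"
  then obtain k where k: "k \<in> Hom C X (Dom C f)" "s = e k" by blast
  have "f \<cdot> k \<in> Hom C X (Dom C g)" using k(1) f g by (simp add: Hom_iff)
  note gk = hom_act_e[OF g(1) this]
  show "hom_act e C X (g \<cdot> f) s = hom_act e C X g (hom_act e C X f s)"
    using hom_act_e[OF f k(1)] gk hom_act_e[of "g \<cdot> f" k X] k f g by (simp add: Hom_iff)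
qed

lemma hom_functor_ob: "Y \<in> Obj C \<Longrightarrow> ob (hom_functor e C X) Y = e ` Hom C X Y"
  by (simp add: hom_functor_mkF)

lemma hom_functor_act: "\<lbrakk>f \<in> Arr C; k \<in> Hom C X (Dom C f)\<rbrakk> \<Longrightarrow> act (hom_functor e C X) f (e k) = e (f \<cdot> k)"
  by (simp add: hom_functor_mkF hom_act_e)

definition precomp_act :: "'b \<Rightarrow> 'p \<Rightarrow> 's \<Rightarrow> 's" where
  "precomp_act h Y s = e (inv_into (Hom C (Cod C h) Y) e s \<cdot> h)"

lemma precomp_act_e: "k \<in> Hom C (Cod C h) Y \<Longrightarrow> precomp_act h Y (e k) = e (k \<cdot> h)"
  by (simp add: precomp_act_def inv_e)

lemma hom_precomp_mkT: "hom_precomp e C h = mkT C (hom_functor e C (Cod C h)) (hom_functor e C (Dom C h)) (precomp_act h)"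
  unfolding hom_precomp_def mkT_def precomp_act_def by (simp add: hom_functor_ob cong: restrict_cong)

lemma hom_precomp_Hom:
  assumes h: "h \<in> Arr C"
  shows "hom_precomp e C h \<in> Hom (functor_cat C Set_cat) (hom_functor e C (Cod C h)) (hom_functor e C (Dom C h))"
  unfolding hom_precomp_mkT
proof (rule mkT_Hom[OF hom_functor_Obj hom_functor_Obj])
  fix Y s assume Y: "Y \<in> Obj C" and "s \<in> ob (hom_functor e C (Cod C h)) Y"
  then obtain k where k: "k \<in> Hom C (Cod C h) Y" "s = e k" by (auto simp: hom_functor_ob)
  have "k \<cdot> h \<in> Hom C (Dom C h) Y" using k(1) h by (simp add: Hom_iff)
  then show "precomp_act h Y s \<in> ob (hom_functor e C (Dom C h)) Y" using precomp_act_e[OF k(1)] k(2) Y by (simp add: hom_functor_ob)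
next
  fix f s assume f: "f \<in> Arr C" and "s \<in> ob (hom_functor e C (Cod C h)) (Dom C f)"
  then obtain k where k: "k \<in> Hom C (Cod C h) (Dom C f)" "s = e k" by (auto simp: hom_functor_ob)
  have "k \<cdot> h \<in> Hom C (Dom C h) (Dom C f)" "f \<cdot> k \<in> Hom C (Cod C h) (Cod C f)" "f \<cdot> (k \<cdot> h) = (f \<cdot> k) \<cdot> h"
    using k(1) h f by (simp_all add: Hom_iff)
  then show "act (hom_functor e C (Dom C h)) f (precomp_act h (Dom C f) s) =
      precomp_act h (Cod C f) (act (hom_functor e C (Cod C h)) f s)"
    unfolding k(2) by (simp only: precomp_act_e[OF k(1)] hom_functor_act[OF f k(1)] hom_functor_act[OF f] precomp_act_e)
qed

lemma hom_precomp_Id: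
  assumes X: "X \<in> Obj C"
  shows "hom_precomp e C (Id C X) = Id (functor_cat C Set_cat) (hom_functor e C X)"
  unfolding Id_mkT hom_precomp_mkT Id_simps(2,3)[OF X]
proof (rule mkT_cong)
  fix Y s assume Y: "Y \<in> Obj C" and "s \<in> ob (hom_functor e C X) Y"
  then obtain k where "k \<in> Hom C X Y" "s = e k" by (auto simp: hom_functor_ob)
  then show "precomp_act (Id C X) Y s = s" using precomp_act_e[of k "Id C X" Y] X by (simp add: Hom_iff)
qed

lemma hom_precomp_comp:
  assumes h: "h \<in> Arr C" "h' \<in> Arr C" "Dom C h = Cod C h'"
  shows "hom_precomp e C (h \<cdot> h') = Comp (functor_cat C Set_cat) (hom_precomp e C h') (hom_precomp e C h)"
proof -
  have "Comp (functor_cat C Set_cat) (hom_precomp e C h') (hom_precomp e C h) =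
      mkT C (hom_functor e C (Cod C h)) (hom_functor e C (Dom C h')) (\<lambda>Y s. precomp_act h' Y (precomp_act h Y s))"
    using mkT_HomD(3)[OF hom_precomp_Hom[OF h(1), unfolded hom_precomp_mkT]]
    unfolding hom_precomp_mkT h(3)[symmetric] by (rule Comp_mkT)
  also have "\<dots> = mkT C (hom_functor e C (Cod C h)) (hom_functor e C (Dom C h')) (precomp_act (h \<cdot> h'))"
  proof (rule mkT_cong)
    fix Y s assume Y: "Y \<in> Obj C" and "s \<in> ob (hom_functor e C (Cod C h)) Y"
    then obtain k where k: "k \<in> Hom C (Cod C h) Y" "s = e k" by (auto simp: hom_functor_ob)
    have "k \<cdot> h \<in> Hom C (Cod C h') Y" "k \<in> Hom C (Cod C (h \<cdot> h')) Y" "(k \<cdot> h) \<cdot> h' = k \<cdot> (h \<cdot> h')"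
      using k(1) h by (simp_all add: Hom_iff)
    then show "precomp_act h' Y (precomp_act h Y s) = precomp_act (h \<cdot> h') Y s"
      unfolding k(2) by (simp only: precomp_act_e[OF k(1)] precomp_act_e)
  qed
  finally show ?thesis using h by (simp add: hom_precomp_mkT)
qed

end

context extensive_universe
begin

sublocale hom: hom_coded_category C e_hom
  by unfold_locales (rule inj_hom)

lemma hom_coded_category_UF: "hom_coded_category (UF C) e_uf"
  using category_UF inj_uf by (simp add: hom_coded_category_def hom_coded_category_axioms_def)

sublocale uf: hom_coded_category "UF C" e_uf
  by (rule hom_coded_category_UF)

text \<open>The colimit is formed among all functors, so another colimit is at first only isomorphic
  to H there. The components of the isomorphism are bijections matching images of coprojections with
  images of coprojections, so the splitting of coproducts transfers.\<close>

lemma FC_iso_closed: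
  assumes F: "F \<in> Obj FCSet" and iso: "isomorphic CSet F G"
  shows "G \<in> Obj FCSet"
proof -
  obtain \<alpha> where \<alpha>: "\<alpha> \<in> Hom CSet F G" "is_iso CSet \<alpha>" using iso by (auto simp: isomorphic_def)
  obtain t where \<alpha>t: "\<alpha> = mkT C F G t" using functor_cat_HomD(1)[OF \<alpha>(1)] by blast
  note t = \<alpha>(1)[unfolded \<alpha>t]
  note T = mkT_HomD[OF t]
  have FF: "is_functor C Set_cat F" using T(1) by (simp add: functor_cat_sel)
  have bij: "bij_betw (t X) (ob F X) (ob G X)" if "X \<in> Obj C" for X
    using mkT_iso_bij[OF \<alpha>(2)[unfolded \<alpha>t] that] .
  have obG: "ob G X = t X ` ob F X" if "X \<in> Obj C" for X using bij[OF that] by (simp add: bij_betw_def)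
  have injt: "inj_on (t X) (ob F X)" if "X \<in> Obj C" for X using bij[OF that] by (simp add: bij_betw_def)
  have fcF: "splits_coproducts C F" using F FC_Obj_iff by blast
  have img: "act G i ` ob G (Dom C i) = t (Cod C i) ` (act F i ` ob F (Dom C i))" if "i \<in> Arr C" for i
    using obG[of "Dom C i"] T(4)[OF that] that by (force simp: image_image)
  have "splits_coproducts C G"
    unfolding splits_coproducts_def
  proof (intro conjI allI impI)
    show "ob G Z = {}" if "is_initial C Z" for Z
      using fcF that obG[of Z] by (simp add: splits_coproducts_def is_initial_def)
    fix i j assume ij: "is_coproduct C i j"
    note D = is_coproductD[OF ij]
    have f: "inj_on (act F i) (ob F (Dom C i))" "act F i ` ob F (Dom C i) \<inter> act F j ` ob F (Dom C j) = {}"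
       "ob F (Cod C i) = act F i ` ob F (Dom C i) \<union> act F j ` ob F (Dom C j)"
      using fcF ij unfolding splits_coproducts_def by blast+
    have sub: "act F i ` ob F (Dom C i) \<subseteq> ob F (Cod C i)" "act F j ` ob F (Dom C j) \<subseteq> ob F (Cod C i)"
      using f(3) by auto
    have "inj_on (\<lambda>x. t (Cod C i) (act F i x)) (ob F (Dom C i))"
      using comp_inj_on[OF f(1) inj_on_subset[OF injt sub(1)]] D by (simp add: comp_def)
    then have "inj_on (\<lambda>x. act G i (t (Dom C i) x)) (ob F (Dom C i))"
      using T(4)[OF D(1)] by (simp cong: inj_on_cong)
    then show "inj_on (act G i) (ob G (Dom C i))"
      using obG[of "Dom C i"] D inj_on_imageI[of "act G i" "t (Dom C i)"] by (simp add: comp_def)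
    show "act G i ` ob G (Dom C i) \<inter> act G j ` ob G (Dom C j) = {}"
      unfolding img[OF D(1)] img[OF D(2)] D(3)
      using inj_on_image_Int[OF injt[of "Cod C i"] sub] f(2) D by simp
    show "ob G (Cod C i) = act G i ` ob G (Dom C i) \<union> act G j ` ob G (Dom C j)"
      unfolding img[OF D(1)] img[OF D(2)] D(3) using f(3) obG[of "Cod C i"] D by (simp add: image_Un)
  qed
  then show ?thesis using T(2) FC_Obj_iff by blast
qed

lemma isomorphic_FC:
  assumes F: "F \<in> Obj FCSet" and iso: "isomorphic CSet F G"
  shows "isomorphic FCSet F G"
proof -
  obtain \<alpha> where \<alpha>: "\<alpha> \<in> Hom CSet F G" "is_iso CSet \<alpha>" using iso by (auto simp: isomorphic_def)
  then have "\<alpha> \<in> Hom FCSet F G" using F FC_iso_closed[OF F iso] by (simp add: FC_Hom)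
  then show ?thesis using FC_iso \<alpha>(2) by (auto simp: isomorphic_def)
qed

section \<open>Germs along a fixed ultrafilter as the colimit of the hom functors\<close>

context
  fixes X :: 'o and U :: "'a set set" and r :: "'a set \<Rightarrow> 'a"
  assumes U: "U \<in> ultrafilters C X" and r: "\<And>V. V \<in> U \<Longrightarrow> r V \<in> V"
begin

text \<open>The inclusion used by \<open>ultrahom_diagram\<close>. The arrow p of the index category
  goes from the larger summand to the smaller one, while \<open>inc p\<close> goes from the smaller
  domain to the larger.\<close>

definition inc :: "'a set \<times> 'a set \<Rightarrow> 'a" where
  "inc p = (THE h. h \<in> Hom C (Dom C (r (snd p))) (Dom C (r (fst p))) \<and> r (fst p) \<cdot> h = r (snd p))"

text \<open>The element of H given by a partial map. Since the map determines its target
  ultrafilter, no ultrafilter on the codomain has to be supplied.\<close>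

definition germ_code :: "'a \<times> 'a \<Rightarrow> 's" where
  "germ_code \<rho> = e_pair (push C U \<rho>, e_uf (germ_at C X U \<rho>))"

abbreviation J where "J \<equiv> opposite_inclusion_cat C U"
abbreviation H where "H \<equiv> int_ob e_pair C (hom_functor e_uf (UF C) (X, U))"

lemma J_sel:
  "Obj J = U" "p \<in> Arr J \<longleftrightarrow> fst p \<in> U \<and> snd p \<in> U \<and> summand_le C (snd p) (fst p)"
  "Dom J = fst" "Cod J = snd" "Id J V = (V, V)" "Comp J p' p = (fst p, snd p')"
  by (auto simp: opposite_inclusion_cat_def)

lemma r_props:
  assumes V: "V \<in> U"
  shows "iso_class C (r V) = V" "large C U (r V)" "coprojection C (r V)" "r V \<in> Arr C" "Cod C (r V) = X"
proof -
  have "V \<in> Summands C X" using V ultrafilter_filter(1)[OF U] by (auto simp: filter_iff)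
  then obtain m where m: "coprojection C m" "V = iso_class C m" by (rule SummandsE)
  have rm: "coprojection C (r V) \<and> factors C m (r V) \<and> factors C (r V) m"
    using r[OF V] mem_iso_class[OF m(1)] m(2) by blast
  then show "iso_class C (r V) = V" using iso_class_eq_iff[of "r V" m] m by blast
  then show l: "large C U (r V)" using V rm by (simp add: large_def)
  show "coprojection C (r V)" "r V \<in> Arr C" using rm coprojection_Arr by blast+
  show "Cod C (r V) = X" by (rule large_Cod[OF U l])
qed

lemma J_factors: "p \<in> Arr J \<longleftrightarrow> fst p \<in> U \<and> snd p \<in> U \<and> factors C (r (fst p)) (r (snd p))"
  using summand_le_iff[OF r_props(3) r_props(3), of "snd p" "fst p"] r_props(1)[of "fst p"] r_props(1)[of "snd p"]
  unfolding J_sel(2) by auto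

lemma inc:
  assumes p: "p \<in> Arr J"
  shows "inc p \<in> Arr C" "Dom C (inc p) = Dom C (r (snd p))" "Cod C (inc p) = Dom C (r (fst p))"
    "r (fst p) \<cdot> inc p = r (snd p)"
proof -
  have VW: "fst p \<in> U" "snd p \<in> U" "factors C (r (fst p)) (r (snd p))" using p unfolding J_factors by blast+
  obtain h where h: "h \<in> Arr C" "Cod C h = Dom C (r (fst p))" "Dom C h = Dom C (r (snd p))" "r (fst p) \<cdot> h = r (snd p)"
    using factorsE[OF VW(3)] .
  let ?P = "\<lambda>h. h \<in> Hom C (Dom C (r (snd p))) (Dom C (r (fst p))) \<and> r (fst p) \<cdot> h = r (snd p)"
  have "?P (inc p)" unfolding inc_def
  proof (rule theI)
    show "?P h" using h by (simp add: Hom_iff)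
    fix h' assume "?P h'"
    then show "h' = h" using coprojection_mono[OF r_props(3)[OF VW(1)], of h' h] h by (simp add: Hom_iff)
  qed
  then show "inc p \<in> Arr C" "Dom C (inc p) = Dom C (r (snd p))" "Cod C (inc p) = Dom C (r (fst p))"
    "r (fst p) \<cdot> inc p = r (snd p)" by (simp_all add: Hom_iff)
qed

lemma inc_eq:
  assumes p: "p \<in> Arr J" and h: "h \<in> Arr C" "Cod C h = Dom C (r (fst p))" "r (fst p) \<cdot> h = r (snd p)"
  shows "h = inc p"
  using coprojection_mono[of "r (fst p)" h "inc p"] inc[OF p] h r_props(3)[of "fst p"] p unfolding J_factors by simp

lemma category_J: "category J"
proof
  fix p assume p: "p \<in> Arr J"
  show "Dom J p \<in> Obj J" "Cod J p \<in> Obj J" using p unfolding J_sel(1,3,4) J_factors by blast+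
next
  fix V assume "V \<in> Obj J"
  then show "Id J V \<in> Hom J V V"
    unfolding Hom_iff J_factors using r_props(4) factors_refl by (simp add: J_sel(1,3-5))
next
  fix p p' V W Z assume "p \<in> Hom J V W" "p' \<in> Hom J W Z"
  then show "Comp J p' p \<in> Hom J V Z"
    unfolding Hom_iff J_factors using factors_trans by (auto simp: J_sel(3-6))
qed (auto simp: Hom_iff J_sel(3-6))

lemma diagram_sel:
  "ob (ultrahom_diagram e_hom C r) V = hom_functor e_hom C (Dom C (r V))"
  "ar (ultrahom_diagram e_hom C r) p = hom_precomp e_hom C (inc p)"
  by (simp_all add: ultrahom_diagram_def inc_def case_prod_beta)

lemma diagram_functor: "is_functor J CSet (ultrahom_diagram e_hom C r)"
  unfolding is_functor_def diagram_sel
proof (intro conjI ballI impI category_J category_CSet hom.hom_functor_Obj)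
  fix p assume p: "p \<in> Arr J"
  show "hom_precomp e_hom C (inc p) \<in> Hom CSet (hom_functor e_hom C (Dom C (r (Dom J p))))
      (hom_functor e_hom C (Dom C (r (Cod J p))))"
    using hom.hom_precomp_Hom[OF inc(1)[OF p]] inc(2,3)[OF p] by (simp add: J_sel(3,4))
next
  fix V assume V: "V \<in> Obj J"
  then have VU: "V \<in> U" by (simp add: J_sel(1))
  have "(V, V) \<in> Arr J" using category.Id_Hom[OF category_J V] by (simp add: Hom_iff J_sel(5))
  then have "inc (V, V) = Id C (Dom C (r V))"
    by (rule inc_eq[symmetric]) (use r_props(4)[OF VU] in simp_all)
  then show "hom_precomp e_hom C (inc (Id J V)) = Id CSet (hom_functor e_hom C (Dom C (r V)))"
    using hom.hom_precomp_Id[of "Dom C (r V)"] r_props(4)[OF VU] by (simp add: J_sel(5))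
next
  fix p p' assume p: "p \<in> Arr J" and p': "p' \<in> Arr J" and eq: "Dom J p' = Cod J p"
  have eq': "fst p' = snd p" using eq by (simp add: J_sel(3,4))
  have pp: "Comp J p' p \<in> Arr J"
    using category.Comp_Hom[OF category_J, of p "Dom J p" "Cod J p" p' "Cod J p'"] p p' eq by (simp add: Hom_iff)
  note i = inc[OF p] and i' = inc[OF p']
  have f: "fst p \<in> U" using p unfolding J_factors by blast
  have "(r (fst p) \<cdot> inc p) \<cdot> inc p' = r (snd p')" using i(4) i'(4) eq' by simp
  then have "r (fst p) \<cdot> (inc p \<cdot> inc p') = r (snd p')" using i(1-3) i'(1-3) eq' r_props(4)[OF f] by simp
  then have "inc p \<cdot> inc p' = inc (Comp J p' p)"
    using i(1-3) i'(1-3) eq' by (intro inc_eq[OF pp]) (simp_all add: J_sel(6))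
  then show "hom_precomp e_hom C (inc (Comp J p' p)) =
      Comp CSet (hom_precomp e_hom C (inc p')) (hom_precomp e_hom C (inc p))"
    using hom.hom_precomp_comp[of "inc p" "inc p'"] i(1-3) i'(1-3) eq' by simp
qed

lemma H_Obj: "H \<in> Obj FCSet"
  by (rule int_ob_FC[OF uf.hom_functor_Obj])

lemma germ_code_pair:
  assumes \<rho>: "rep C U Y \<rho>"
  shows "push C U \<rho> \<in> ultrafilters C Y" "germ_at C X U \<rho> \<in> Hom (UF C) (X, U) (Y, push C U \<rho>)"
    "e_uf (germ_at C X U \<rho>) \<in> ob (hom_functor e_uf (UF C) (X, U)) (Y, push C U \<rho>)"
proof -
  show V: "push C U \<rho> \<in> ultrafilters C Y" by (rule push_in_ultrafilters[OF U \<rho>])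
  show g: "germ_at C X U \<rho> \<in> Hom (UF C) (X, U) (Y, push C U \<rho>)" by (rule germ_at_Hom[OF U \<rho>])
  show "e_uf (germ_at C X U \<rho>) \<in> ob (hom_functor e_uf (UF C) (X, U)) (Y, push C U \<rho>)"
    using V g by (subst uf.hom_functor_ob) auto
qed

lemma germ_code_in: "rep C U Y \<rho> \<Longrightarrow> germ_code \<rho> \<in> ob H Y"
  unfolding germ_code_def by (rule int_obI[OF uf.hom_functor_Obj germ_code_pair(1,3)])

text \<open>Equal codes have equal target ultrafilters by injectivity of \<open>e_pair\<close>, and
  then equal germs by injectivity of \<open>e_uf\<close> on one hom-set.\<close>

lemma germ_code_eq_iff:
  assumes \<rho>: "rep C U Y \<rho>" and \<sigma>: "rep C U Y \<sigma>"
  shows "germ_code \<rho> = germ_code \<sigma> \<longleftrightarrow> sim C U \<rho> \<sigma>"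
proof
  assume "germ_code \<rho> = germ_code \<sigma>"
  then have eq: "push C U \<rho> = push C U \<sigma>" "e_uf (germ_at C X U \<rho>) = e_uf (germ_at C X U \<sigma>)"
    using pair_eq_iff[OF uf.hom_functor_Obj germ_code_pair(1)[OF \<rho>] germ_code_pair(1)[OF \<sigma>]] by (auto simp: germ_code_def)
  have "inj_on e_uf (Hom (UF C) (X, U) (Y, push C U \<rho>))"
    using inj_uf U germ_code_pair(1)[OF \<rho>] by simp
  then have "germ_at C X U \<rho> = germ_at C X U \<sigma>"
    using germ_code_pair(2)[OF \<rho>] germ_code_pair(2)[OF \<sigma>] eq by (auto simp: inj_on_def)
  then show "sim C U \<rho> \<sigma>" using germ_at_eq_iff[OF U \<rho> \<sigma>] by blast
next
  assume "sim C U \<rho> \<sigma>"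
  then show "germ_code \<rho> = germ_code \<sigma>" using germ_at_eq_iff[OF U \<rho> \<sigma>] sim_push[OF U \<rho> \<sigma>] by (simp add: germ_code_def)
qed

text \<open>On generalised elements of the smaller domain both maps have the same values. This is
  how a germ is moved to another representative of its domain.\<close>

lemma sim_precomp:
  assumes \<rho>: "rep C U Y \<rho>" and c: "c \<in> Arr C" "Cod C c = Dom C (fst \<rho>)" and l: "large C U (fst \<rho> \<cdot> c)"
  shows "rep C U Y (fst \<rho> \<cdot> c, snd \<rho> \<cdot> c)" "sim C U \<rho> (fst \<rho> \<cdot> c, snd \<rho> \<cdot> c)"
proof -
  note [simp] = repD[OF \<rho>]
  show s: "rep C U Y (fst \<rho> \<cdot> c, snd \<rho> \<cdot> c)" using c l by (simp add: rep_def Hom_iff)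
  show "sim C U \<rho> (fst \<rho> \<cdot> c, snd \<rho> \<cdot> c)"
    unfolding sim_def using ev_app[OF s]
  proof (rule ev_mono)
    fix t assume "\<exists>z. app C (fst \<rho> \<cdot> c, snd \<rho> \<cdot> c) t z"
    then obtain b where b: "b \<in> Arr C" "Cod C b = Dom C c" "t = (fst \<rho> \<cdot> c) \<cdot> b"
      using c by (auto simp: app_def)
    have "app C \<rho> t (snd \<rho> \<cdot> (c \<cdot> b))"
      using appI[of "c \<cdot> b" \<rho>] b c by simp
    moreover have "app C (fst \<rho> \<cdot> c, snd \<rho> \<cdot> c) t (snd \<rho> \<cdot> (c \<cdot> b))"
      using appI[of b "(fst \<rho> \<cdot> c, snd \<rho> \<cdot> c)"] b c by simp
    ultimately show "\<exists>z. app C \<rho> t z \<and> app C (fst \<rho> \<cdot> c, snd \<rho> \<cdot> c) t z" by blast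
  qed
qed

lemma rep_r: "\<lbrakk>V \<in> U; f \<in> Hom C (Dom C (r V)) Y\<rbrakk> \<Longrightarrow> rep C U Y (r V, f)"
  using r_props(2) by (simp add: rep_def)

text \<open>A germ comes with some coprojection \<open>fst \<rho>\<close>, possibly not the one that
  r selects in its class; precomposition with the factorisation c moves the germ to the selected
  one.\<close>

lemma H_obE:
  assumes s: "s \<in> ob H Y" and Y: "Y \<in> Obj C"
  obtains V f where "V \<in> U" "f \<in> Hom C (Dom C (r V)) Y" "s = germ_code (r V, f)"
proof -
  obtain V b where V: "V \<in> ultrafilters C Y" "b \<in> ob (hom_functor e_uf (UF C) (X, U)) (Y, V)" "s = e_pair (V, b)"
    using int_obE[OF uf.hom_functor_Obj s Y] .
  then obtain \<phi> where \<phi>: "\<phi> \<in> Hom (UF C) (X, U) (Y, V)" "b = e_uf \<phi>" using uf.hom_functor_ob[of "(Y, V)"] by auto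
  obtain \<rho> where \<rho>: "rep C U Y \<rho>" "V = push C U \<rho>" "\<phi> = germ_at C X U \<rho>" using UF_HomE[OF \<phi>(1)] .
  have s\<rho>: "s = germ_code \<rho>" using V(3) \<phi>(2) \<rho> by (simp add: germ_code_def)
  note D = repD[OF \<rho>(1)]
  let ?W = "iso_class C (fst \<rho>)"
  have W: "?W \<in> U" using D(6) by (simp add: large_def)
  have "factors C (fst \<rho>) (r ?W)" using r[OF W] mem_iso_class[OF D(5)] by blast
  then obtain c where c: "c \<in> Arr C" "Cod C c = Dom C (fst \<rho>)" "Dom C c = Dom C (r ?W)" "fst \<rho> \<cdot> c = r ?W"
    by (rule factorsE)
  note sp = sim_precomp[OF \<rho>(1) c(1,2), unfolded c(4), OF r_props(2)[OF W]]
  have "s = germ_code (r ?W, snd \<rho> \<cdot> c)" using germ_code_eq_iff[OF \<rho>(1) sp(1)] sp(2) s\<rho> by simp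
  moreover have "snd \<rho> \<cdot> c \<in> Hom C (Dom C (r ?W)) Y" using c D by (simp add: Hom_iff)
  ultimately show ?thesis using that W by blast
qed

text \<open>The action on the integral composes with the germ of the total map g, and
  postcomposition with g on the same domain represents that composite.\<close>

lemma H_act:
  assumes \<rho>: "rep C U (Dom C g) \<rho>" and g: "g \<in> Arr C"
  shows "act H g (germ_code \<rho>) = germ_code (fst \<rho>, g \<cdot> snd \<rho>)"
proof -
  note D = repD[OF \<rho>]
  have s: "rep C U (Cod C g) (fst \<rho>, g \<cdot> snd \<rho>)" using D g by (simp add: rep_def Hom_iff)
  let ?V = "push C U \<rho>"
  note V = germ_code_pair[OF \<rho>]
  have rg: "rep C ?V (Cod C g) (tot g)" by (rule rep_tot[OF V(1) g])
  have comp: "rcomp C U \<rho> (tot g) (fst \<rho>, g \<cdot> snd \<rho>)"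
    unfolding rcomp_def using ev_app[OF \<rho>]
  proof (rule ev_mono)
    fix t assume "\<exists>z. app C \<rho> t z"
    then obtain b where b: "b \<in> Arr C" "Cod C b = Dom C (fst \<rho>)" "t = fst \<rho> \<cdot> b" by (auto simp: app_def)
    then show "\<exists>y z. app C \<rho> t y \<and> app C (tot g) y z \<and> app C (fst \<rho>, g \<cdot> snd \<rho>) t z"
      using appI[of b \<rho>] appI[of b "(fst \<rho>, g \<cdot> snd \<rho>)"] app_tot[OF g, of "snd \<rho> \<cdot> b" "g \<cdot> snd \<rho> \<cdot> b"] D g
      by (intro exI[of _ "snd \<rho> \<cdot> b"] exI[of _ "g \<cdot> snd \<rho> \<cdot> b"]) simp
  qed
  have "act H g (germ_code \<rho>) = e_pair (push C ?V (tot g),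
      act (hom_functor e_uf (UF C) (X, U)) (germ_at C (Dom C g) ?V (tot g)) (e_uf (germ_at C X U \<rho>)))"
    unfolding germ_code_def by (rule int_ob_act[OF uf.hom_functor_Obj g V(1,3)])
  also have "act (hom_functor e_uf (UF C) (X, U)) (germ_at C (Dom C g) ?V (tot g)) (e_uf (germ_at C X U \<rho>)) =
      e_uf (Comp (UF C) (germ_at C (Dom C g) ?V (tot g)) (germ_at C X U \<rho>))"
    by (rule uf.hom_functor_act[OF germ_at_Arr[OF V(1) rg]]) (use V(2) in \<open>simp add: UF_sel\<close>)
  also have "Comp (UF C) (germ_at C (Dom C g) ?V (tot g)) (germ_at C X U \<rho>) = germ_at C X U (fst \<rho>, g \<cdot> snd \<rho>)"
    by (rule Comp_germ_at[OF U \<rho> rg s comp])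
  finally show ?thesis using rcomp_push[OF U \<rho> rg s comp] by (simp add: germ_code_def)
qed

definition ultrahom_leg :: "'a set \<Rightarrow> ('o, 'a, 's) set_trans" where
  "ultrahom_leg V = mkT C (hom_functor e_hom C (Dom C (r V))) H
     (\<lambda>Y s. germ_code (r V, inv_into (Hom C (Dom C (r V)) Y) e_hom s))"

lemma ultrahom_leg_Hom:
  assumes V: "V \<in> U"
  shows "ultrahom_leg V \<in> Hom CSet (hom_functor e_hom C (Dom C (r V))) H"
  unfolding ultrahom_leg_def
proof (rule mkT_Hom[OF hom.hom_functor_Obj])
  show "H \<in> Obj CSet" using H_Obj FC_Obj_iff by blast
  fix Y s assume "Y \<in> Obj C" "s \<in> ob (hom_functor e_hom C (Dom C (r V))) Y"
  then obtain f where f: "f \<in> Hom C (Dom C (r V)) Y" "s = e_hom f" by (auto simp: hom.hom_functor_ob)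
  then show "germ_code (r V, inv_into (Hom C (Dom C (r V)) Y) e_hom s) \<in> ob H Y"
    using germ_code_in[OF rep_r[OF V f(1)]] hom.inv_e by simp
next
  fix g s assume g: "g \<in> Arr C" and "s \<in> ob (hom_functor e_hom C (Dom C (r V))) (Dom C g)"
  then obtain f where f: "f \<in> Hom C (Dom C (r V)) (Dom C g)" "s = e_hom f" by (auto simp: hom.hom_functor_ob)
  have gf: "g \<cdot> f \<in> Hom C (Dom C (r V)) (Cod C g)" using f(1) g by (simp add: Hom_iff)
  show "act H g (germ_code (r V, inv_into (Hom C (Dom C (r V)) (Dom C g)) e_hom s)) =
      germ_code (r V, inv_into (Hom C (Dom C (r V)) (Cod C g)) e_hom (act (hom_functor e_hom C (Dom C (r V))) g s))"
    unfolding f(2) hom.hom_functor_act[OF g f(1)] hom.inv_e[OF f(1)] hom.inv_e[OF gf]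
    using H_act[OF rep_r[OF V f(1)] g] by simp
qed

text \<open>Precomposition with an inclusion restricts a map to a smaller large summand, which
  leaves its germ unchanged.\<close>

lemma ultrahom_leg_cocone:
  assumes p: "p \<in> Arr J"
  shows "Comp CSet (ultrahom_leg (snd p)) (hom_precomp e_hom C (inc p)) = ultrahom_leg (fst p)"
proof -
  have VW: "fst p \<in> U" "snd p \<in> U" using p unfolding J_factors by blast+
  note i = inc[OF p]
  have "Comp CSet (ultrahom_leg (snd p)) (hom_precomp e_hom C (inc p)) =
      mkT C (hom_functor e_hom C (Dom C (r (fst p)))) H
        (\<lambda>Y s. germ_code (r (snd p), inv_into (Hom C (Dom C (r (snd p))) Y) e_hom (hom.precomp_act (inc p) Y s)))"
    using mkT_HomD(3)[OF hom.hom_precomp_Hom[OF i(1), unfolded hom.hom_precomp_mkT i(2,3)]]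
    unfolding ultrahom_leg_def hom.hom_precomp_mkT i(2,3) by (rule Comp_mkT)
  also have "\<dots> = ultrahom_leg (fst p)"
    unfolding ultrahom_leg_def
  proof (rule mkT_cong)
    fix Y s assume "Y \<in> Obj C" "s \<in> ob (hom_functor e_hom C (Dom C (r (fst p)))) Y"
    then obtain f where f: "f \<in> Hom C (Dom C (r (fst p))) Y" "s = e_hom f" by (auto simp: hom.hom_functor_ob)
    have f': "f \<in> Hom C (Cod C (inc p)) Y" using f i by simp
    have fi: "f \<cdot> inc p \<in> Hom C (Dom C (r (snd p))) Y" using f i by (simp add: Hom_iff)
    note rp = rep_r[OF VW(1) f(1)]
    have "germ_code (r (fst p), f) = germ_code (r (snd p), f \<cdot> inc p)"
      using sim_precomp[OF rp, of "inc p"] i r_props(2)[OF VW(2)] germ_code_eq_iff[OF rp] by simp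
    then show "germ_code (r (snd p), inv_into (Hom C (Dom C (r (snd p))) Y) e_hom (hom.precomp_act (inc p) Y s)) =
        germ_code (r (fst p), inv_into (Hom C (Dom C (r (fst p))) Y) e_hom s)"
      unfolding f(2) hom.precomp_act_e[OF f'] hom.inv_e[OF f(1)] hom.inv_e[OF fi] by simp
  qed
  finally show ?thesis .
qed

text \<open>Equal germs agree on some large w. Moved to the chosen representative of w, the common
  restriction is one arrow at the index \<open>?Z\<close>, from which the cocone equations compute
  both values.\<close>

lemma cocone_agree:
  assumes \<mu>: "\<And>V. V \<in> U \<Longrightarrow> \<mu> V \<in> Hom CSet (hom_functor e_hom C (Dom C (r V))) M"
    and cc: "\<And>p. p \<in> Arr J \<Longrightarrow> Comp CSet (\<mu> (snd p)) (hom_precomp e_hom C (inc p)) = \<mu> (fst p)"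
    and V: "V \<in> U" "f \<in> Hom C (Dom C (r V)) Y" and W: "W \<in> U" "g \<in> Hom C (Dom C (r W)) Y"
    and eq: "germ_code (r V, f) = germ_code (r W, g)"
  shows "val (val (\<mu> V) Y) (e_hom f) = val (val (\<mu> W) Y) (e_hom g)"
proof -
  note rV = rep_r[OF V] and rW = rep_r[OF W]
  have Y: "Y \<in> Obj C" using V(2) Obj_Cod by (auto simp: Hom_iff)
  have "sim C U (r V, f) (r W, g)" using eq germ_code_eq_iff[OF rV rW] by blast
  then obtain w z where w: "large C U w" "app C (r V, f) w z" "app C (r W, g) w z"
    unfolding sim_def by (rule ev_E) blast
  let ?Z = "iso_class C w"
  have Z: "?Z \<in> U" using w(1) by (simp add: large_def)
  have "factors C w (r ?Z)" using r[OF Z] mem_iso_class[OF large_coprojection[OF w(1)]] by blast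
  then obtain c where c: "c \<in> Arr C" "Cod C c = Dom C w" "w \<cdot> c = r ?Z" by (rule factorsE)
  have zV: "app C (r V, f) (r ?Z) (z \<cdot> c)" and zW: "app C (r W, g) (r ?Z) (z \<cdot> c)"
    using app_comp[OF rV w(2) c(1,2)] app_comp[OF rW w(3) c(1,2)] c(3) by simp_all
  \<comment> \<open>The factorisation b between chosen representatives is the arrow
    \<open>inc\<close> of the diagram, so the leg at V' factors through the leg at
    \<open>?Z\<close>.\<close>
  have key: "val (val (\<mu> V') Y) (e_hom f') = val (val (\<mu> ?Z) Y) (e_hom (z \<cdot> c))"
    if V': "V' \<in> U" "f' \<in> Hom C (Dom C (r V')) Y" and a: "app C (r V', f') (r ?Z) (z \<cdot> c)" for V' f'
  proof -
    obtain b where b: "b \<in> Arr C" "Cod C b = Dom C (r V')" "r V' \<cdot> b = r ?Z" "f' \<cdot> b = z \<cdot> c"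
      using a by (auto simp: app_def)
    have "factors C (r V') (r ?Z)" using factorsI[of "r V'" b] b r_props(4)[OF V'(1)] by simp
    then have p: "(V', ?Z) \<in> Arr J" unfolding J_factors using V' Z by simp
    have bi: "b = inc (V', ?Z)" using inc_eq[OF p, of b] b by simp
    have f': "f' \<in> Hom C (Cod C b) Y" using V'(2) b(2) by simp
    note i = inc[OF p]
    have "\<mu> V' = Comp CSet (\<mu> ?Z) (hom_precomp e_hom C b)" using cc[OF p] bi by simp
    then have "val (val (\<mu> V') Y) (e_hom f') =
        val (val (Comp CSet (\<mu> ?Z) (hom_precomp e_hom C b)) Y) (e_hom f')" by simp
    also have "\<dots> = val (val (\<mu> ?Z) Y) (val (val (hom_precomp e_hom C b) Y) (e_hom f'))"
      using Y f' by (simp add: functor_cat_sel(5) compose_def hom.hom_precomp_mkT mkT_def hom.hom_functor_ob)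
    also have "val (val (hom_precomp e_hom C b) Y) (e_hom f') = e_hom (z \<cdot> c)"
      unfolding hom.hom_precomp_mkT using Y f' b(4) by (subst mkT_sel(3)) (auto simp: hom.hom_functor_ob hom.precomp_act_e)
    finally show ?thesis .
  qed
  show ?thesis using key[OF V zV] key[OF W zW] by simp
qed

text \<open>Every element of H is the germ of an arrow at some stage, which gives uniqueness; by
  \<open>cocone_agree\<close> the value of a cocone depends only on the germ, which gives
  existence.\<close>

lemma H_colimit: "is_colimit J CSet (ultrahom_diagram e_hom C r) H ultrahom_leg"
  unfolding is_colimit_def Let_def diagram_sel J_sel(1,3,4)
proof (intro conjI allI impI ballI diagram_functor ultrahom_leg_Hom ultrahom_leg_cocone)
  show HO: "H \<in> Obj CSet" using H_Obj FC_Obj_iff by blast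
  fix M \<mu> assume c: "M \<in> Obj CSet \<and> (\<forall>V \<in> U. \<mu> V \<in> Hom CSet (hom_functor e_hom C (Dom C (r V))) M) \<and>
     (\<forall>p \<in> Arr J. Comp CSet (\<mu> (snd p)) (hom_precomp e_hom C (inc p)) = \<mu> (fst p))"
  have M: "M \<in> Obj CSet" and \<mu>: "\<And>V. V \<in> U \<Longrightarrow> \<mu> V \<in> Hom CSet (hom_functor e_hom C (Dom C (r V))) M"
    and cc: "\<And>p. p \<in> Arr J \<Longrightarrow> Comp CSet (\<mu> (snd p)) (hom_precomp e_hom C (inc p)) = \<mu> (fst p)"
    using c by blast+
  \<comment> \<open>The choice runs over all presentations of s as a germ; their values
    coincide.\<close>
  define u where "u Y s = (SOME z. \<exists>V f. V \<in> U \<and> f \<in> Hom C (Dom C (r V)) Y \<and> s = germ_code (r V, f) \<and>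
      z = val (val (\<mu> V) Y) (e_hom f))" for Y s
  have u: "u Y (germ_code (r V, f)) = val (val (\<mu> V) Y) (e_hom f)" if V: "V \<in> U" "f \<in> Hom C (Dom C (r V)) Y" for V f Y
    unfolding u_def
  proof (rule some_equality)
    show "\<exists>V' f'. V' \<in> U \<and> f' \<in> Hom C (Dom C (r V')) Y \<and> germ_code (r V, f) = germ_code (r V', f') \<and>
        val (val (\<mu> V) Y) (e_hom f) = val (val (\<mu> V') Y) (e_hom f')" using V by blast
    fix z assume "\<exists>V' f'. V' \<in> U \<and> f' \<in> Hom C (Dom C (r V')) Y \<and> germ_code (r V, f) = germ_code (r V', f') \<and>
        z = val (val (\<mu> V') Y) (e_hom f')"
    then show "z = val (val (\<mu> V) Y) (e_hom f)" using cocone_agree[OF \<mu> cc V] by metis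
  qed
  have uH: "mkT C H M u \<in> Hom CSet H M"
  proof (rule mkT_Hom[OF HO M])
    fix Y s assume Y: "Y \<in> Obj C" and s: "s \<in> ob H Y"
    obtain V f where V: "V \<in> U" "f \<in> Hom C (Dom C (r V)) Y" "s = germ_code (r V, f)" using H_obE[OF s Y] .
    show "u Y s \<in> ob M Y"
      unfolding V(3) u[OF V(1,2)] using functor_cat_HomD(4)[OF \<mu>[OF V(1)] Y] V(2) Y by (simp add: hom.hom_functor_ob)
  next
    fix g s assume g: "g \<in> Arr C" and s: "s \<in> ob H (Dom C g)"
    obtain V f where V: "V \<in> U" "f \<in> Hom C (Dom C (r V)) (Dom C g)" "s = germ_code (r V, f)"
      using H_obE[OF s] g by auto
    have gf: "g \<cdot> f \<in> Hom C (Dom C (r V)) (Cod C g)" using V(2) g by (simp add: Hom_iff)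
    have "act H g s = germ_code (r V, g \<cdot> f)" unfolding V(3) using H_act[OF rep_r[OF V(1,2)] g] by simp
    moreover have "act M g (val (val (\<mu> V) (Dom C g)) (e_hom f)) = val (val (\<mu> V) (Cod C g)) (e_hom (g \<cdot> f))"
      using functor_cat_HomD(5)[OF \<mu>[OF V(1)] g, of "e_hom f"] V(2) g hom.hom_functor_act[OF g V(2)]
      by (simp add: hom.hom_functor_ob)
    ultimately show "act M g (u (Dom C g) s) = u (Cod C g) (act H g s)"
      using u[OF V(1,2)] u[OF V(1) gf] V(3) by simp
  qed
  have comp: "Comp CSet (mkT C H M t) (ultrahom_leg V) = mkT C (hom_functor e_hom C (Dom C (r V))) M
      (\<lambda>Y s. t Y (germ_code (r V, inv_into (Hom C (Dom C (r V)) Y) e_hom s)))" if "V \<in> U" for t V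
    using mkT_HomD(3)[OF ultrahom_leg_Hom[OF that, unfolded ultrahom_leg_def]] unfolding ultrahom_leg_def by (rule Comp_mkT)
  show "\<exists>!v. v \<in> Hom CSet H M \<and> (\<forall>V \<in> U. Comp CSet v (ultrahom_leg V) = \<mu> V)"
  proof (rule ex1I[of _ "mkT C H M u"], intro conjI ballI uH)
    fix V assume V: "V \<in> U"
    have "\<mu> V = mkT C (hom_functor e_hom C (Dom C (r V))) M (\<lambda>Y. val (val (\<mu> V) Y))"
      by (rule functor_cat_HomD(1)[OF \<mu>[OF V]])
    also have "\<dots> = Comp CSet (mkT C H M u) (ultrahom_leg V)"
      unfolding comp[OF V]
    proof (rule mkT_cong)
      fix Y s assume "Y \<in> Obj C" "s \<in> ob (hom_functor e_hom C (Dom C (r V))) Y"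
      then obtain f where f: "f \<in> Hom C (Dom C (r V)) Y" "s = e_hom f" by (auto simp: hom.hom_functor_ob)
      then show "val (val (\<mu> V) Y) s = u Y (germ_code (r V, inv_into (Hom C (Dom C (r V)) Y) e_hom s))"
        using u[OF V f(1)] hom.inv_e by simp
    qed
    finally show "Comp CSet (mkT C H M u) (ultrahom_leg V) = \<mu> V" by simp
  next
    fix v assume v: "v \<in> Hom CSet H M \<and> (\<forall>V \<in> U. Comp CSet v (ultrahom_leg V) = \<mu> V)"
    then have vH: "v \<in> Hom CSet H M" by blast
    obtain t where vt: "v = mkT C H M t" using functor_cat_HomD(1)[OF vH] by blast
    show "v = mkT C H M u"
      unfolding vt
    proof (rule mkT_cong)
      fix Y s assume Y: "Y \<in> Obj C" and s: "s \<in> ob H Y"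
      obtain V f where V: "V \<in> U" "f \<in> Hom C (Dom C (r V)) Y" "s = germ_code (r V, f)" using H_obE[OF s Y] .
      have "\<mu> V = mkT C (hom_functor e_hom C (Dom C (r V))) M
          (\<lambda>Y s. t Y (germ_code (r V, inv_into (Hom C (Dom C (r V)) Y) e_hom s)))"
        using v V(1) comp[OF V(1), of t] vt by simp
      then have "val (val (\<mu> V) Y) (e_hom f) = t Y s"
        using Y V by (simp add: mkT_sel(3) hom.hom_functor_ob hom.inv_e)
      then show "t Y s = u Y s" using u[OF V(1,2)] V(3) by simp
    qed
  qed
qed

text \<open>Any other colimit is isomorphic to H and inherits the splitting of coproducts by
  \<open>FC_iso_closed\<close>. The functor \<open>tilde C\<close> preserves this isomorphism, and
  the unit at the representable functor identifies the image of H.\<close>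

lemma ultrahom:
  "is_ultrahom e_hom C r U H"
  "is_ultrahom e_hom C r U H' \<Longrightarrow> H' \<in> Obj FCSet \<and> isomorphic FCSet H H' \<and>
     isomorphic UFSet (tilde_ob C H') (hom_functor e_uf (UF C) (X, U))"
proof -
  show "is_ultrahom e_hom C r U H" using H_colimit by (auto simp: is_ultrahom_def)
  assume "is_ultrahom e_hom C r U H'"
  then obtain \<kappa> where \<kappa>: "is_colimit J CSet (ultrahom_diagram e_hom C r) H' \<kappa>" by (auto simp: is_ultrahom_def)
  have iso: "isomorphic CSet H H'" by (rule colimit_unique[OF category_CSet H_colimit \<kappa>])
  have FCiso: "isomorphic FCSet H H'" by (rule isomorphic_FC[OF H_Obj iso])
  then have "isomorphic FCSet H' H" by (rule category.isomorphic_sym[OF category_FCSet])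
  then have "isomorphic UFSet (tilde_ob C H') (tilde_ob C H)"
    using functor_preserves_isomorphic[OF tilde_functor] by (simp add: tilde_def)
  moreover have "isomorphic UFSet (tilde_ob C H) (hom_functor e_uf (UF C) (X, U))"
    unfolding isomorphic_def using unit[OF uf.hom_functor_Obj] by blast
  ultimately have "isomorphic UFSet (tilde_ob C H') (hom_functor e_uf (UF C) (X, U))"
    by (rule category.isomorphic_trans[OF category_UFSet])
  then show "H' \<in> Obj FCSet \<and> isomorphic FCSet H H' \<and>
     isomorphic UFSet (tilde_ob C H') (hom_functor e_uf (UF C) (X, U))"
    using FC_iso_closed[OF H_Obj iso] FCiso by blast
qed

end

end

text \<open>The diagram depends on a choice r of representatives, and its colimit is determined only
  up to isomorphism; hence both are universally quantified. The three injections are the price of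
  having a single type as universe of sets.\<close>

theorem theorem22:
  fixes C :: "('o, 'a) cat"
    and e_hom :: "'a \<Rightarrow> 's"
    and e_uf :: "(('o, 'a) uf, ('a \<times> 'a) set) arrow \<Rightarrow> 's"
    and e_pair :: "'a set set \<times> 's \<Rightarrow> 's"
  assumes "extensive C"
    and "\<And>X Y. X \<in> Obj C \<Longrightarrow> Y \<in> Obj C \<Longrightarrow> inj_on e_hom (Hom C X Y)"
    and "\<And>P Q. P \<in> Obj (UF C) \<Longrightarrow> Q \<in> Obj (UF C) \<Longrightarrow> inj_on e_uf (Hom (UF C) P Q)"
    and "\<And>Y. Y \<in> Obj C \<Longrightarrow> inj_on e_pair (ultrafilters C Y \<times> UNIV)"
  shows "equivalence (FC C) (functor_cat (UF C) (Set_cat :: ('s set, _) cat))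
           (tilde C) (int_functor e_pair C)
    \<and> (\<forall>X \<in> Obj C. \<forall>\<U> \<in> ultrafilters C X. \<forall>r. (\<forall>U \<in> \<U>. r U \<in> U) \<longrightarrow>
         (\<exists>H. is_ultrahom e_hom C r \<U> H) \<and>
         (\<forall>H. is_ultrahom e_hom C r \<U> H \<longrightarrow>
            H \<in> Obj (FC C) \<and>
            isomorphic (FC C) (ob (int_functor e_pair C) (hom_functor e_uf (UF C) (X, \<U>))) H \<and>
            isomorphic (functor_cat (UF C) Set_cat)
              (ob (tilde C) H) (hom_functor e_uf (UF C) (X, \<U>))))"
proof -
  have "category C" using assms(1) by (simp add: extensive_def)
  then interpret extensive_universe C e_hom e_uf e_pair
    by (intro extensive_universe.intro extensive_category.intro extensive_category_axioms.intro
        extensive_universe_axioms.intro assms)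
  have sel: "ob (tilde C) A = tilde_ob C A" "ob (int_functor e_pair C) B = int_ob e_pair C B" for A B
    by (simp_all add: tilde_def int_functor_def)
  show ?thesis
    unfolding sel
  proof (intro conjI[OF equivalence_tilde_int] ballI allI impI)
    fix X \<U> r assume U: "\<U> \<in> ultrafilters C X" and r: "\<forall>U \<in> \<U>. r U \<in> U"
    note u = ultrahom[OF U r[rule_format]]
    show "(\<exists>H. is_ultrahom e_hom C r \<U> H) \<and>
         (\<forall>H. is_ultrahom e_hom C r \<U> H \<longrightarrow> H \<in> Obj (FC C) \<and>
            isomorphic (FC C) (int_ob e_pair C (hom_functor e_uf (UF C) (X, \<U>))) H \<and>
            isomorphic (functor_cat (UF C) Set_cat) (tilde_ob C H) (hom_functor e_uf (UF C) (X, \<U>)))"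
      using u by blast
  qed
qed

end
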